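(* Let $z_0\in\mathcal H$ and $\ell\in\mathcal U(z_0;D(A))$. Then there exists a unique solution $z\in H^1(0,T;\mathcal H)$ of $\dot z\in A(R\ell-Qz)$, $z(0)=z_0$. Moreover there is a constant $C>0$, independent of $z_0$ and $\ell$, such that $$\|z\|_{C([0,T];\mathcal H)}\le C\big(1+\|z_0\|_{\mathcal H}+\|\ell\|_{C([0,T];\mathcal X)}+\|\dot\ell\|_{L^1(0,T;\mathcal X)}\big),$$ $$\|\dot z\|_{L^2(0,T;\mathcal H)}\le C\Big(\|\dot\ell\|_{L^2(0,T;\mathcal X)}+\sup_{\tau\in[0,T]}\|A^0(R\ell(\tau)-Qz(\tau))\|_{\mathcal H}\Big).$$
   Context: Fix $T>0$. $\mathcal X,\mathcal X_c,\mathcal Y,\mathcal Z,\mathcal W$ are real Banach spaces, $\mathcal X_c$ is reflexive and compactly embedded in $\mathcal X$, and $\mathcal H$ is a real separable Hilbert space with continuous embeddings $\mathcal Y\hookrightarrow\mathcal Z\hookrightarrow\mathcal H\hookrightarrow\mathcal W$. $H^1(0,T;\mathcal V)$, $L^p(0,T;\mathcal V)$, $C([0,T];\mathcal V)$ denote Bochner(–Sobolev) spaces and $\dot z$ the time derivative. $A:\mathcal H\to2^{\mathcal H}$ is maximal monotone with closed domain $D(A)$, and its minimal section $A^0:D(A)\to\mathcal H$, $A^0(h)=\operatorname{argmin}_{v\in A(h)}\|v\|_{\mathcal H}$, is bounded on bounded sets. For $\lambda>0$, $R_\lambda=(I+\lambda A)^{-1}$ is the resolvent and $A_\lambda=\lambda^{-1}(I-R_\lambda)$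 the Yosida approximation. $R\in L(\mathcal X;\mathcal Y)$ (hence $R\in L(\mathcal X;\mathcal H)$) and $Q\in L(\mathcal W)$ whose restrictions to $\mathcal H,\mathcal Z,\mathcal Y$ map these spaces boundedly into themselves (denoted again $Q$); as an operator on $\mathcal H$, $Q$ is self-adjoint and coercive with constant $\gamma_Q>0$, i.e. $(Qh,h)_{\mathcal H}\ge\gamma_Q\|h\|_{\mathcal H}^2$. Given $z_0\in\mathcal H$ and $\ell\in H^1(0,T;\mathcal X)$, a solution of the state equation $\dot z\in A(R\ell-Qz)$, $z(0)=z_0$, is $z\in H^1(0,T;\mathcal H)$ with $z(0)=z_0$ and $\dot z(t)\in A(R\ell(t)-Qz(t))$ for a.e. $t\in(0,T)$. For $M\subset D(A)$, $\mathcal U(z_0;M)=\{\ell\in H^1(0,T;\mathcal X):R\ell(0)-Qz_0\in M\}$. *)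

theory Defs
  imports "HOL-Analysis.Analysis"
begin

definition strongly_measurable_on :: "real set \<Rightarrow> (real \<Rightarrow> 'a::real_normed_vector) \<Rightarrow> bool" where
  "strongly_measurable_on S f \<longleftrightarrow>
     (\<exists>s::nat \<Rightarrow> real \<Rightarrow> 'a.
        (\<forall>n. finite (range (s n)) \<and> (\<forall>y. s n -` {y} \<in> sets lebesgue)) \<and>
        (AE t in lebesgue. t \<in> S \<longrightarrow> (\<lambda>n. s n t) \<longlonglongrightarrow> f t))"

text \<open>v is an L^2(0,T;V) function (strongly measurable, square integrable norm) and
  f(t) = f(0) + \<integral>_0^t v for all t in [0,T].  For Bochner integrable v the
  (Henstock--Kurzweil) integral used here coincides with the Bochner integral.\<close>
definition H1 :: "real \<Rightarrow> (real \<Rightarrow> 'a::banach) \<Rightarrow> bool" where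
  "H1 T f \<longleftrightarrow>
     (\<exists>v. strongly_measurable_on {0..T} v \<and>
          set_integrable lebesgue {0..T} (\<lambda>t. (norm (v t))\<^sup>2) \<and>
          (\<forall>t\<in>{0..T}. (v has_integral (f t - f 0)) {0..t}))"

definition sup_norm_on :: "real \<Rightarrow> (real \<Rightarrow> 'a::real_normed_vector) \<Rightarrow> real" where
  "sup_norm_on T f = Sup ((\<lambda>t. norm (f t)) ` {0..T})"

definition L1_norm_on :: "real \<Rightarrow> (real \<Rightarrow> 'a::real_normed_vector) \<Rightarrow> real" where
  "L1_norm_on T f = set_lebesgue_integral lebesgue {0..T} (\<lambda>t. norm (f t))"

definition L2_norm_on :: "real \<Rightarrow> (real \<Rightarrow> 'a::real_normed_vector) \<Rightarrow> real" where
  "L2_norm_on T f = sqrt (set_lebesgue_integral lebesgue {0..T} (\<lambda>t. (norm (f t))\<^sup>2))"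

text \<open>Time derivative (exists a.e. for H^1 functions and equals the weak derivative a.e.).\<close>
definition tderiv :: "(real \<Rightarrow> 'a::real_normed_vector) \<Rightarrow> real \<Rightarrow> 'a" where
  "tderiv f t = vector_derivative f (at t)"

definition monotone_op :: "('h::real_inner \<Rightarrow> 'h set) \<Rightarrow> bool" where
  "monotone_op A \<longleftrightarrow> (\<forall>x y u v. u \<in> A x \<longrightarrow> v \<in> A y \<longrightarrow> 0 \<le> inner (u - v) (x - y))"

definition maximal_monotone :: "('h::real_inner \<Rightarrow> 'h set) \<Rightarrow> bool" where
  "maximal_monotone A \<longleftrightarrow> monotone_op A \<and>
     (\<forall>B. monotone_op B \<and> (\<forall>x. A x \<subseteq> B x) \<longrightarrow> B = A)"

definition dom_op :: "('h \<Rightarrow> 'h set) \<Rightarrow> 'h set" where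
  "dom_op A = {x. A x \<noteq> {}}"

definition min_section :: "('h::real_normed_vector \<Rightarrow> 'h set) \<Rightarrow> 'h \<Rightarrow> 'h" where
  "min_section A h = (THE v. v \<in> A h \<and> (\<forall>w\<in>A h. norm v \<le> norm w))"

definition is_solution ::
  "real \<Rightarrow> ('h::{real_inner,banach} \<Rightarrow> 'h set) \<Rightarrow> ('x::banach \<Rightarrow> 'h) \<Rightarrow> ('h \<Rightarrow> 'h)
     \<Rightarrow> 'h \<Rightarrow> (real \<Rightarrow> 'x) \<Rightarrow> (real \<Rightarrow> 'h) \<Rightarrow> bool" where
  "is_solution T A R Q z0 l z \<longleftrightarrow>
     H1 T z \<and> z 0 = z0 \<and>
     (AE t in lebesgue. t \<in> {0<..<T} \<longrightarrow> tderiv z t \<in> A (R (l t) - Q (z t)))"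

definition admissible ::
  "real \<Rightarrow> ('x::banach \<Rightarrow> 'h::{real_inner,banach}) \<Rightarrow> ('h \<Rightarrow> 'h) \<Rightarrow> 'h \<Rightarrow> 'h set
     \<Rightarrow> (real \<Rightarrow> 'x) set" where
  "admissible T R Q z0 M = {l. H1 T l \<and> R (l 0) - Q z0 \<in> M}"

end

theory Submission
  imports Defs
begin

text \<open>Existence: the implicit Euler steps \<open>\<xi>\<^sub>k \<in> A (R l(t\<^sub>k) - Q z\<^sub>k)\<close> are solvable by a Minty
  argument for the coercive symmetric operator \<open>\<tau> Q\<close>. The states \<open>R l - Q z\<close> stay in the domain, so
  the minimal section bounds the slopes by a square integrable function independent of the step size.
  Monotonicity makes the interpolants uniformly Cauchy. Their slopes are bounded in \<open>L\<^sup>2\<close>; convex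
  combinations of them converge strongly, so the limit \<open>z\<close> is in \<open>H\<^sup>1\<close>, and by maximality \<open>z'(t)\<close> lies in
  \<open>A (R l(t) - Q z(t))\<close> wherever \<open>z\<close> is differentiable, which by Lebesgue's differentiation theorem
  is almost everywhere. The bound on \<open>z'\<close> follows from monotonicity between the times \<open>s < t\<close> as
  \<open>s \<rightarrow> t\<close>.\<close>

section \<open>Lebesgue differentiation\<close>

text \<open>The order of the estimates avoids a circle. The states are bounded by comparison with
  one fixed pair of the graph of \<open>A\<close>, which involves only norms of the data. This fixes
  the ball on which the minimal section is bounded, and only then can the slopes be bounded. Their
  bound depends on that ball, hence on \<open>z0\<close> and \<open>l\<close>: enough for the limit,
  too weak for the second estimate, which is therefore derived from the limit inclusion itself.
  Since \<open>A\<close> acts on \<open>R l - Q z\<close>, monotonicity for the difference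
  \<open>e\<close> of two trajectories says that \<open>inner (Q e) e'\<close> is nonpositive, so
  the energy \<open>inner (Q e) e\<close> cannot grow. An Euler interpolant satisfies the inclusion
  only at a slightly displaced argument; the displacement costs its size times the L1 norm of
  \<open>e'\<close>, which is bounded. In the limit inclusion, too, slopes enter only through
  integrals over short intervals, where uniform convergence of the trajectories suffices. Closedness
  of the domain puts \<open>R l - Q z\<close> into it at every time, so that the supremum in the
  second estimate controls the minimal section at all earlier times.\<close>

lemma one_over_Suc_tendsto_0: "(\<lambda>n. 1 / real (Suc n)) \<longlonglongrightarrow> 0"
  using LIMSEQ_inverse_real_of_nat by (simp add: inverse_eq_divide)

text \<open>Inner regularity gives closed subsets of \<open>P\<close> that miss ever less measure.
  Their finite unions stay closed and exhaust \<open>P\<close> up to a null set, so dominated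
  convergence makes the remaining integral small.\<close>

lemma integral_small_outside_closed:
  fixes h :: "real \<Rightarrow> real"
  assumes h: "integrable lebesgue h" and P: "P \<in> sets lebesgue" and e: "e > 0"
  obtains F where "closed F" "F \<subseteq> P" "(LINT x|lebesgue. indicator (P - F) x * \<bar>h x\<bar>) < e"
proof -
  have "\<exists>F. closed F \<and> F \<subseteq> P \<and> emeasure lebesgue (P - F) < ennreal (1 / Suc n)" for n
    using sets_lebesgue_inner_closed [OF P, of "1 / Suc n"] by (metis of_nat_0_less_iff zero_less_Suc zero_less_divide_1_iff)
  then obtain F where F: "\<And>n. closed (F n)" "\<And>n. F n \<subseteq> P"
      "\<And>n. emeasure lebesgue (P - F n) < ennreal (1 / Suc n)"
    by metis
  define G where "G n = (\<Union>k\<le>n. F k)" for n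
  have clG: "closed (G n)" for n
    unfolding G_def using F(1) by auto
  have GP: "G n \<subseteq> P" for n
    unfolding G_def using F(2) by auto
  have Fm: "F n \<in> sets lebesgue" for n
    using F(1) by (simp add: borel_closed)
  have Gm: "G n \<in> sets lebesgue" for n
    using clG by (simp add: borel_closed)
  have null: "P - (\<Union>k. F k) \<in> null_sets lebesgue"
  proof (rule null_setsI)
    show m: "P - (\<Union>k. F k) \<in> sets lebesgue"
      using P Fm by auto
    have le: "emeasure lebesgue (P - (\<Union>k. F k)) \<le> ennreal (1 / Suc n)" for n
    proof -
      have "emeasure lebesgue (P - (\<Union>k. F k)) \<le> emeasure lebesgue (P - F n)"
        using P Fm by (intro emeasure_mono) auto
      then show ?thesis using F(3)[of n] by (meson less_imp_le order_trans)
    qed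
    have "(\<lambda>n. ennreal (1 / Suc n)) \<longlonglongrightarrow> ennreal 0"
      by (intro tendsto_ennrealI one_over_Suc_tendsto_0)
    then have "emeasure lebesgue (P - (\<Union>k. F k)) \<le> ennreal 0"
      by (rule LIMSEQ_le_const) (use le in blast)
    then show "emeasure lebesgue (P - (\<Union>k. F k)) = 0" by simp
  qed
  have "(\<lambda>n. LINT x|lebesgue. (indicator (P - G n) x * \<bar>h x\<bar> :: real)) \<longlonglongrightarrow> (LINT x::real|lebesgue. (0::real))"
  proof (rule integral_dominated_convergence[where w="\<lambda>x. \<bar>h x\<bar>"])
    show "(\<lambda>x. indicator (P - G n) x * \<bar>h x\<bar>) \<in> borel_measurable lebesgue" for n
      using P Gm h by (intro borel_measurable_times borel_measurable_indicator borel_measurable_abs) auto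
    show "integrable lebesgue (\<lambda>x. \<bar>h x\<bar>)" using h by (rule integrable_abs)
    show "AE x in lebesgue. norm (indicator (P - G n) x * \<bar>h x\<bar>) \<le> \<bar>h x\<bar>" for n
      by (auto simp: indicator_def)
    have "AE x in lebesgue. x \<notin> P - (\<Union>k. F k)" by (rule AE_not_in [OF null])
    then show "AE x in lebesgue. (\<lambda>n. indicator (P - G n) x * \<bar>h x\<bar>) \<longlonglongrightarrow> 0"
    proof (eventually_elim)
      case (elim x)
      have "\<exists>N. \<forall>n\<ge>N. x \<notin> P - G n"
        using elim unfolding G_def by blast
      then have "\<forall>\<^sub>F n in sequentially. indicator (P - G n) x * \<bar>h x\<bar> = 0"
        unfolding eventually_sequentially by (auto simp: indicator_def)
      then show ?case by (rule tendsto_eventually)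
    qed
  qed simp
  then have "(\<lambda>n. LINT x|lebesgue. indicator (P - G n) x * \<bar>h x\<bar>) \<longlonglongrightarrow> 0" by simp
  then have "\<forall>\<^sub>F n in sequentially. (LINT x|lebesgue. indicator (P - G n) x * \<bar>h x\<bar>) < e"
    using e by (rule order_tendstoD)
  then obtain n where "(LINT x|lebesgue. indicator (P - G n) x * \<bar>h x\<bar>) < e"
    by (meson eventually_happens trivial_limit_sequentially)
  then show thesis using that clG GP by blast
qed

text \<open>Nearly all mass of \<open>h\<close> sits on a closed set \<open>F\<close> that avoids
  the zeros of \<open>h\<close>. Small intervals around points of the set can therefore be kept away
  from \<open>F\<close>. A disjoint Vitali subfamily covers the set up to a null set, and its total
  length is at most the integral of \<open>h\<close> off \<open>F\<close> divided by
  \<open>\<delta>\<close>.\<close>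

lemma negligible_large_averages_at_zeros:
  fixes h :: "real \<Rightarrow> real"
  assumes h: "integrable lebesgue h" and h0: "\<And>x. h x \<ge> 0" and \<delta>: "\<delta> > 0"
  shows "negligible {t. h t = 0 \<and> (\<forall>d>0. \<exists>c r. 0 < r \<and> r < d \<and> t \<in> cball c r \<and>
            \<delta> * (2 * r) < (LINT x|lebesgue. indicator (cball c r) x * h x))}" (is "negligible ?E")
  unfolding negligible_outer_le
proof (intro allI impI)
  fix e :: real assume e: "e > 0"
  have hm: "h \<in> borel_measurable lebesgue" using h by auto
  define P where "P = {x. h x \<noteq> 0}"
  have Pm: "P \<in> sets lebesgue"
  proof -
    have "P = {x \<in> space lebesgue. h x \<noteq> 0}" by (simp add: P_def)
    also have "\<dots> \<in> sets lebesgue" using hm by measurable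
    finally show ?thesis .
  qed
  obtain F where F: "closed F" "F \<subseteq> P" "(LINT x|lebesgue. indicator (P - F) x * \<bar>h x\<bar>) < e * \<delta>"
    using integral_small_outside_closed [OF h Pm, of "e * \<delta>"] e \<delta> by auto
  have Fm: "F \<in> sets lebesgue" using F(1) by (simp add: borel_closed)
  define K where "K = {(c, r). 0 < r \<and> cball c r \<inter> F = {} \<and>
      \<delta> * (2 * r) < (LINT x|lebesgue. indicator (cball c r) x * h x)}"
  have cover: "\<exists>i. i \<in> K \<and> x \<in> cball (fst i) (snd i) \<and> snd i < d" if x: "x \<in> ?E" and d: "0 < d" for x d
  proof -
    have "x \<notin> F" using x F(2) by (auto simp: P_def)
    then obtain d' where d': "d' > 0" "ball x d' \<inter> F = {}"
      using F(1) by (meson ComplI disjoint_eq_subset_Compl open_Compl openE)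
    from x obtain c r where cr: "0 < r" "r < min d (d' / 3)" "x \<in> cball c r"
       "\<delta> * (2 * r) < (LINT x|lebesgue. indicator (cball c r) x * h x)"
    proof -
      have "0 < min d (d' / 3)" using d d' by simp
      then show thesis using x that by blast
    qed
    have "cball c r \<subseteq> ball x d'"
    proof
      fix y assume "y \<in> cball c r"
      then show "y \<in> ball x d'" using cr(1-3) by (auto simp: dist_real_def)
    qed
    then have "(c, r) \<in> K" using cr d' by (auto simp: K_def)
    then show ?thesis using cr by force
  qed
  obtain C where C: "countable C" "C \<subseteq> K"
     "pairwise (\<lambda>i j. disjnt (cball (fst i) (snd i)) (cball (fst j) (snd j))) C"
     "negligible (?E - (\<Union>i \<in> C. cball (fst i) (snd i)))"
  proof (rule Vitali_covering_theorem_cballs [of K snd ?E fst])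
    show "0 < snd i" if "i \<in> K" for i using that by (auto simp: K_def)
  qed (use cover in auto)
  define U where "U = (\<Union>i \<in> C. cball (fst i) (snd i))"
  have Um: "U \<in> sets lebesgue"
    unfolding U_def using C(1) by (intro sets.countable_UN'') auto
  \<comment> \<open>As values of a measure, the integrals over disjoint intervals add up by
    countable additivity.\<close>
  define N where "N = density lebesgue (\<lambda>x. ennreal (h x))"
  have N_eq: "emeasure N X = ennreal (LINT x|lebesgue. indicator X x * h x)" if "X \<in> sets lebesgue" for X
  proof -
    have i: "integrable lebesgue (\<lambda>x. indicator X x * h x)"
      using that h by (rule integrable_mult_indicator[where 'b=real, simplified real_scaleR_def])
    have "emeasure N X = (\<integral>\<^sup>+x. ennreal (h x) * indicator X x \<partial>lebesgue)"
      unfolding N_def using hm that by (intro emeasure_density) auto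
    also have "\<dots> = (\<integral>\<^sup>+x. ennreal (indicator X x * h x) \<partial>lebesgue)"
      by (intro nn_integral_cong) (auto simp: indicator_def)
    also have "\<dots> = ennreal (LINT x|lebesgue. indicator X x * h x)"
      by (rule nn_integral_eq_integral [OF i]) (simp add: h0)
    finally show ?thesis .
  qed
  have disj: "disjoint_family_on (\<lambda>i. cball (fst i) (snd i)) C"
    using C(3) by (auto simp: disjoint_family_on_def pairwise_def disjnt_def)
  have "ennreal \<delta> * emeasure lebesgue U = ennreal \<delta> * (\<integral>\<^sup>+i. emeasure lebesgue (cball (fst i) (snd i)) \<partial>count_space C)"
    unfolding U_def by (subst emeasure_UN_countable [OF _ C(1) disj]) auto
  also have "\<dots> = (\<integral>\<^sup>+i. ennreal \<delta> * emeasure lebesgue (cball (fst i) (snd i)) \<partial>count_space C)"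
    by (simp add: nn_integral_cmult)
  also have "\<dots> \<le> (\<integral>\<^sup>+i. emeasure N (cball (fst i) (snd i)) \<partial>count_space C)"
  proof (rule nn_integral_mono)
    fix i assume "i \<in> space (count_space C)"
    then have "i \<in> K" using C(2) by auto
    then obtain c r where i: "i = (c, r)" "0 < r" "\<delta> * (2 * r) < (LINT x|lebesgue. indicator (cball c r) x * h x)"
      by (auto simp: K_def)
    have "emeasure lebesgue (cball c r) = ennreal (2 * r)"
      using i(2) by (simp add: cball_eq_atLeastAtMost)
    then show "ennreal \<delta> * emeasure lebesgue (cball (fst i) (snd i)) \<le> emeasure N (cball (fst i) (snd i))"
      using i \<delta> by (simp add: N_eq ennreal_mult [symmetric] ennreal_leI)
  qed
  also have "\<dots> = emeasure N U"
    unfolding U_def by (subst emeasure_UN_countable [OF _ C(1) disj]) (auto simp: N_def)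
  also have "\<dots> = ennreal (LINT x|lebesgue. indicator U x * h x)" by (rule N_eq [OF Um])
  also have "\<dots> \<le> ennreal (e * \<delta>)"
  proof (rule ennreal_leI)
    have "cball (fst i) (snd i) \<inter> F = {}" if "i \<in> C" for i
      using C(2) that unfolding K_def by fastforce
    then have UF: "U \<inter> F = {}" unfolding U_def by blast
    have "(LINT x|lebesgue. indicator U x * h x) \<le> (LINT x|lebesgue. indicator (P - F) x * \<bar>h x\<bar>)"
    proof (rule integral_mono)
      show "integrable lebesgue (\<lambda>x. indicator U x * h x)"
        using Um h by (rule integrable_mult_indicator[where 'b=real, simplified real_scaleR_def])
      show "integrable lebesgue (\<lambda>x. indicator (P - F) x * \<bar>h x\<bar>)"
        using Pm Fm h by (intro integrable_mult_indicator[where 'b=real, simplified real_scaleR_def]) auto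
      show "indicator U x * h x \<le> indicator (P - F) x * \<bar>h x\<bar>" for x
        using UF by (auto simp: indicator_def P_def)
    qed
    then show "(LINT x|lebesgue. indicator U x * h x) \<le> e * \<delta>" using F(3) by simp
  qed
  finally have "ennreal \<delta> * emeasure lebesgue U \<le> ennreal \<delta> * ennreal e"
    using e \<delta> by (simp add: ennreal_mult [symmetric] mult.commute)
  then have Ue: "emeasure lebesgue U \<le> ennreal e"
    using \<delta> by (subst (asm) ennreal_mult_le_mult_iff) auto
  then have Ul: "U \<in> lmeasurable" "measure lebesgue U \<le> e"
    using Um e by (auto simp: fmeasurable_def measure_def enn2real_leI intro: le_less_trans)
  define Z where "Z = ?E - U"
  have "negligible Z" using C(4) by (simp add: U_def Z_def)
  then have Z: "Z \<in> lmeasurable" "measure lebesgue Z = 0"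
    by (simp_all add: negligible_imp_measurable negligible_imp_measure0)
  have "?E \<subseteq> U \<union> Z" by (auto simp: Z_def)
  moreover have "U \<union> Z \<in> lmeasurable" using Ul Z by blast
  moreover have "measure lebesgue (U \<union> Z) \<le> e"
    using measure_Un_le[of U lebesgue Z] Ul Z by (simp add: fmeasurableD)
  ultimately show "\<exists>T. ?E \<subseteq> T \<and> T \<in> lmeasurable \<and> measure lebesgue T \<le> e" by blast
qed

text \<open>The excess of \<open>g\<close> over a level \<open>q\<close> vanishes where
  \<open>g\<close> is at most \<open>q\<close>, so near almost every such point its averages are
  small. Rational levels keep the exceptional set null, and some rational level lies just above
  \<open>g t\<close>.\<close>

lemma AE_averages_upper_bound:
  fixes g :: "real \<Rightarrow> real"
  assumes g: "integrable lebesgue g" and g0: "\<And>x. g x \<ge> 0"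
  shows "AE t in lebesgue. \<forall>\<eta>>0. \<exists>d>0. \<forall>a b. a \<le> t \<longrightarrow> t \<le> b \<longrightarrow> b - a < d \<longrightarrow>
           integral {a..b} g \<le> (g t + \<eta>) * (b - a)"
proof -
  define h where "h q x = max (g x - q) 0" for q x :: real
  \<comment> \<open>A nonnegative level makes \<open>g\<close> dominate its truncated excess; for a
    negative one the excess is bounded below by a positive constant on the whole line.\<close>
  have hint: "integrable lebesgue (h q)" if "q \<ge> 0" for q
  proof (rule Bochner_Integration.integrable_bound [OF g])
    show "h q \<in> borel_measurable lebesgue" unfolding h_def using g by measurable
    show "AE x in lebesgue. norm (h q x) \<le> norm (g x)"
      using g0 that by (auto simp: h_def)
  qed
  define E where "E q \<delta> = {t. h q t = 0 \<and> (\<forall>d>0. \<exists>c r. 0 < r \<and> r < d \<and> t \<in> cball c r \<and>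
            \<delta> * (2 * r) < (LINT x|lebesgue. indicator (cball c r) x * h q x))}" for q \<delta> :: real
  have neg: "negligible (E q \<delta>)" if "q \<ge> 0" "\<delta> > 0" for q \<delta>
    unfolding E_def using hint[OF that(1)] _ that(2)
    by (rule negligible_large_averages_at_zeros) (simp add: h_def)
  have "AE t in lebesgue. \<forall>q\<in>\<rat> \<inter> {0..}. \<forall>\<delta>\<in>\<rat> \<inter> {0<..}. t \<notin> E q \<delta>"
  proof (subst AE_ball_countable, simp add: countable_rat countable_Int1, intro ballI)
    fix q :: real assume q: "q \<in> \<rat> \<inter> {0..}"
    show "AE t in lebesgue. \<forall>\<delta>\<in>\<rat> \<inter> {0<..}. t \<notin> E q \<delta>"
    proof (subst AE_ball_countable, simp add: countable_rat countable_Int1, intro ballI)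
      fix \<delta> :: real assume \<delta>: "\<delta> \<in> \<rat> \<inter> {0<..}"
      show "AE t in lebesgue. t \<notin> E q \<delta>"
        using neg[of q \<delta>] q \<delta> by (intro AE_not_in) (auto simp: negligible_iff_null_sets)
    qed
  qed
  then show ?thesis
  proof eventually_elim
    case (elim t)
    show ?case
    proof (intro allI impI)
      fix \<eta> :: real assume \<eta>: "\<eta> > 0"
      \<comment> \<open>The slack \<eta> is shared by the level \<open>q\<close> and the bound
        \<delta> on the averages of the excess.\<close>
      obtain q where q: "q \<in> \<rat>" "g t < q" "q < g t + \<eta> / 2"
        using Rats_dense_in_real[of "g t" "g t + \<eta> / 2"] \<eta> by auto
      obtain \<delta> where \<delta>: "\<delta> \<in> \<rat>" "0 < \<delta>" "\<delta> < \<eta> / 2"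
        using Rats_dense_in_real[of 0 "\<eta> / 2"] \<eta> by auto
      have q0: "q \<ge> 0" using q g0[of t] by simp
      have "t \<notin> E q \<delta>" using elim q \<delta> q0 by auto
      moreover have "h q t = 0" using q by (simp add: h_def)
      ultimately obtain d where d: "d > 0" "\<And>c r. 0 < r \<Longrightarrow> r < d \<Longrightarrow> t \<in> cball c r \<Longrightarrow>
            (LINT x|lebesgue. indicator (cball c r) x * h q x) \<le> \<delta> * (2 * r)"
        unfolding E_def mem_Collect_eq by (meson not_less)
      show "\<exists>d>0. \<forall>a b. a \<le> t \<longrightarrow> t \<le> b \<longrightarrow> b - a < d \<longrightarrow> integral {a..b} g \<le> (g t + \<eta>) * (b - a)"
      proof (intro exI[of _ d] conjI allI impI)
        fix a b assume ab: "a \<le> t" "t \<le> b" "b - a < d"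
        show "integral {a..b} g \<le> (g t + \<eta>) * (b - a)"
        proof (cases "a = b")
          case False
          define c r where "c = (a + b) / 2" and "r = (b - a) / 2"
          have cr: "cball c r = {a..b}"
            by (simp add: cball_eq_atLeastAtMost c_def r_def field_simps)
          have hab: "set_integrable lebesgue {a..b} (h q)" and gab: "set_integrable lebesgue {a..b} g"
            unfolding set_integrable_def
            using hint[OF q0] g by (intro integrable_mult_indicator; simp)+
          have hab': "h q integrable_on {a..b}" and gab': "g integrable_on {a..b}"
            using hab gab set_lebesgue_integral_eq_integral(1) by blast+
          have "integral {a..b} (h q) = (LINT x|lebesgue. indicator (cball c r) x * h q x)"
            using set_lebesgue_integral_eq_integral(2)[OF hab] by (simp add: cr set_lebesgue_integral_def)
          also have "\<dots> \<le> \<delta> * (2 * r)"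
            using ab False cr by (intro d(2)) (auto simp: r_def)
          finally have 1: "integral {a..b} (h q) \<le> \<delta> * (b - a)" by (simp add: r_def field_simps)
          have "integral {a..b} g \<le> integral {a..b} (\<lambda>x. q + h q x)"
            using hab' gab' by (intro integral_le integrable_add integrable_const_ivl) (assumption | simp add: h_def)+
          also have "\<dots> = q * (b - a) + integral {a..b} (h q)"
            using hab' ab by (subst integral_add) auto
          also have "\<dots> \<le> (q + \<delta>) * (b - a)" using 1 by (simp add: algebra_simps)
          also have "\<dots> \<le> (g t + \<eta>) * (b - a)" using q \<delta> ab by (intro mult_right_mono) auto
          finally show ?thesis .
        qed simp
      qed (use d in auto)
    qed
  qed
qed

section \<open>Simple functions, strong measurability and Lebesgue points\<close>

definition simple_map :: "(real \<Rightarrow> 'a) \<Rightarrow> bool" where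
  "simple_map s \<longleftrightarrow> finite (range s) \<and> (\<forall>y. s -` {y} \<in> sets lebesgue)"

lemma simple_map_vimage:
  assumes "simple_map s"
  shows "s -` Y \<in> sets lebesgue"
proof -
  have "s -` Y = (\<Union>y\<in>Y \<inter> range s. s -` {y})" by auto
  also have "\<dots> \<in> sets lebesgue"
    using assms unfolding simple_map_def by (intro sets.finite_UN) auto
  finally show ?thesis .
qed

lemma simple_map_comp:
  assumes "simple_map s"
  shows "simple_map (\<lambda>t. F (s t))"
  unfolding simple_map_def
proof (intro conjI allI)
  have "range (\<lambda>t. F (s t)) = F ` range s" by auto
  then show "finite (range (\<lambda>t. F (s t)))" using assms by (simp add: simple_map_def)
  show "(\<lambda>t. F (s t)) -` {y} \<in> sets lebesgue" for y
    using simple_map_vimage[OF assms, of "F -` {y}"] by (simp add: vimage_def)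
qed

lemma simple_map_Pair:
  assumes "simple_map s" "simple_map s'"
  shows "simple_map (\<lambda>t. (s t, s' t))"
  unfolding simple_map_def
proof (intro conjI allI)
  have "range (\<lambda>t. (s t, s' t)) \<subseteq> range s \<times> range s'" by auto
  then show "finite (range (\<lambda>t. (s t, s' t)))"
    using assms finite_subset unfolding simple_map_def by blast
  show "(\<lambda>t. (s t, s' t)) -` {y} \<in> sets lebesgue" for y
  proof -
    have "(\<lambda>t. (s t, s' t)) -` {y} = s -` {fst y} \<inter> s' -` {snd y}"
      by (cases y) auto
    then show ?thesis using assms simple_map_vimage by (metis sets.Int)
  qed
qed

lemma simple_map_comp2:
  assumes "simple_map s" "simple_map s'"
  shows "simple_map (\<lambda>t. F (s t) (s' t))"
  using simple_map_comp[OF simple_map_Pair[OF assms], of "\<lambda>p. F (fst p) (snd p)"]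
  by (simp only: fst_conv snd_conv)

text \<open>\<open>F\<close> may be arbitrary because only finitely many values occur. Norms of
  differences thus become measurable without any Borel structure on the range of
  \<open>s\<close>.\<close>

lemma simple_map_borel_measurable:
  fixes F :: "'a \<Rightarrow> 'b::topological_space"
  assumes "simple_map s"
  shows "(\<lambda>t. F (s t)) \<in> borel_measurable lebesgue"
proof (rule measurableI)
  fix B :: "'b set" assume "B \<in> sets borel"
  show "(\<lambda>t. F (s t)) -` B \<inter> space lebesgue \<in> sets lebesgue"
    using simple_map_vimage[OF assms, of "F -` B"] by (simp add: vimage_def)
qed auto

lemma simple_map_integrable_on:
  fixes s :: "real \<Rightarrow> 'a::real_normed_vector"
  assumes s: "simple_map s"
  shows "s integrable_on {a..b}"
proof -
  have fin: "finite (range s)" using s by (simp add: simple_map_def)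
  have eq: "s = (\<lambda>t. \<Sum>y\<in>range s. indicat_real (s -` {y}) t *\<^sub>R y)"
  proof
    fix t
    have "(\<Sum>y\<in>range s. indicat_real (s -` {y}) t *\<^sub>R y) = (\<Sum>y\<in>range s. if y = s t then y else 0)"
      by (intro sum.cong) (auto simp: indicator_def)
    also have "\<dots> = s t" using fin by simp
    finally show "s t = (\<Sum>y\<in>range s. indicat_real (s -` {y}) t *\<^sub>R y)" by simp
  qed
  have "indicat_real (s -` {y}) integrable_on {a..b}" for y
    unfolding integrable_on_indicator
    using simple_map_vimage[OF s, of "{y}"] lmeasurable_interval(1)[of a b]
    by (simp add: Int_commute fmeasurable_Int_fmeasurable)
  then have "(\<lambda>t. \<Sum>y\<in>range s. indicat_real (s -` {y}) t *\<^sub>R y) integrable_on {a..b}"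
    by (intro integrable_sum fin integrable_on_scaleR_left)
  then show ?thesis using eq by simp
qed

lemma borel_measurable_AE_limit:
  fixes g :: "real \<Rightarrow> real"
  assumes f: "\<And>n. f n \<in> borel_measurable lebesgue" and lim: "AE t in lebesgue. (\<lambda>n. f n t) \<longlonglongrightarrow> g t"
  shows "g \<in> borel_measurable lebesgue"
proof -
  have "(\<lambda>t. lim (\<lambda>n. f n t)) \<in> borel_measurable lebesgue"
    using f by (rule borel_measurable_lim_metric)
  moreover have "AE t in lebesgue. lim (\<lambda>n. f n t) = g t"
    using lim by eventually_elim (rule limI)
  ultimately show ?thesis by (rule borel_measurable_AE)
qed

lemma strongly_measurable_on_obtain:
  assumes "strongly_measurable_on S f"
  obtains s where "\<And>n::nat. simple_map (s n)" "AE t in lebesgue. t \<in> S \<longrightarrow> (\<lambda>n. s n t) \<longlonglongrightarrow> f t"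
  using assms unfolding strongly_measurable_on_def simple_map_def[symmetric] by blast

lemma strongly_measurable_on_diff:
  assumes "strongly_measurable_on S f" "strongly_measurable_on S g"
  shows "strongly_measurable_on S (\<lambda>t. f t - g t)"
proof -
  obtain s where s: "\<And>n::nat. simple_map (s n)" "AE t in lebesgue. t \<in> S \<longrightarrow> (\<lambda>n. s n t) \<longlonglongrightarrow> f t"
    using strongly_measurable_on_obtain[OF assms(1)] by blast
  obtain s' where s': "\<And>n::nat. simple_map (s' n)" "AE t in lebesgue. t \<in> S \<longrightarrow> (\<lambda>n. s' n t) \<longlonglongrightarrow> g t"
    using strongly_measurable_on_obtain[OF assms(2)] by blast
  have "AE t in lebesgue. t \<in> S \<longrightarrow> (\<lambda>n. s n t - s' n t) \<longlonglongrightarrow> f t - g t"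
    using s(2) s'(2) by eventually_elim (auto intro: tendsto_diff)
  moreover have "simple_map (\<lambda>t. s n t - s' n t)" for n
    by (rule simple_map_comp2[OF s(1) s'(1)])
  ultimately show ?thesis
    unfolding strongly_measurable_on_def simple_map_def
    by (intro exI[of _ "\<lambda>n t. s n t - s' n t"]) blast
qed

text \<open>Off \<open>S\<close> the approximants need not converge to \<open>f\<close>, hence the
  indicator.\<close>

lemma strongly_measurable_on_norm:
  assumes f: "strongly_measurable_on S f" and S: "S \<in> sets lebesgue"
  shows "(\<lambda>t. indicat_real S t * norm (f t - x)) \<in> borel_measurable lebesgue"
proof -
  obtain s where s: "\<And>n::nat. simple_map (s n)" "AE t in lebesgue. t \<in> S \<longrightarrow> (\<lambda>n. s n t) \<longlonglongrightarrow> f t"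
    using strongly_measurable_on_obtain[OF f] by blast
  show ?thesis
  proof (rule borel_measurable_AE_limit)
    show "(\<lambda>t. indicat_real S t * norm (s n t - x)) \<in> borel_measurable lebesgue" for n
      using S simple_map_borel_measurable[OF s(1)[of n], of "\<lambda>y. norm (y - x)"]
      by (intro borel_measurable_times borel_measurable_indicator)
    show "AE t in lebesgue. (\<lambda>n. indicat_real S t * norm (s n t - x)) \<longlonglongrightarrow> indicat_real S t * norm (f t - x)"
      using s(2) by eventually_elim (auto simp: indicator_def intro!: tendsto_intros)
  qed
qed

lemma set_integrable_norm_shift:
  assumes f: "strongly_measurable_on {a..b} f" and i: "set_integrable lebesgue {a..b} (\<lambda>t. norm (f t))"
  shows "set_integrable lebesgue {a..b} (\<lambda>t. norm (f t - x))"
proof -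
  have c: "set_integrable lebesgue {a..b} (\<lambda>t. norm x)"
    using integrable_const_ivl[of "norm x" a b] by (intro nonnegative_absolutely_integrable_1) auto
  show ?thesis
    unfolding set_integrable_def
  proof (rule Bochner_Integration.integrable_bound)
    show "integrable lebesgue (\<lambda>t. indicat_real {a..b} t *\<^sub>R norm (f t) + indicat_real {a..b} t *\<^sub>R norm x)"
      using i c unfolding set_integrable_def by (rule Bochner_Integration.integrable_add)
    show "(\<lambda>t. indicat_real {a..b} t *\<^sub>R norm (f t - x)) \<in> borel_measurable lebesgue"
      using strongly_measurable_on_norm[OF f] by simp
    show "AE t in lebesgue. norm (indicat_real {a..b} t *\<^sub>R norm (f t - x))
        \<le> norm (indicat_real {a..b} t *\<^sub>R norm (f t) + indicat_real {a..b} t *\<^sub>R norm x)"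
      by (auto simp: indicator_def norm_triangle_ineq4)
  qed
qed

lemma set_integrable_norm_of_square:
  assumes f: "strongly_measurable_on {a..b} f" and i: "set_integrable lebesgue {a..b} (\<lambda>t. (norm (f t))\<^sup>2)"
  shows "set_integrable lebesgue {a..b} (\<lambda>t. norm (f t))"
proof -
  have c: "set_integrable lebesgue {a..b} (\<lambda>t. 1::real)"
    using integrable_const_ivl[of "1::real" a b] by (intro nonnegative_absolutely_integrable_1) auto
  show ?thesis
    unfolding set_integrable_def
  proof (rule Bochner_Integration.integrable_bound)
    show "integrable lebesgue (\<lambda>t. indicat_real {a..b} t *\<^sub>R 1 + indicat_real {a..b} t *\<^sub>R (norm (f t))\<^sup>2)"
      using c i unfolding set_integrable_def by (rule Bochner_Integration.integrable_add)
    show "(\<lambda>t. indicat_real {a..b} t *\<^sub>R norm (f t)) \<in> borel_measurable lebesgue"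
      using strongly_measurable_on_norm[OF f, of 0] by simp
    have "norm (f t) \<le> 1 + (norm (f t))\<^sup>2" for t
      using sum_power2_ge_zero[of "norm (f t) - 1/2" 0] by (simp add: power2_eq_square algebra_simps)
    then show "AE t in lebesgue. norm (indicat_real {a..b} t *\<^sub>R norm (f t))
        \<le> norm (indicat_real {a..b} t *\<^sub>R 1 + indicat_real {a..b} t *\<^sub>R (norm (f t))\<^sup>2)"
      by (auto simp: indicator_def)
  qed
qed

text \<open>Countably many values of the approximating simple functions are dense in the essential range
  of \<open>f\<close>, so the scalar statement for each \<open>norm (f - x)\<close> suffices.\<close>

lemma AE_lebesgue_point:
  fixes f :: "real \<Rightarrow> 'a::real_normed_vector"
  assumes f: "strongly_measurable_on {a..b} f" and i: "set_integrable lebesgue {a..b} (\<lambda>t. norm (f t))"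
  shows "AE t in lebesgue. t \<in> {a..b} \<longrightarrow> (\<forall>\<eta>>0. \<exists>d>0. \<forall>c e. a \<le> c \<longrightarrow> c \<le> t \<longrightarrow> t \<le> e \<longrightarrow> e \<le> b \<longrightarrow> e - c < d \<longrightarrow>
           integral {c..e} (\<lambda>r. norm (f r - f t)) \<le> \<eta> * (e - c))"
proof -
  obtain s where s: "\<And>n::nat. simple_map (s n)" "AE t in lebesgue. t \<in> {a..b} \<longrightarrow> (\<lambda>n. s n t) \<longlonglongrightarrow> f t"
    using strongly_measurable_on_obtain[OF f] by blast
  define D where "D = (\<Union>n. range (s n))"
  have "countable D"
    unfolding D_def using s(1) by (auto simp: simple_map_def intro: countable_finite)
  have sh: "set_integrable lebesgue {a..b} (\<lambda>t. norm (f t - x))" for x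
    by (rule set_integrable_norm_shift[OF f i])
  have shHK: "(\<lambda>t. norm (f t - x)) integrable_on {c..e}" if "a \<le> c" "e \<le> b" for x c e
    using set_lebesgue_integral_eq_integral(1)[OF sh[of x]] that
    by - (rule integrable_on_subinterval[of _ "{a..b}"], auto)
  \<comment> \<open>Cut off outside \<open>{a..b}\<close>, because
    \<open>AE_averages_upper_bound\<close> asks for integrability on the whole line.\<close>
  define g where "g x t = indicat_real {a..b} t * norm (f t - x)" for x t
  have "AE t in lebesgue. \<forall>x\<in>D. \<forall>\<eta>>0. \<exists>d>0. \<forall>c e. c \<le> t \<longrightarrow> t \<le> e \<longrightarrow> e - c < d \<longrightarrow>
           integral {c..e} (g x) \<le> (g x t + \<eta>) * (e - c)"
  proof (subst AE_ball_countable[OF \<open>countable D\<close>], intro ballI)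
    fix x
    show "AE t in lebesgue. \<forall>\<eta>>0. \<exists>d>0. \<forall>c e. c \<le> t \<longrightarrow> t \<le> e \<longrightarrow> e - c < d \<longrightarrow>
           integral {c..e} (g x) \<le> (g x t + \<eta>) * (e - c)"
      using sh[of x]
      by (intro AE_averages_upper_bound) (auto simp: g_def[abs_def] set_integrable_def)
  qed
  with s(2) show ?thesis
  proof eventually_elim
    case (elim t)
    show ?case
    proof (intro impI allI)
      fix \<eta> :: real assume t: "t \<in> {a..b}" and \<eta>: "\<eta> > 0"
      have "(\<lambda>n. s n t) \<longlonglongrightarrow> f t" using elim t by blast
      then have "\<forall>\<^sub>F n in sequentially. dist (s n t) (f t) < \<eta> / 4"
        using \<eta> by (intro tendstoD) auto
      then obtain n where "dist (s n t) (f t) < \<eta> / 4"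
        by (meson eventually_happens trivial_limit_sequentially)
      \<comment> \<open>The detour through \<open>x\<close> costs \<open>norm (f t - x)\<close>
        twice, once in the averages of \<open>norm (f r - x)\<close> and once directly; with the
        error of the averages this stays below \<eta>.\<close>
      then obtain x where x: "x \<in> D" "norm (f t - x) < \<eta> / 4"
        unfolding D_def by (metis UN_I UNIV_I dist_commute dist_norm rangeI)
      have "\<eta> / 4 > 0" using \<eta> by simp
      then obtain d where d: "d > 0" "\<And>c e. c \<le> t \<Longrightarrow> t \<le> e \<Longrightarrow> e - c < d \<Longrightarrow>
           integral {c..e} (g x) \<le> (g x t + \<eta> / 4) * (e - c)"
        using elim(2) x(1) by meson
      show "\<exists>d>0. \<forall>c e. a \<le> c \<longrightarrow> c \<le> t \<longrightarrow> t \<le> e \<longrightarrow> e \<le> b \<longrightarrow> e - c < d \<longrightarrow>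
           integral {c..e} (\<lambda>r. norm (f r - f t)) \<le> \<eta> * (e - c)"
      proof (intro exI[of _ d] conjI allI impI)
        fix c e assume ce: "a \<le> c" "c \<le> t" "t \<le> e" "e \<le> b" "e - c < d"
        have gx: "integral {c..e} (g x) = integral {c..e} (\<lambda>r. norm (f r - x))"
          by (rule integral_cong) (use ce in \<open>auto simp: g_def\<close>)
        have "integral {c..e} (\<lambda>r. norm (f r - f t)) \<le> integral {c..e} (\<lambda>r. norm (f r - x) + norm (f t - x))"
        proof (intro integral_le integrable_add integrable_const_ivl shHK ce(1) ce(4))
          fix r
          have "f r - f t = (f r - x) - (f t - x)" by simp
          then show "norm (f r - f t) \<le> norm (f r - x) + norm (f t - x)"
            by (metis norm_triangle_ineq4)
        qed
        also have "\<dots> = integral {c..e} (g x) + norm (f t - x) * (e - c)"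
          unfolding gx using ce by (subst integral_add) (auto intro: shHK)
        also have "\<dots> \<le> (norm (f t - x) + \<eta> / 4) * (e - c) + norm (f t - x) * (e - c)"
          using d(2)[OF ce(2,3,5)] t by (simp add: g_def)
        also have "\<dots> = (2 * norm (f t - x) + \<eta> / 4) * (e - c)" by (simp add: algebra_simps)
        also have "\<dots> \<le> \<eta> * (e - c)" using x(2) ce \<eta> by (intro mult_right_mono) auto
        finally show "integral {c..e} (\<lambda>r. norm (f r - f t)) \<le> \<eta> * (e - c)" .
      qed (use d in auto)
    qed
  qed
qed

section \<open>Primitives of strongly measurable functions\<close>

lemmas integral_combine_HK = Henstock_Kurzweil_Integration.integral_combine
lemmas integral_add_HK = Henstock_Kurzweil_Integration.integral_add

lemma has_integral_increment:
  fixes f :: "real \<Rightarrow> 'a::banach"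
  assumes f: "\<And>t. t \<in> {0..T} \<Longrightarrow> (v has_integral (f t - f 0)) {0..t}" and xy: "0 \<le> x" "x \<le> y" "y \<le> T"
  shows "(v has_integral (f y - f x)) {x..y}"
proof -
  have int0: "v integrable_on {0..y}" using f[of y] xy by (auto simp: integrable_on_def)
  have "v integrable_on {x..y}"
    by (rule integrable_on_subinterval[OF int0]) (use xy in auto)
  moreover have "integral {x..y} v = f y - f x"
    using integral_combine_HK[OF xy(1,2) int0]
      integral_unique[OF f[of x]] integral_unique[OF f[of y]] xy
    by (simp add: algebra_simps)
  ultimately show ?thesis by (metis integrable_integral)
qed

text \<open>At a Lebesgue point of \<open>v\<close> the remainder of the linear approximation is
  bounded by the integral of \<open>norm (v r - v t)\<close> between the two times.
  \<open>AE_lebesgue_point\<close> admits intervals with \<open>t\<close> at either end, which gives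
  the two-sided derivative.\<close>

lemma AE_has_vector_derivative_primitive:
  fixes f :: "real \<Rightarrow> 'a::banach"
  assumes v: "strongly_measurable_on {0..T} v" and i: "set_integrable lebesgue {0..T} (\<lambda>t. norm (v t))"
    and f: "\<And>t. t \<in> {0..T} \<Longrightarrow> (v has_integral (f t - f 0)) {0..t}"
  shows "AE t in lebesgue. t \<in> {0<..<T} \<longrightarrow> (f has_vector_derivative v t) (at t)"
  using AE_lebesgue_point[OF v i]
proof eventually_elim
  case (elim t)
  show ?case
  proof
    assume t: "t \<in> {0<..<T}"
    have sub: "(v has_integral (f y - f x)) {x..y}" if "0 \<le> x" "x \<le> y" "y \<le> T" for x y
      using f that by (rule has_integral_increment)
    have shHK: "(\<lambda>r. norm (v r - x)) integrable_on {c..e}" if "0 \<le> c" "e \<le> T" for x c e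
      using set_lebesgue_integral_eq_integral(1)[OF set_integrable_norm_shift[OF v i, of x]] that
      by - (rule integrable_on_subinterval[of _ "{0..T}"], auto)
    have est: "norm (f y - f x - (y - x) *\<^sub>R v t) \<le> integral {x..y} (\<lambda>r. norm (v r - v t))"
      if xy: "0 \<le> x" "x \<le> y" "y \<le> T" for x y
    proof -
      have "((\<lambda>r. v r - v t) has_integral (f y - f x - (y - x) *\<^sub>R v t)) {x..y}"
        using has_integral_diff[OF sub[OF xy] has_integral_const_real[of "v t" x y]] xy by simp
      then have "norm (f y - f x - (y - x) *\<^sub>R v t) = norm (integral {x..y} (\<lambda>r. v r - v t))"
        and "(\<lambda>r. v r - v t) integrable_on {x..y}"
        by (simp_all add: integral_unique integrable_on_def) blast
      then show ?thesis using shHK[OF xy(1,3)] integral_norm_bound_integral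
        by (metis order_refl)
    qed
    show "(f has_vector_derivative v t) (at t)"
      unfolding has_vector_derivative_def has_derivative_at_alt
    proof (intro conjI allI impI)
      show "bounded_linear (\<lambda>x. x *\<^sub>R v t)" by (rule bounded_linear_scaleR_left)
      fix \<eta> :: real assume "\<eta> > 0"
      then obtain d where d: "d > 0" "\<And>c e. 0 \<le> c \<Longrightarrow> c \<le> t \<Longrightarrow> t \<le> e \<Longrightarrow> e \<le> T \<Longrightarrow> e - c < d \<Longrightarrow>
           integral {c..e} (\<lambda>r. norm (v r - v t)) \<le> \<eta> * (e - c)"
        using elim t by (meson greaterThanLessThan_iff atLeastAtMost_iff less_imp_le)
      show "\<exists>d>0. \<forall>y. norm (y - t) < d \<longrightarrow> norm (f y - f t - (y - t) *\<^sub>R v t) \<le> \<eta> * norm (y - t)"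
      proof (intro exI[of _ "min d (min t (T - t))"] conjI allI impI)
        show "0 < min d (min t (T - t))" using d t by auto
        fix y assume y: "norm (y - t) < min d (min t (T - t))"
        show "norm (f y - f t - (y - t) *\<^sub>R v t) \<le> \<eta> * norm (y - t)"
        proof (cases "t \<le> y")
          case True
          then show ?thesis using est[of t y] d(2)[of t y] y t by auto
        next
          case False
          have "norm (f y - f t - (y - t) *\<^sub>R v t) = norm (f t - f y - (t - y) *\<^sub>R v t)"
            using norm_minus_cancel[of "f t - f y - (t - y) *\<^sub>R v t"] by (simp add: algebra_simps)
          then show ?thesis using False est[of y t] d(2)[of y t] y t by auto
        qed
      qed
    qed
  qed
qed

text \<open>The limit is taken on Riemann sums: those of \<open>f - F n\<close> are dominated by
  those of \<open>G n\<close>, which a fine gauge brings close to the small number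
  \<open>J n\<close>. The domination must hold at every tag, not just almost everywhere.\<close>

lemma has_integral_limit_L1:
  fixes f :: "real \<Rightarrow> 'a::real_normed_vector"
  assumes F: "\<And>n. (F n has_integral I n) {a..b}" and G: "\<And>n. (G n has_integral J n) {a..b}"
    and le: "\<And>n x. x \<in> {a..b} \<Longrightarrow> norm (f x - F n x) \<le> G n x"
    and J: "J \<longlonglongrightarrow> (0::real)" and I: "I \<longlonglongrightarrow> L"
  shows "(f has_integral L) {a..b}"
  unfolding has_integral_real
proof (intro allI impI)
  fix e :: real assume e: "e > 0"
  \<comment> \<open>Two quarters pay for the Riemann sum of \<open>G n\<close>, namely
    \<open>J n\<close> and its approximation; the others pay for the Riemann sum of
    \<open>F n\<close> and for the distance of \<open>I n\<close> from \<open>L\<close>.\<close>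
  have "e / 4 > 0" using e by simp
  then have "\<forall>\<^sub>F n in sequentially. dist (J n) 0 < e / 4 \<and> dist (I n) L < e / 4"
    using tendstoD[OF J] tendstoD[OF I] eventually_conj by blast
  then obtain n where "dist (J n) 0 < e / 4 \<and> dist (I n) L < e / 4"
    using eventually_happens trivial_limit_sequentially by blast
  then have n: "J n < e / 4" "norm (I n - L) < e / 4"
    by (auto simp: dist_norm abs_less_iff)
  obtain g1 where g1: "gauge g1" "\<And>D. D tagged_division_of {a..b} \<Longrightarrow> g1 fine D \<Longrightarrow>
        norm ((\<Sum>(x,k)\<in>D. measure lborel k *\<^sub>R F n x) - I n) < e / 4"
    using iffD1[OF has_integral_real F[of n], rule_format, OF \<open>e / 4 > 0\<close>] by metis
  obtain g2 where g2: "gauge g2" "\<And>D. D tagged_division_of {a..b} \<Longrightarrow> g2 fine D \<Longrightarrow>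
        norm ((\<Sum>(x,k)\<in>D. measure lborel k *\<^sub>R G n x) - J n) < e / 4"
    using iffD1[OF has_integral_real G[of n], rule_format, OF \<open>e / 4 > 0\<close>] by metis
  show "\<exists>\<gamma>. gauge \<gamma> \<and> (\<forall>\<D>. \<D> tagged_division_of {a..b} \<and> \<gamma> fine \<D> \<longrightarrow>
           norm ((\<Sum>(x, k)\<in>\<D>. measure lborel k *\<^sub>R f x) - L) < e)"
  proof (intro exI[of _ "\<lambda>x. g1 x \<inter> g2 x"] conjI allI impI)
    show "gauge (\<lambda>x. g1 x \<inter> g2 x)" using g1(1) g2(1) by (rule gauge_Int)
    fix D assume "D tagged_division_of {a..b} \<and> (\<lambda>x. g1 x \<inter> g2 x) fine D"
    then have D: "D tagged_division_of {a..b}" "g1 fine D" "g2 fine D" by (auto simp: fine_Int)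
    have "norm ((\<Sum>(x,k)\<in>D. measure lborel k *\<^sub>R f x) - (\<Sum>(x,k)\<in>D. measure lborel k *\<^sub>R F n x))
        = norm (\<Sum>(x,k)\<in>D. measure lborel k *\<^sub>R (f x - F n x))"
      by (simp add: sum_subtractf[symmetric] scaleR_diff_right case_prod_unfold)
    also have "\<dots> \<le> (\<Sum>(x,k)\<in>D. measure lborel k *\<^sub>R G n x)"
    proof (rule sum_norm_le)
      fix p assume p: "p \<in> D"
      obtain x k where xk: "p = (x, k)" by (cases p)
      then have "x \<in> {a..b}" using tag_in_interval[OF D(1)] p by auto
      then show "norm (case p of (x, k) \<Rightarrow> measure lborel k *\<^sub>R (f x - F n x)) \<le> (case p of (x, k) \<Rightarrow> measure lborel k *\<^sub>R G n x)"
        using le[of x n] by (simp add: xk mult_left_mono)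
    qed
    finally have 1: "norm ((\<Sum>(x,k)\<in>D. measure lborel k *\<^sub>R f x) - (\<Sum>(x,k)\<in>D. measure lborel k *\<^sub>R F n x))
        \<le> (\<Sum>(x,k)\<in>D. measure lborel k *\<^sub>R G n x)" .
    have 2: "norm ((\<Sum>(x,k)\<in>D. measure lborel k *\<^sub>R F n x) - I n) < e / 4"
       "norm ((\<Sum>(x,k)\<in>D. measure lborel k *\<^sub>R G n x) - J n) < e / 4"
      using g1(2) g2(2) D by auto
    have "(\<Sum>(x,k)\<in>D. measure lborel k *\<^sub>R G n x) < e / 2"
      using 2(2) n(1) unfolding real_norm_def abs_less_iff by linarith
    moreover have "norm ((\<Sum>(x, k)\<in>D. measure lborel k *\<^sub>R f x) - L) \<le>
         norm ((\<Sum>(x,k)\<in>D. measure lborel k *\<^sub>R f x) - (\<Sum>(x,k)\<in>D. measure lborel k *\<^sub>R F n x)) +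
         norm ((\<Sum>(x,k)\<in>D. measure lborel k *\<^sub>R F n x) - I n) + norm (I n - L)"
      using norm_triangle_ineq[of "(\<Sum>(x,k)\<in>D. measure lborel k *\<^sub>R f x) - (\<Sum>(x,k)\<in>D. measure lborel k *\<^sub>R F n x)"
          "((\<Sum>(x,k)\<in>D. measure lborel k *\<^sub>R F n x) - I n) + (I n - L)"]
        norm_triangle_ineq[of "(\<Sum>(x,k)\<in>D. measure lborel k *\<^sub>R F n x) - I n" "I n - L"]
      by simp
    ultimately show "norm ((\<Sum>(x, k)\<in>D. measure lborel k *\<^sub>R f x) - L) < e"
      using 1 2(1) n(2) by linarith
  qed
qed

section \<open>Henstock--Kurzweil primitives and square integrable limits\<close>

lemma AE_lebesgue_negligible: "(AE x in lebesgue. P x) \<longleftrightarrow> negligible {x. \<not> P x}"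
  by (simp add: completion.AE_iff_null_sets negligible_iff_null_sets)

lemma integral_le_AE:
  fixes f g :: "real \<Rightarrow> real"
  assumes f: "f integrable_on S" and g: "g integrable_on S"
    and le: "AE x in lebesgue. x \<in> S \<longrightarrow> f x \<le> g x"
  shows "integral S f \<le> integral S g"
proof -
  let ?N = "{x. \<not> (x \<in> S \<longrightarrow> f x \<le> g x)}"
  define g' where "g' x = (if x \<in> ?N then f x else g x)" for x
  have N: "negligible ?N" using le by (simp add: AE_lebesgue_negligible)
  have "g' integrable_on S" by (rule integrable_spike[OF g N]) (auto simp: g'_def)
  moreover have "integral S g' = integral S g"
    by (rule integral_spike[OF N]) (auto simp: g'_def)
  moreover have "f x \<le> g' x" if "x \<in> S" for x using that by (auto simp: g'_def)
  ultimately show ?thesis using integral_le[OF f, of g'] by simp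
qed

lemma local_antimono_imp_le:
  fixes \<psi> :: "real \<Rightarrow> real"
  assumes \<delta>: "\<delta> > 0" and loc: "\<And>s t. 0 \<le> s \<Longrightarrow> s \<le> t \<Longrightarrow> t \<le> T \<Longrightarrow> t - s \<le> \<delta> \<Longrightarrow> \<psi> t \<le> \<psi> s"
    and t: "0 \<le> t" "t \<le> T"
  shows "\<psi> t \<le> \<psi> 0"
proof -
  have "t \<le> real n * \<delta> \<Longrightarrow> 0 \<le> t \<Longrightarrow> t \<le> T \<Longrightarrow> \<psi> t \<le> \<psi> 0" for n t
  proof (induction n arbitrary: t)
    case (Suc n)
    show ?case
    proof (cases "t \<le> \<delta>")
      case True
      then show ?thesis using loc[of 0 t] Suc.prems by simp
    next
      case False
      have "\<psi> t \<le> \<psi> (t - \<delta>)" using False Suc.prems \<delta> by (intro loc) auto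
      also have "\<dots> \<le> \<psi> 0" using False Suc.prems \<delta> by (intro Suc.IH) (auto simp: algebra_simps)
      finally show ?thesis .
    qed
  qed auto
  moreover obtain n where "t \<le> real n * \<delta>"
    using reals_Archimedean3[OF \<delta>] by (metis less_imp_le)
  ultimately show ?thesis using t by blast
qed

text \<open>The chain rule for \<open>inner (Q e) e\<close>, where \<open>e\<close> is only a primitive: compare increments over
  short intervals, on which \<open>e\<close> is almost constant.\<close>

lemma quadratic_form_bound:
  fixes Q :: "'h::{real_inner,banach} \<Rightarrow> 'h" and e d :: "real \<Rightarrow> 'h" and T t :: real
  assumes Q: "bounded_linear Q" and sym: "\<And>h k. inner (Q h) k = inner h (Q k)"
    and pos: "\<And>h. 0 \<le> inner (Q h) h"
    and e: "\<And>t. t \<in> {0..T} \<Longrightarrow> (d has_integral e t) {0..t}"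
    and d: "(\<lambda>t. norm (d t)) integrable_on {0..T}"
    and ae: "AE t in lebesgue. t \<in> {0..T} \<longrightarrow> inner (Q (e t)) (d t) \<le> \<kappa> * norm (d t)"
    and t: "t \<in> {0..T}"
  shows "inner (Q (e t)) (e t) \<le> 2 * \<kappa> * integral {0..t} (\<lambda>t. norm (d t))"
proof -
  interpret Q: bounded_linear Q by fact
  obtain K where K: "K > 0" "\<And>x. norm (Q x) \<le> norm x * K" using Q.pos_bounded by blast
  have T0: "0 \<le> T" using t by auto
  then have "(d has_integral e 0) {0..0}" using e[of 0] by simp
  then have e0: "e 0 = 0" using has_integral_unique[OF _ has_integral_refl(2)[of d 0]] by simp
  have e': "(d has_integral (e y - e x)) {x..y}" if "0 \<le> x" "x \<le> y" "y \<le> T" for x y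
    using has_integral_increment[of T d e x y] e e0 that by simp
  have dint: "(\<lambda>t. norm (d t)) integrable_on {x..y}" if "0 \<le> x" "y \<le> T" for x y
    using d that by - (rule integrable_on_subinterval[of _ "{0..T}"], auto)
  define D where "D t = integral {0..t} (\<lambda>t. norm (d t))" for t
  have Dd: "integral {x..y} (\<lambda>t. norm (d t)) = D y - D x" if "0 \<le> x" "x \<le> y" "y \<le> T" for x y
    unfolding D_def using integral_combine_HK[OF that(1,2) dint[OF _ that(3)]] by simp
  define \<phi> where "\<phi> t = inner (Q (e t)) (e t)" for t
  have key: "\<phi> y - \<phi> x \<le> 2 * (\<kappa> + K * \<eta>) * (D y - D x)"
    if xy: "0 \<le> x" "x \<le> y" "y \<le> T" and \<eta>: "\<And>r. r \<in> {x..y} \<Longrightarrow> norm (e y - e r) \<le> \<eta>" for x y \<eta>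
  proof -
    have "0 \<le> inner (Q (e y - e x)) (e y - e x)" by (rule pos)
    moreover have "inner (Q (e y)) (e x) = inner (Q (e x)) (e y)"
      using sym[of "e y" "e x"] by (simp add: inner_commute)
    ultimately have 1: "\<phi> y - \<phi> x \<le> 2 * inner (Q (e y)) (e y - e x)"
      by (simp add: \<phi>_def Q.diff inner_diff_left inner_diff_right)
    have hi: "((\<lambda>r. inner (Q (e y)) (d r)) has_integral inner (Q (e y)) (e y - e x)) {x..y}"
      using has_integral_linear[OF e'[OF xy] bounded_linear_inner_right[of "Q (e y)"]] by (simp add: o_def)
    have "inner (Q (e y)) (e y - e x) = integral {x..y} (\<lambda>r. inner (Q (e y)) (d r))"
      using hi by (simp add: integral_unique)
    also have "\<dots> \<le> integral {x..y} (\<lambda>r. (\<kappa> + K * \<eta>) * norm (d r))"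
    proof (rule integral_le_AE)
      show "(\<lambda>r. inner (Q (e y)) (d r)) integrable_on {x..y}" using hi by blast
      show "(\<lambda>r. (\<kappa> + K * \<eta>) * norm (d r)) integrable_on {x..y}"
        using dint[OF xy(1,3)] by (rule integrable_on_mult_right)
      show "AE r in lebesgue. r \<in> {x..y} \<longrightarrow> inner (Q (e y)) (d r) \<le> (\<kappa> + K * \<eta>) * norm (d r)"
        using ae
      proof eventually_elim
        case (elim r)
        show ?case
        proof
          assume r: "r \<in> {x..y}"
          have "inner (Q (e y)) (d r) = inner (Q (e r)) (d r) + inner (Q (e y - e r)) (d r)"
            by (simp add: Q.diff inner_diff_left)
          moreover have "inner (Q (e y - e r)) (d r) \<le> norm (Q (e y - e r)) * norm (d r)"
            by (rule norm_cauchy_schwarz)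
          moreover have "norm (Q (e y - e r)) * norm (d r) \<le> (K * \<eta>) * norm (d r)"
            using K(2)[of "e y - e r"] \<eta>[OF r] K(1)
            by (intro mult_right_mono) (smt (verit, best) mult.commute mult_left_mono, simp)
          moreover have "inner (Q (e r)) (d r) \<le> \<kappa> * norm (d r)" using elim r xy by auto
          ultimately show "inner (Q (e y)) (d r) \<le> (\<kappa> + K * \<eta>) * norm (d r)"
            by (simp add: algebra_simps)
        qed
      qed
    qed
    also have "\<dots> = (\<kappa> + K * \<eta>) * (D y - D x)" using Dd[OF xy] by simp
    finally have "\<phi> y - \<phi> x \<le> 2 * ((\<kappa> + K * \<eta>) * (D y - D x))" using 1 by linarith
    then show ?thesis by (simp only: mult.assoc)
  qed
  have cont: "continuous_on {0..T} e"
  proof -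
    have "d integrable_on {0..T}" using e[of T] T0 by auto
    then have "continuous_on {0..T} (\<lambda>x. integral {0..x} d)" by (rule indefinite_integral_continuous_1)
    moreover have "integral {0..x} d = e x" if "x \<in> {0..T}" for x using e[OF that] by (rule integral_unique)
    ultimately show ?thesis by (metis (no_types, lifting) continuous_on_cong)
  qed
  have uc: "uniformly_continuous_on {0..T} e" by (rule compact_uniformly_continuous[OF cont]) simp
  have bd: "\<phi> t \<le> 2 * (\<kappa> + K * \<eta>) * D t" if \<eta>: "\<eta> > 0" for \<eta>
  proof -
    obtain \<delta> where \<delta>: "\<delta> > 0" "\<And>x y. x \<in> {0..T} \<Longrightarrow> y \<in> {0..T} \<Longrightarrow> dist y x < \<delta> \<Longrightarrow> dist (e y) (e x) < \<eta>"
      using uc \<eta> unfolding uniformly_continuous_on_def by metis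
    \<comment> \<open>With its right-hand side subtracted, the estimate on short intervals says that
      \<open>\<psi>\<close> does not increase there, which chains up to all of
      \<open>{0..T}\<close>.\<close>
    define \<psi> where "\<psi> t = \<phi> t - 2 * (\<kappa> + K * \<eta>) * D t" for t
    have "\<psi> t \<le> \<psi> 0"
    proof (rule local_antimono_imp_le[of "\<delta>/2" T])
      show "\<psi> y \<le> \<psi> x" if xy: "0 \<le> x" "x \<le> y" "y \<le> T" "y - x \<le> \<delta> / 2" for x y
      proof -
        have "norm (e y - e r) \<le> \<eta>" if "r \<in> {x..y}" for r
          using \<delta>(2)[of r y] \<delta>(1) that xy by (simp add: dist_norm)
        from key[OF xy(1,2,3) this] show ?thesis by (simp add: \<psi>_def algebra_simps)
      qed
    qed (use \<delta> t in auto)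
    then show ?thesis by (simp add: \<psi>_def \<phi>_def e0 D_def)
  qed
  have "((\<lambda>\<eta>. 2 * (\<kappa> + K * \<eta>) * D t) \<longlongrightarrow> 2 * (\<kappa> + K * 0) * D t) (at_right 0)"
    by (intro tendsto_intros)
  moreover have "\<forall>\<^sub>F \<eta> in at_right 0. \<phi> t \<le> 2 * (\<kappa> + K * \<eta>) * D t"
    using bd by (auto simp: eventually_at_filter)
  ultimately have "\<phi> t \<le> 2 * (\<kappa> + K * 0) * D t"
    by (rule tendsto_lowerbound) simp
  then show ?thesis by (simp add: \<phi>_def D_def)
qed

section \<open>Completeness of L2 and weak limits through simple functions\<close>

definition sq_int :: "real \<Rightarrow> (real \<Rightarrow> 'h::real_normed_vector) \<Rightarrow> real" where
  "sq_int T \<zeta> = integral {0..T} (\<lambda>t. (norm (\<zeta> t))\<^sup>2)"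

lemma simple_map_sq_integrable: "simple_map \<zeta> \<Longrightarrow> (\<lambda>t. (norm (\<zeta> t))\<^sup>2) integrable_on {a..b}"
  by (rule simple_map_integrable_on[OF simple_map_comp])

lemma sq_int_parallelogram:
  fixes \<zeta> \<xi> :: "real \<Rightarrow> 'h::real_inner"
  assumes "simple_map \<zeta>" "simple_map \<xi>"
  shows "sq_int T (\<lambda>t. \<zeta> t - \<xi> t) = 2 * sq_int T \<zeta> + 2 * sq_int T \<xi> - 4 * sq_int T (\<lambda>t. (1/2) *\<^sub>R (\<zeta> t + \<xi> t))"
proof -
  have m: "simple_map (\<lambda>t. (1/2) *\<^sub>R (\<zeta> t + \<xi> t))" by (rule simple_map_comp2[OF assms])
  have hi: "((\<lambda>t. (norm (\<omega> t))\<^sup>2) has_integral sq_int T \<omega>) {0..T}" if "simple_map \<omega>" for \<omega> :: "real \<Rightarrow> 'h"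
    unfolding sq_int_def using simple_map_sq_integrable[OF that] by (rule integrable_integral)
  have "((\<lambda>t. 2 * (norm (\<zeta> t))\<^sup>2 + 2 * (norm (\<xi> t))\<^sup>2 - 4 * (norm ((1/2) *\<^sub>R (\<zeta> t + \<xi> t)))\<^sup>2)
      has_integral 2 * sq_int T \<zeta> + 2 * sq_int T \<xi> - 4 * sq_int T (\<lambda>t. (1/2) *\<^sub>R (\<zeta> t + \<xi> t))) {0..T}"
    by (intro has_integral_diff has_integral_add has_integral_mult_right hi assms m)
  also have "(\<lambda>t. 2 * (norm (\<zeta> t))\<^sup>2 + 2 * (norm (\<xi> t))\<^sup>2 - 4 * (norm ((1/2) *\<^sub>R (\<zeta> t + \<xi> t)))\<^sup>2)
      = (\<lambda>t. (norm (\<zeta> t - \<xi> t))\<^sup>2)"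
    by (rule ext, simp add: power2_norm_eq_inner inner_diff inner_add inner_commute algebra_simps)
  finally show ?thesis
    unfolding sq_int_def by (rule integral_unique)
qed

text \<open>Young's inequality with weight \<open>2 ^ j\<close>: a squared L2 distance of order
  \<open>(1/4) ^ j\<close> becomes an L1 distance of order \<open>(1/2) ^ j\<close>, with an
  integrable majorant that holds pointwise.\<close>

lemma le_weighted_square:
  fixes x :: real
  assumes "x \<ge> 0"
  shows "x \<le> (1/2) ^ j + 2 ^ j * x\<^sup>2"
proof -
  have "0 \<le> 2 ^ j * (x - (1/2) ^ j)\<^sup>2" by simp
  also have "\<dots> = 2 ^ j * x\<^sup>2 - 2 * x + (1/2) ^ j"
    by (simp add: power2_eq_square field_simps)
  finally show ?thesis using assms by linarith
qed

text \<open>The Riesz-Fischer argument: the rate makes the L1 norms of consecutive differences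
  summable, so the telescoping series converges absolutely almost everywhere; Fatou's lemma
  transfers the L2 rate to the limit.\<close>

lemma simple_maps_fast_L2_Cauchy_limit:
  fixes \<psi> :: "nat \<Rightarrow> real \<Rightarrow> 'h::{real_inner,banach}"
  assumes T: "T \<ge> 0" and \<psi>: "\<And>j. simple_map (\<psi> j)"
    and cauchy: "\<And>j k. j \<le> k \<Longrightarrow> sq_int T (\<lambda>t. \<psi> k t - \<psi> j t) \<le> (1/4) ^ j"
  obtains v where "AE t in lebesgue. t \<in> {0..T} \<longrightarrow> (\<lambda>j. \<psi> j t) \<longlonglongrightarrow> v t"
    "\<And>j. (\<lambda>t. (norm (v t - \<psi> j t))\<^sup>2) integrable_on {0..T}"
    "\<And>j. integral {0..T} (\<lambda>t. (norm (v t - \<psi> j t))\<^sup>2) \<le> (1/4) ^ j"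
proof -
  let ?M = "lebesgue_on {0..T}"
  have meas: "(\<lambda>t. F (\<psi> k t) (\<psi> j t)) \<in> borel_measurable ?M" for F :: "'h \<Rightarrow> 'h \<Rightarrow> real" and j k
    using simple_map_borel_measurable[OF simple_map_Pair[OF \<psi>[of k] \<psi>[of j]], of "\<lambda>p. F (fst p) (snd p)"]
    by (intro measurable_restrict_space1) simp
  have nn: "(\<integral>\<^sup>+t. ennreal (F (\<psi> k t) (\<psi> j t)) \<partial>?M) = ennreal (integral {0..T} (\<lambda>t. F (\<psi> k t) (\<psi> j t)))"
    if "\<And>x y. F x y \<ge> 0" for F :: "'h \<Rightarrow> 'h \<Rightarrow> real" and j k
  proof -
    have "(\<lambda>t. F (\<psi> k t) (\<psi> j t)) integrable_on {0..T}"
      by (rule simple_map_integrable_on[OF simple_map_comp2[OF \<psi> \<psi>]])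
    then have "(\<lambda>t. F (\<psi> k t) (\<psi> j t)) absolutely_integrable_on {0..T}"
      by (rule nonnegative_absolutely_integrable_1) (use that in auto)
    then have i: "integrable ?M (\<lambda>t. F (\<psi> k t) (\<psi> j t))"
      by (simp add: set_integrable_def integrable_restrict_space)
    show ?thesis
      using nn_integral_eq_integral[OF i] lebesgue_integral_eq_integral[OF i] that by simp
  qed
  define sq where "sq x y = (norm (x - y))\<^sup>2" for x y :: 'h
  define nm where "nm x y = norm (x - y)" for x y :: 'h
  have sq_le: "integral {0..T} (\<lambda>t. sq (\<psi> k t) (\<psi> j t)) \<le> (1/4) ^ j" if "j \<le> k" for j k
    using cauchy[OF that] by (simp add: sq_int_def sq_def)
  have nm_le: "integral {0..T} (\<lambda>t. nm (\<psi> (Suc j) t) (\<psi> j t)) \<le> (1 + T) * (1/2) ^ j" for j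
  proof -
    have "integral {0..T} (\<lambda>t. nm (\<psi> (Suc j) t) (\<psi> j t)) \<le>
        integral {0..T} (\<lambda>t. (1/2) ^ j + 2 ^ j * sq (\<psi> (Suc j) t) (\<psi> j t))"
    proof (intro integral_le integrable_add integrable_const_ivl integrable_on_mult_right
         simple_map_integrable_on[OF simple_map_comp2[OF \<psi> \<psi>]])
      show "nm (\<psi> (Suc j) t) (\<psi> j t) \<le> (1/2) ^ j + 2 ^ j * sq (\<psi> (Suc j) t) (\<psi> j t)" for t
        unfolding nm_def sq_def by (rule le_weighted_square) simp
    qed
    also have "\<dots> = T * (1/2) ^ j + 2 ^ j * integral {0..T} (\<lambda>t. sq (\<psi> (Suc j) t) (\<psi> j t))"
      using T simple_map_integrable_on[OF simple_map_comp2[OF \<psi> \<psi>], of sq "Suc j" j 0 T]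
      by (subst integral_add) (auto intro: integrable_on_mult_right)
    also have "\<dots> \<le> T * (1/2) ^ j + 2 ^ j * (1/4) ^ j"
      using sq_le[of j "Suc j"] by (intro add_left_mono mult_left_mono) auto
    also have "2 ^ j * (1/4::real) ^ j = (1/2) ^ j"
      by (simp add: power_mult_distrib[symmetric])
    finally show ?thesis by (simp add: algebra_simps)
  qed
  have "(\<integral>\<^sup>+t. (\<Sum>j. ennreal (nm (\<psi> (Suc j) t) (\<psi> j t))) \<partial>?M)
      = (\<Sum>j. \<integral>\<^sup>+t. ennreal (nm (\<psi> (Suc j) t) (\<psi> j t)) \<partial>?M)"
    by (rule nn_integral_suminf) (intro measurable_compose[OF meas] measurable_ennreal)
  also have "\<dots> \<le> (\<Sum>j. ennreal ((1 + T) * (1/2) ^ j))"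
  proof (intro suminf_le summableI)
    have "nm x y \<ge> 0" for x y by (simp add: nm_def)
    then show "(\<integral>\<^sup>+t. ennreal (nm (\<psi> (Suc j) t) (\<psi> j t)) \<partial>?M) \<le> ennreal ((1 + T) * (1/2) ^ j)" for j
      using nn[of nm "Suc j" j] nm_le[of j] by (simp add: ennreal_leI)
  qed
  also have "\<dots> = ennreal (\<Sum>j. (1 + T) * (1/2) ^ j)"
    using T by (intro suminf_ennreal2) (auto intro!: summable_mult summable_geometric)
  finally have fin: "(\<integral>\<^sup>+t. (\<Sum>j. ennreal (nm (\<psi> (Suc j) t) (\<psi> j t))) \<partial>?M) \<noteq> \<infinity>"
    by (metis ennreal_less_top infinity_ennreal_def not_le top.extremum)
  have "AE t in ?M. (\<Sum>j. ennreal (nm (\<psi> (Suc j) t) (\<psi> j t))) \<noteq> \<infinity>"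
  proof (rule nn_integral_PInf_AE)
    show "(\<lambda>t. \<Sum>j. ennreal (nm (\<psi> (Suc j) t) (\<psi> j t))) \<in> borel_measurable ?M"
      by (intro borel_measurable_suminf_order measurable_compose[OF meas] measurable_ennreal)
  qed (use fin in auto)
  then have conv: "AE t in ?M. convergent (\<lambda>j. \<psi> j t)"
  proof eventually_elim
    case (elim t)
    then have "summable (\<lambda>j. nm (\<psi> (Suc j) t) (\<psi> j t))"
      by (intro summable_suminf_not_top) (auto simp: nm_def)
    then have "summable (\<lambda>j. \<psi> (Suc j) t - \<psi> j t)"
      unfolding nm_def by (rule summable_norm_cancel)
    then have "convergent (\<lambda>n. \<Sum>i<n. \<psi> (Suc i) t - \<psi> i t)" by (simp add: summable_iff_convergent)
    then have "convergent (\<lambda>n. \<psi> n t - \<psi> 0 t)" by (simp add: sum_lessThan_telescope[of "\<lambda>i. \<psi> i t"])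
    then show ?case using convergent_diff_const_right_iff by blast
  qed
  \<comment> \<open>Arbitrary on the null set where the sequence diverges.\<close>
  define v where "v t = lim (\<lambda>j. \<psi> j t)" for t
  have lim: "AE t in ?M. (\<lambda>j. \<psi> j t) \<longlonglongrightarrow> v t"
    using conv by eventually_elim (simp add: v_def convergent_LIMSEQ_iff)
  then have lim': "AE t in lebesgue. t \<in> {0..T} \<longrightarrow> (\<lambda>j. \<psi> j t) \<longlonglongrightarrow> v t"
    by (simp add: AE_restrict_space_iff)
  have sm: "strongly_measurable_on {0..T} v"
    using lim' \<psi> unfolding strongly_measurable_on_def simple_map_def by blast
  have vint: "(\<lambda>t. (norm (v t - \<psi> j t))\<^sup>2) integrable_on {0..T} \<and>
    integral {0..T} (\<lambda>t. (norm (v t - \<psi> j t))\<^sup>2) \<le> (1/4) ^ j" for j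
  proof -
    have sj: "strongly_measurable_on {0..T} (\<psi> j)"
      using \<psi>[of j] unfolding strongly_measurable_on_def simple_map_def
      by (intro exI[of _ "\<lambda>n. \<psi> j"]) auto
    have "(\<lambda>t. indicat_real {0..T} t * (norm (v t - \<psi> j t))\<^sup>2) \<in> borel_measurable lebesgue"
    proof -
      have "(\<lambda>t. (indicat_real {0..T} t * norm (v t - \<psi> j t - 0))\<^sup>2) \<in> borel_measurable lebesgue"
        using strongly_measurable_on_norm[OF strongly_measurable_on_diff[OF sm sj], of 0]
        by (intro borel_measurable_power) auto
      moreover have "(indicat_real {0..T} t * norm (v t - \<psi> j t - 0))\<^sup>2 = indicat_real {0..T} t * (norm (v t - \<psi> j t))\<^sup>2" for t
        by (simp add: indicator_def)
      ultimately show ?thesis by simp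
    qed
    then have m: "(\<lambda>t. sq (v t) (\<psi> j t)) \<in> borel_measurable ?M"
      by (subst borel_measurable_restrict_space_iff) (auto simp: sq_def)
    have "(\<integral>\<^sup>+t. ennreal (sq (v t) (\<psi> j t)) \<partial>?M) = (\<integral>\<^sup>+t. liminf (\<lambda>k. ennreal (sq (\<psi> k t) (\<psi> j t))) \<partial>?M)"
    proof (rule nn_integral_cong_AE)
      show "AE t in ?M. ennreal (sq (v t) (\<psi> j t)) = liminf (\<lambda>k. ennreal (sq (\<psi> k t) (\<psi> j t)))"
        using lim
      proof eventually_elim
        case (elim t)
        have "(\<lambda>k. ennreal (sq (\<psi> k t) (\<psi> j t))) \<longlonglongrightarrow> ennreal (sq (v t) (\<psi> j t))"
          unfolding sq_def by (intro tendsto_ennrealI tendsto_intros elim)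
        then show ?case by (simp add: lim_imp_Liminf)
      qed
    qed
    also have "\<dots> \<le> liminf (\<lambda>k. \<integral>\<^sup>+t. ennreal (sq (\<psi> k t) (\<psi> j t)) \<partial>?M)"
      by (rule nn_integral_liminf) (intro measurable_compose[OF meas] measurable_ennreal)
    also have "\<dots> \<le> ennreal ((1/4) ^ j)"
    proof -
      have "\<forall>\<^sub>F k in sequentially. (\<integral>\<^sup>+t. ennreal (sq (\<psi> k t) (\<psi> j t)) \<partial>?M) \<le> ennreal ((1/4) ^ j)"
        using eventually_ge_at_top[of j]
      proof eventually_elim
        case (elim k)
        show ?case using sq_le[OF elim] by (subst nn) (auto simp: sq_def[abs_def] intro!: ennreal_leI)
      qed
      then have "liminf (\<lambda>k. \<integral>\<^sup>+t. ennreal (sq (\<psi> k t) (\<psi> j t)) \<partial>?M) \<le> liminf (\<lambda>k::nat. ennreal ((1/4) ^ j))"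
        by (rule Liminf_mono)
      then show ?thesis by (simp add: Liminf_const)
    qed
    finally have le: "(\<integral>\<^sup>+t. ennreal (sq (v t) (\<psi> j t)) \<partial>?M) \<le> ennreal ((1/4) ^ j)" .
    have i: "integrable ?M (\<lambda>t. sq (v t) (\<psi> j t))"
      unfolding integrable_iff_bounded using m le
      by (auto simp: sq_def intro: le_less_trans)
    have "ennreal (integral\<^sup>L ?M (\<lambda>t. sq (v t) (\<psi> j t))) \<le> ennreal ((1/4) ^ j)"
      using le nn_integral_eq_integral[OF i] by (simp add: sq_def)
    then have "integral\<^sup>L ?M (\<lambda>t. sq (v t) (\<psi> j t)) \<le> (1/4) ^ j" by simp
    then show ?thesis
      using integrable_on_lebesgue_on[OF i] lebesgue_integral_eq_integral[OF i]
      by (simp add: sq_def)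
  qed
  show thesis using that[OF lim'] vint by blast
qed

text \<open>The Radon--Nikodym property of Hilbert spaces in disguise: the sets of admissible simple
  functions are convex and decreasing, so almost minimisers of the \<open>L\<^sup>2\<close> norm are Cauchy
  by the parallelogram law.\<close>

lemma H1_if_simple_approximations:
  fixes z :: "real \<Rightarrow> 'h::{real_inner,banach}"
  assumes T: "T \<ge> 0"
    and approx: "\<And>\<epsilon>. \<epsilon> > 0 \<Longrightarrow> \<exists>\<zeta>. simple_map \<zeta> \<and> sq_int T \<zeta> \<le> B \<and>
        (\<forall>t\<in>{0..T}. norm (integral {0..t} \<zeta> - (z t - z 0)) \<le> \<epsilon>)"
  shows "H1 T z"
proof -
  define K where "K n = {\<zeta>. simple_map \<zeta> \<and> sq_int T \<zeta> \<le> B \<and>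
        (\<forall>t\<in>{0..T}. norm (integral {0..t} \<zeta> - (z t - z 0)) \<le> 1 / Suc n)}" for n
  have sq0: "sq_int T \<zeta> \<ge> 0" if "simple_map \<zeta>" for \<zeta> :: "real \<Rightarrow> 'h"
    unfolding sq_int_def using simple_map_sq_integrable[OF that] by (intro integral_nonneg) auto
  have Kne: "K n \<noteq> {}" for n
    using approx[of "1 / Suc n"] by (auto simp: K_def)
  have Kdec: "K m \<subseteq> K n" if "n \<le> m" for n m
  proof -
    have "1 / real (Suc m) \<le> 1 / real (Suc n)" using that by (simp add: frac_le)
    then show ?thesis unfolding K_def using order_trans by blast
  qed
  have half: "(1/2) *\<^sub>R (x + y) - d = (1/2) *\<^sub>R (x - d) + (1/2) *\<^sub>R (y - d)" for x y d :: 'h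
  proof -
    have "(1/2) *\<^sub>R d + (1/2) *\<^sub>R d = d" by (simp flip: scaleR_add_left)
    then show ?thesis by (simp add: algebra_simps)
  qed
  have Kmid: "(\<lambda>t. (1/2) *\<^sub>R (\<zeta> t + \<xi> t)) \<in> K n" if "\<zeta> \<in> K n" "\<xi> \<in> K n" for \<zeta> \<xi> n
  proof -
    have s: "simple_map \<zeta>" "simple_map \<xi>" using that by (auto simp: K_def)
    have "0 \<le> sq_int T (\<lambda>t. \<zeta> t - \<xi> t)" by (rule sq0[OF simple_map_comp2[OF s]])
    then have 1: "sq_int T (\<lambda>t. (1/2) *\<^sub>R (\<zeta> t + \<xi> t)) \<le> B"
      using that unfolding sq_int_parallelogram[OF s] by (simp add: K_def)
    have 2: "norm (integral {0..t} (\<lambda>t. (1/2) *\<^sub>R (\<zeta> t + \<xi> t)) - (z t - z 0)) \<le> 1 / Suc n" if t: "t \<in> {0..T}" for t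
    proof -
      have "integral {0..t} (\<lambda>t. (1/2) *\<^sub>R (\<zeta> t + \<xi> t)) = (1/2) *\<^sub>R (integral {0..t} \<zeta> + integral {0..t} \<xi>)"
        using simple_map_integrable_on[OF s(1)] simple_map_integrable_on[OF s(2)]
        by (simp only: integral_cmul integral_add)
      then have "integral {0..t} (\<lambda>t. (1/2) *\<^sub>R (\<zeta> t + \<xi> t)) - (z t - z 0) =
          (1/2) *\<^sub>R (integral {0..t} \<zeta> - (z t - z 0)) + (1/2) *\<^sub>R (integral {0..t} \<xi> - (z t - z 0))"
        by (simp only: half)
      then have "norm (integral {0..t} (\<lambda>t. (1/2) *\<^sub>R (\<zeta> t + \<xi> t)) - (z t - z 0)) \<le> (1/2) * norm (integral {0..t} \<zeta> - (z t - z 0)) + (1/2) * norm (integral {0..t} \<xi> - (z t - z 0))"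
        using norm_triangle_ineq[of "(1/2) *\<^sub>R (integral {0..t} \<zeta> - (z t - z 0))"
            "(1/2) *\<^sub>R (integral {0..t} \<xi> - (z t - z 0))"] by simp
      also have "\<dots> \<le> 1 / Suc n"
      proof -
        have "norm (integral {0..t} \<zeta> - (z t - z 0)) \<le> 1 / Suc n" "norm (integral {0..t} \<xi> - (z t - z 0)) \<le> 1 / Suc n"
          using \<open>\<zeta> \<in> K n\<close> \<open>\<xi> \<in> K n\<close> t by (auto simp: K_def)
        then show ?thesis by linarith
      qed
      finally show ?thesis .
    qed
    show ?thesis using 1 2 simple_map_comp2[OF s, of "\<lambda>x y. (1/2) *\<^sub>R (x + y)"] by (auto simp: K_def)
  qed
  define m where "m n = Inf (sq_int T ` K n)" for n
  have bdd: "bdd_below (sq_int T ` K n)" for n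
    by (rule bdd_belowI[of _ 0]) (auto simp: K_def sq0)
  have m_le: "m n \<le> sq_int T \<zeta>" if "\<zeta> \<in> K n" for n \<zeta>
    unfolding m_def using bdd that by (intro cInf_lower) auto
  have m_inc: "incseq m"
    unfolding incseq_def m_def
    using Kdec Kne bdd by (intro allI impI cInf_superset_mono) auto
  have m_B: "m n \<le> B" for n
    using Kne[of n] m_le[of _ n] unfolding K_def by fastforce
  obtain L where L: "m \<longlonglongrightarrow> L" "\<And>n. m n \<le> L"
    using incseq_convergent[OF m_inc, of B] m_B by blast
  have "\<exists>\<zeta>. \<zeta> \<in> K n \<and> sq_int T \<zeta> < m n + 1 / Suc n" for n
    using cInf_lessD[of "sq_int T ` K n" "m n + 1 / Suc n"] Kne[of n] by (auto simp: m_def)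
  then obtain \<zeta> where \<zeta>: "\<And>n. \<zeta> n \<in> K n" "\<And>n. sq_int T (\<zeta> n) < m n + 1 / Suc n" by metis
  have \<zeta>s: "simple_map (\<zeta> n)" for n using \<zeta>(1)[of n] by (simp add: K_def)
  \<comment> \<open>Parallelogram law for two almost minimisers: the later one has square below
    \<open>L + 1 / Suc n\<close>, the earlier one below \<open>m n + 1 / Suc n\<close>, and their
    midpoint at least \<open>m n\<close>.\<close>
  define c where "c n = 2 * (L - m n) + 4 * (1 / Suc n)" for n
  have cdist: "sq_int T (\<lambda>t. \<zeta> k t - \<zeta> n t) \<le> c n" if "n \<le> k" for n k
  proof -
    have "m n \<le> sq_int T (\<lambda>t. (1/2) *\<^sub>R (\<zeta> k t + \<zeta> n t))"
      using Kmid[of "\<zeta> k" n "\<zeta> n"] \<zeta>(1) Kdec[OF that] by (intro m_le) auto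
    moreover define a b where "a = 1 / real (Suc n)" and "b = 1 / real (Suc k)"
    moreover have "b \<le> a" unfolding a_def b_def using that by (simp add: frac_le)
    moreover have "sq_int T (\<zeta> n) < m n + a" "sq_int T (\<zeta> k) < m k + b"
      unfolding a_def b_def by (rule \<zeta>(2))+
    moreover have "2 * x + 2 * y - 4 * M \<le> 2 * (L - m n) + 4 * a"
      if "m n \<le> M" "b \<le> a" "y < m n + a" "x < m k + b" for x y M
      using that L(2)[of k] by (simp add: algebra_simps)
    ultimately show ?thesis
      unfolding sq_int_parallelogram[OF \<zeta>s \<zeta>s] c_def a_def[symmetric] by blast
  qed
  have "c \<longlonglongrightarrow> 2 * (L - L) + 4 * 0"
    unfolding c_def by (intro tendsto_intros L(1) one_over_Suc_tendsto_0)
  then have c0: "c \<longlonglongrightarrow> 0" by simp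
  have "\<exists>n\<ge>k. c n \<le> (1/4) ^ j" for j k
  proof -
    have "\<forall>\<^sub>F n in sequentially. c n < (1/4) ^ j"
      using c0 by (rule order_tendstoD) simp
    then obtain N where "\<And>n. n \<ge> N \<Longrightarrow> c n < (1/4) ^ j" by (auto simp: eventually_sequentially)
    then show ?thesis by (intro exI[of _ "max N k"]) (simp add: less_imp_le)
  qed
  \<comment> \<open>Passing to a subsequence yields the rate of
    \<open>simple_maps_fast_L2_Cauchy_limit\<close>. Being increasing, it also keeps the tolerance
    of the primitives below \<open>1 / Suc j\<close>.\<close>
  then have "\<exists>r. \<forall>j. c (r j) \<le> (1/4) ^ j \<and> r j < r (Suc j)"
    by (intro dependent_nat_choice) (use Suc_le_lessD in blast)+
  then obtain r where r: "\<And>j. c (r j) \<le> (1/4) ^ j" "strict_mono r"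
    by (auto simp: strict_mono_Suc_iff)
  have r_ge: "r j \<ge> j" for j using r(2) by (rule seq_suble)
  obtain v where v: "AE t in lebesgue. t \<in> {0..T} \<longrightarrow> (\<lambda>j. \<zeta> (r j) t) \<longlonglongrightarrow> v t"
    "\<And>j. (\<lambda>t. (norm (v t - \<zeta> (r j) t))\<^sup>2) integrable_on {0..T}"
    "\<And>j. integral {0..T} (\<lambda>t. (norm (v t - \<zeta> (r j) t))\<^sup>2) \<le> (1/4) ^ j"
  proof (rule simple_maps_fast_L2_Cauchy_limit[OF T, of "\<lambda>j. \<zeta> (r j)"])
    show "sq_int T (\<lambda>t. \<zeta> (r k) t - \<zeta> (r j) t) \<le> (1/4) ^ j" if "j \<le> k" for j k
      using cdist[of "r j" "r k"] r that by (meson order_trans strict_mono_less_eq)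
  qed (use \<zeta>s in auto)
  have sm: "strongly_measurable_on {0..T} v"
    using v(1) \<zeta>s unfolding strongly_measurable_on_def simple_map_def
    by (intro exI[of _ "\<lambda>j. \<zeta> (r j)"]) auto
  have vsq: "set_integrable lebesgue {0..T} (\<lambda>t. (norm (v t))\<^sup>2)"
    unfolding set_integrable_def
  proof (rule Bochner_Integration.integrable_bound)
    have "(\<lambda>t. 2 * (norm (v t - \<zeta> (r 0) t))\<^sup>2 + 2 * (norm (\<zeta> (r 0) t))\<^sup>2) absolutely_integrable_on {0..T}"
      using v(2)[of 0] simple_map_sq_integrable[OF \<zeta>s[of "r 0"], of 0 T]
      by (intro nonnegative_absolutely_integrable_1 integrable_add integrable_on_mult_right) auto
    then show "integrable lebesgue (\<lambda>t. indicat_real {0..T} t *\<^sub>R (2 * (norm (v t - \<zeta> (r 0) t))\<^sup>2 + 2 * (norm (\<zeta> (r 0) t))\<^sup>2))"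
      by (simp add: set_integrable_def)
    have "(\<lambda>t. (indicat_real {0..T} t * norm (v t - 0))\<^sup>2) \<in> borel_measurable lebesgue"
      using strongly_measurable_on_norm[OF sm, of 0] by (intro borel_measurable_power) auto
    moreover have "(indicat_real {0..T} t * norm (v t - 0))\<^sup>2 = indicat_real {0..T} t *\<^sub>R (norm (v t))\<^sup>2" for t
      by (simp add: indicator_def)
    ultimately show "(\<lambda>t. indicat_real {0..T} t *\<^sub>R (norm (v t))\<^sup>2) \<in> borel_measurable lebesgue" by simp
    have "(norm (v t))\<^sup>2 \<le> 2 * (norm (v t - \<zeta> (r 0) t))\<^sup>2 + 2 * (norm (\<zeta> (r 0) t))\<^sup>2" for t
    proof -
      have "norm (v t) \<le> norm (v t - \<zeta> (r 0) t) + norm (\<zeta> (r 0) t)"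
        by (metis diff_add_cancel norm_triangle_ineq)
      then have "(norm (v t))\<^sup>2 \<le> (norm (v t - \<zeta> (r 0) t) + norm (\<zeta> (r 0) t))\<^sup>2"
        by (intro power_mono) auto
      also have "\<dots> \<le> 2 * (norm (v t - \<zeta> (r 0) t))\<^sup>2 + 2 * (norm (\<zeta> (r 0) t))\<^sup>2"
        using sum_squares_bound[of "norm (v t - \<zeta> (r 0) t)" "norm (\<zeta> (r 0) t)"] by (simp add: power2_sum)
      finally show ?thesis .
    qed
    then show "AE t in lebesgue. norm (indicat_real {0..T} t *\<^sub>R (norm (v t))\<^sup>2) \<le>
        norm (indicat_real {0..T} t *\<^sub>R (2 * (norm (v t - \<zeta> (r 0) t))\<^sup>2 + 2 * (norm (\<zeta> (r 0) t))\<^sup>2))"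
      by (auto simp: indicator_def intro: order_trans)
  qed
  have "(v has_integral (z t - z 0)) {0..t}" if t: "t \<in> {0..T}" for t
  proof -
    define J where "J j = integral {0..t} (\<lambda>s. (norm (v s - \<zeta> (r j) s))\<^sup>2)" for j
    \<comment> \<open>The majorant from \<open>le_weighted_square\<close>: its integral is at most
      \<open>t * (1/2) ^ j + 2 ^ j * (1/4) ^ j\<close>, which tends to zero.\<close>
    define G where "G j s = (1/2) ^ j + 2 ^ j * (norm (v s - \<zeta> (r j) s))\<^sup>2" for j s
    have sqt: "(\<lambda>t. (norm (v t - \<zeta> (r j) t))\<^sup>2) integrable_on {0..t}" for j
      by (rule integrable_on_subinterval[OF v(2)]) (use t in auto)
    have Gi: "(G j has_integral ((t * (1/2) ^ j + 2 ^ j * J j))) {0..t}" for j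
      unfolding G_def J_def using has_integral_const_real[of "(1/2)^j::real" 0 t] t integrable_integral[OF sqt]
      by (intro has_integral_eq_rhs[OF has_integral_add[OF _ has_integral_mult_right]]) auto
    show ?thesis
    proof (rule has_integral_limit_L1)
      show "(\<zeta> (r j) has_integral integral {0..t} (\<zeta> (r j))) {0..t}" for j
        using simple_map_integrable_on[OF \<zeta>s] by (rule integrable_integral)
      show "(G j has_integral ((t * (1/2) ^ j + 2 ^ j * J j))) {0..t}" for j
        by (rule Gi)
      show "norm (v s - \<zeta> (r j) s) \<le> G j s" for j s
        unfolding G_def by (rule le_weighted_square) simp
      show "(\<lambda>j. (t * (1/2) ^ j + 2 ^ j * J j)) \<longlonglongrightarrow> 0"
      proof (rule tendsto_sandwich)
        show "\<forall>\<^sub>F j in sequentially. 0 \<le> (t * (1/2) ^ j + 2 ^ j * J j)"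
          using t sqt unfolding J_def by (intro always_eventually allI) (auto intro!: add_nonneg_nonneg mult_nonneg_nonneg integral_nonneg)
        show "\<forall>\<^sub>F j in sequentially. (t * (1/2) ^ j + 2 ^ j * J j)
            \<le> (t + 1) * (1/2) ^ j"
        proof (intro always_eventually allI)
          fix j
          have "J j \<le> integral {0..T} (\<lambda>s. (norm (v s - \<zeta> (r j) s))\<^sup>2)"
            unfolding J_def using t sqt v(2) by (intro integral_subset_le) auto
          also have "\<dots> \<le> (1/4) ^ j" by (rule v(3))
          finally have "2 ^ j * J j \<le> 2 ^ j * (1/4) ^ j"
            by (intro mult_left_mono) auto
          also have "2 ^ j * (1/4::real) ^ j = (1/2) ^ j" by (simp add: power_mult_distrib[symmetric])
          finally show "(t * (1/2) ^ j + 2 ^ j * J j) \<le> (t + 1) * (1/2) ^ j"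
            by (simp add: algebra_simps)
        qed
        show "(\<lambda>j. (t + 1) * (1/2) ^ j) \<longlonglongrightarrow> 0"
          by (intro tendsto_mult_right_zero LIMSEQ_power_zero) simp
      qed simp
      have "(\<lambda>j. integral {0..t} (\<zeta> (r j)) - (z t - z 0)) \<longlonglongrightarrow> 0"
      proof (rule Lim_null_comparison)
        show "\<forall>\<^sub>F j in sequentially. norm (integral {0..t} (\<zeta> (r j)) - (z t - z 0)) \<le> 1 / Suc j"
        proof (intro always_eventually allI)
          fix j
          have "norm (integral {0..t} (\<zeta> (r j)) - (z t - z 0)) \<le> 1 / Suc (r j)"
            using \<zeta>(1)[of "r j"] t by (auto simp: K_def)
          also have "\<dots> \<le> 1 / Suc j" using r_ge[of j] by (simp add: frac_le)
          finally show "norm (integral {0..t} (\<zeta> (r j)) - (z t - z 0)) \<le> 1 / Suc j" .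
        qed
        show "(\<lambda>j. 1 / real (Suc j)) \<longlonglongrightarrow> 0"
          by (rule one_over_Suc_tendsto_0)
      qed
      then show "(\<lambda>j. integral {0..t} (\<zeta> (r j))) \<longlonglongrightarrow> z t - z 0"
        by (simp add: LIM_zero_iff)
    qed
  qed
  then show ?thesis using sm vsq unfolding H1_def by blast
qed

section \<open>Coercive operators and resolvents in Hilbert space\<close>

text \<open>Midpoints stay in the convex set, so by the parallelogram law minimising sequences are
  Cauchy and two minimisers coincide. This makes the description in \<open>min_section\<close>
  meaningful.\<close>

lemma ex1_min_norm:
  fixes S :: "'h::{real_inner,banach} set"
  assumes S: "closed S" "convex S" "S \<noteq> {}"
  shows "\<exists>!v. v \<in> S \<and> (\<forall>w\<in>S. norm v \<le> norm w)"
proof -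
  define m where "m = Inf ((\<lambda>v. (norm v)\<^sup>2) ` S)"
  have bdd: "bdd_below ((\<lambda>v. (norm v)\<^sup>2) ` S)" by (rule bdd_belowI[of _ 0]) auto
  have m: "m \<le> (norm v)\<^sup>2" if "v \<in> S" for v
    unfolding m_def using bdd that by (intro cInf_lower) auto
  have par: "(norm (v - w))\<^sup>2 \<le> 2 * (norm v)\<^sup>2 + 2 * (norm w)\<^sup>2 - 4 * m" if "v \<in> S" "w \<in> S" for v w
  proof -
    have "(1/2) *\<^sub>R v + (1/2) *\<^sub>R w \<in> S" using S(2) that by (intro convexD) auto
    from m[OF this] have "m \<le> (1/4) * (norm (v + w))\<^sup>2"
      by (simp flip: scaleR_add_right add: power_divide)
    moreover have "(norm (v - w))\<^sup>2 = 2 * (norm v)\<^sup>2 + 2 * (norm w)\<^sup>2 - (norm (v + w))\<^sup>2"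
      by (simp add: power2_norm_eq_inner inner_diff inner_add inner_commute)
    ultimately show ?thesis by (simp add: algebra_simps)
  qed
  have "\<exists>v. v \<in> S \<and> (norm v)\<^sup>2 < m + 1 / Suc n" for n
    using cInf_lessD[of "(\<lambda>v. (norm v)\<^sup>2) ` S" "m + 1 / Suc n"] S(3) by (auto simp: m_def)
  then obtain v where v: "\<And>n. v n \<in> S" "\<And>n. (norm (v n))\<^sup>2 < m + 1 / Suc n" by metis
  have "Cauchy v"
  proof (rule metric_CauchyI)
    fix e :: real assume e: "e > 0"
    have "(\<lambda>n. 4 * (1 / real (Suc n))) \<longlonglongrightarrow> 4 * 0"
      by (intro tendsto_intros one_over_Suc_tendsto_0)
    then have "\<forall>\<^sub>F n in sequentially. 4 * (1 / real (Suc n)) < e\<^sup>2"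
      by (rule order_tendstoD) (use e in simp)
    then obtain N where N: "4 * (1 / real (Suc N)) < e\<^sup>2"
      by (meson eventually_happens trivial_limit_sequentially)
    show "\<exists>M. \<forall>n\<ge>M. \<forall>k\<ge>M. dist (v n) (v k) < e"
    proof (intro exI[of _ N] allI impI)
      fix n k assume nk: "N \<le> n" "N \<le> k"
      have "1 / real (Suc n) \<le> 1 / real (Suc N)" "1 / real (Suc k) \<le> 1 / real (Suc N)"
        using nk by (simp_all add: frac_le)
      then have "(norm (v n - v k))\<^sup>2 < e\<^sup>2"
        using par[OF v(1)[of n] v(1)[of k]] v(2)[of n] v(2)[of k] N by linarith
      then show "dist (v n) (v k) < e" using e by (simp add: dist_norm power_less_imp_less_base)
    qed
  qed
  then obtain x where x: "v \<longlonglongrightarrow> x" using convergent_eq_Cauchy by blast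
  have xS: "x \<in> S" using S(1) v(1) x by (metis closed_sequentially)
  have "(norm x)\<^sup>2 \<le> m"
  proof (rule LIMSEQ_le)
    show "(\<lambda>n. (norm (v n))\<^sup>2) \<longlonglongrightarrow> (norm x)\<^sup>2" by (intro tendsto_intros x)
    have "(\<lambda>n. m + 1 / real (Suc n)) \<longlonglongrightarrow> m + 0"
      by (intro tendsto_intros one_over_Suc_tendsto_0)
    then show "(\<lambda>n. m + 1 / real (Suc n)) \<longlonglongrightarrow> m" by simp
    show "\<exists>N. \<forall>n\<ge>N. (norm (v n))\<^sup>2 \<le> m + 1 / real (Suc n)" using v(2) less_imp_le by blast
  qed
  then have xm: "norm x \<le> norm w" if "w \<in> S" for w
    using m[OF that] by (meson norm_ge_zero order_trans power2_le_imp_le)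
  show ?thesis
  proof (intro ex1I[of _ x] conjI ballI xS xm)
    fix y assume y: "y \<in> S \<and> (\<forall>w\<in>S. norm y \<le> norm w)"
    then have "norm y = norm x" using xm xS by (simp add: antisym)
    then have "(norm (y - x))\<^sup>2 \<le> 4 * (norm x)\<^sup>2 - 4 * m"
      using par[of y x] y xS by simp
    also have "\<dots> \<le> 0" using \<open>(norm x)\<^sup>2 \<le> m\<close> by simp
    finally have "(norm (y - x))\<^sup>2 \<le> 0" .
    then show "y = x" by simp
  qed
qed

section \<open>Maximal monotone operators and their minimal section\<close>

lemma maximal_monotoneD: "maximal_monotone A \<Longrightarrow> u \<in> A x \<Longrightarrow> v \<in> A y \<Longrightarrow> 0 \<le> inner (u - v) (x - y)"
  unfolding maximal_monotone_def monotone_op_def by blast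

text \<open>Adjoining the single pair to the graph keeps it monotone, so maximality forces the
  enlarged operator to be \<open>A\<close> itself.\<close>

lemma maximal_monotone_memI:
  assumes A: "maximal_monotone A" and u: "\<And>y v. v \<in> A y \<Longrightarrow> 0 \<le> inner (u - v) (x - y)"
  shows "u \<in> A x"
proof -
  define B where "B = A(x := insert u (A x))"
  have "monotone_op B"
    unfolding monotone_op_def
  proof (intro allI impI)
    fix x1 y1 u1 v1 assume *: "u1 \<in> B x1" "v1 \<in> B y1"
    have "inner (u1 - u) (x1 - x) = inner (u - u1) (x - x1)"
      by (metis inner_minus_left inner_minus_right minus_diff_eq minus_minus)
    with * u[of v1 y1] u[of u1 x1] maximal_monotoneD[OF A, of u1 x1 v1 y1]
    show "0 \<le> inner (u1 - v1) (x1 - y1)"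
      by (auto simp: B_def split: if_splits)
  qed
  moreover have "A y \<subseteq> B y" for y by (auto simp: B_def)
  ultimately have "B = A" using A unfolding maximal_monotone_def by blast
  then show ?thesis by (metis B_def fun_upd_same insertI1)
qed

lemma maximal_monotone_eq:
  assumes "maximal_monotone A"
  shows "A x = {u. \<forall>y v. v \<in> A y \<longrightarrow> 0 \<le> inner (u - v) (x - y)}"
  using maximal_monotoneD[OF assms] maximal_monotone_memI[OF assms] by blast

text \<open>By maximality \<open>A x\<close> is an intersection of closed half-spaces, hence closed
  and convex, and has a unique element of least norm.\<close>

lemma min_section_in:
  fixes A :: "'h::{real_inner,banach} \<Rightarrow> 'h set"
  assumes A: "maximal_monotone A" and x: "x \<in> dom_op A"
  shows "min_section A x \<in> A x"
proof -
  have eq: "A x = (\<Inter>y. \<Inter>v\<in>A y. {u. inner (x - y) v \<le> inner (x - y) u})"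
  proof -
    have "inner (u - v) (x - y) = inner (x - y) u - inner (x - y) v" for u v y
      by (simp add: inner_diff_left inner_commute)
    then show ?thesis by (subst maximal_monotone_eq[OF A]) auto
  qed
  have "closed (A x)"
    by (subst eq) (intro closed_INT ballI closed_Collect_le continuous_intros)
  moreover have "convex (A x)"
    by (subst eq) (intro convex_INT convex_halfspace_ge)
  moreover have "A x \<noteq> {}" using x by (simp add: dom_op_def)
  ultimately show ?thesis
    unfolding min_section_def using theI'[OF ex1_min_norm] by blast
qed

section \<open>The energy inner product of a coercive operator\<close>

locale coercive_operator =
  fixes P :: "'h::{real_inner,banach} \<Rightarrow> 'h" and \<gamma> :: real
  assumes lin: "bounded_linear P" and sym: "\<And>h k. inner (P h) k = inner h (P k)"
    and \<gamma>_pos: "\<gamma> > 0" and coercive: "\<And>h. \<gamma> * (norm h)\<^sup>2 \<le> inner (P h) h"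
begin

sublocale P: bounded_linear P by (rule lin)

lemma form_nonneg: "0 \<le> inner (P h) h"
  using coercive[of h] \<gamma>_pos by (meson mult_nonneg_nonneg less_imp_le order_trans zero_le_power2)

lemma form_commute: "inner (P h) k = inner (P k) h"
  using sym[of h k] by (simp add: inner_commute)

lemma form_add: "inner (P (h + k)) (h + k) = inner (P h) h + 2 * inner (P h) k + inner (P k) k"
  using form_commute[of h k] by (simp add: P.add inner_add)

lemma form_diff: "inner (P (h - k)) (h - k) = inner (P h) h - 2 * inner (P h) k + inner (P k) k"
  using form_commute[of h k] by (simp add: P.diff inner_diff)

lemma form_scaleR: "inner (P (c *\<^sub>R h)) (c *\<^sub>R h) = c\<^sup>2 * inner (P h) h"
  by (simp add: P.scaleR power2_eq_square)

lemma norm_bound: "\<gamma> * norm h \<le> norm (P h)"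
proof (cases "h = 0")
  case False
  have "(\<gamma> * norm h) * norm h \<le> norm (P h) * norm h"
    using coercive[of h] norm_cauchy_schwarz[of "P h" h] by (simp add: power2_eq_square)
  then show ?thesis using False by simp
qed simp

text \<open>Lax-Milgram by Banach's fixed point theorem:
  \<open>\<theta> = \<gamma> / K\<^sup>2\<close> minimises
  \<open>1 - 2 * \<theta> * \<gamma> + \<theta>\<^sup>2 * K\<^sup>2\<close>, the bound for the
  squared contraction factor of the relaxed iteration.\<close>

lemma surj: "\<exists>x. P x = y"
proof -
  obtain K0 where K0: "K0 > 0" "\<And>x. norm (P x) \<le> norm x * K0" using P.pos_bounded by blast
  \<comment> \<open>Enlarging the operator bound to at least \<gamma> keeps the radicand in
    \<open>c\<close> nonnegative.\<close>
  define K where "K = max K0 \<gamma>"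
  have K: "K > 0" "\<gamma> \<le> K" "norm (P x) \<le> K * norm x" for x
  proof -
    show "K > 0" "\<gamma> \<le> K" using K0(1) by (auto simp: K_def)
    have "norm x * K0 \<le> norm x * K" by (intro mult_left_mono) (auto simp: K_def)
    then show "norm (P x) \<le> K * norm x" using K0(2)[of x] by (simp add: mult.commute)
  qed
  define \<theta> where "\<theta> = \<gamma> / K\<^sup>2"
  define c where "c = sqrt (1 - \<gamma>\<^sup>2 / K\<^sup>2)"
  have \<theta>: "\<theta> > 0" using \<gamma>_pos K by (simp add: \<theta>_def)
  have q: "0 < \<gamma>\<^sup>2 / K\<^sup>2" "\<gamma>\<^sup>2 / K\<^sup>2 \<le> 1"
    using \<gamma>_pos K by (simp_all add: power_mono)
  have c: "0 \<le> c" "c < 1" "c\<^sup>2 = 1 - \<gamma>\<^sup>2 / K\<^sup>2"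
    using q by (auto simp: c_def real_sqrt_lt_1_iff)
  have contr: "norm (u - \<theta> *\<^sub>R P u) \<le> c * norm u" for u
  proof (rule power2_le_imp_le)
    have "(norm (u - \<theta> *\<^sub>R P u))\<^sup>2 = (norm u)\<^sup>2 - 2 * \<theta> * inner (P u) u + \<theta>\<^sup>2 * (norm (P u))\<^sup>2"
      by (simp add: power2_norm_eq_inner inner_diff inner_commute[of u "P u"] power2_eq_square[of \<theta>] algebra_simps)
    also have "\<dots> \<le> (norm u)\<^sup>2 - 2 * \<theta> * (\<gamma> * (norm u)\<^sup>2) + \<theta>\<^sup>2 * (K * norm u)\<^sup>2"
    proof -
      have "2 * \<theta> * (\<gamma> * (norm u)\<^sup>2) \<le> 2 * \<theta> * inner (P u) u"
        using coercive[of u] \<theta> by (intro mult_left_mono) auto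
      moreover have "\<theta>\<^sup>2 * (norm (P u))\<^sup>2 \<le> \<theta>\<^sup>2 * (K * norm u)\<^sup>2"
        using power_mono[OF K(3)[of u] norm_ge_zero] by (intro mult_left_mono) auto
      ultimately show ?thesis by linarith
    qed
    also have "\<dots> = (c * norm u)\<^sup>2"
    proof -
      have "\<theta>\<^sup>2 * K\<^sup>2 = \<theta> * \<gamma>" "\<gamma>\<^sup>2 / K\<^sup>2 = \<theta> * \<gamma>"
        using K(1) by (simp_all add: \<theta>_def power2_eq_square)
      then show ?thesis
        unfolding power_mult_distrib c(3) by (simp add: algebra_simps)
    qed
    finally show "(norm (u - \<theta> *\<^sub>R P u))\<^sup>2 \<le> (c * norm u)\<^sup>2" .
  qed (use c in simp)
  have "\<exists>!x. x - \<theta> *\<^sub>R (P x - y) = x"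
  proof (rule banach_fix_type[OF c(1,2)])
    show "\<forall>x. \<forall>z. dist (x - \<theta> *\<^sub>R (P x - y)) (z - \<theta> *\<^sub>R (P z - y)) \<le> c * dist x z"
    proof (intro allI)
      fix x z
      have "x - \<theta> *\<^sub>R (P x - y) - (z - \<theta> *\<^sub>R (P z - y)) = (x - z) - \<theta> *\<^sub>R P (x - z)"
        by (simp add: P.diff algebra_simps)
      then show "dist (x - \<theta> *\<^sub>R (P x - y)) (z - \<theta> *\<^sub>R (P z - y)) \<le> c * dist x z"
        using contr[of "x - z"] by (simp only: dist_norm)
    qed
  qed
  then obtain x where "x - \<theta> *\<^sub>R (P x - y) = x" by auto
  then have "P x = y" using \<theta> by simp
  then show ?thesis ..
qed

lemma inverse: obtains Pi where "bounded_linear Pi" "\<And>y. P (Pi y) = y"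
proof -
  obtain Pi where Pi: "\<And>y. P (Pi y) = y" using surj by metis
  have inj: "x = y" if "P x = P y" for x y
    using norm_bound[of "x - y"] that \<gamma>_pos by (simp add: P.diff zero_less_mult_iff mult_le_0_iff)
  have "bounded_linear Pi"
  proof (rule bounded_linear_intro[where K="1 / \<gamma>"])
    show "Pi (x + y) = Pi x + Pi y" for x y by (rule inj) (simp add: Pi P.add)
    show "Pi (r *\<^sub>R x) = r *\<^sub>R Pi x" for r x by (rule inj) (simp add: Pi P.scaleR)
    show "norm (Pi x) \<le> norm x * (1 / \<gamma>)" for x
      using norm_bound[of "Pi x"] \<gamma>_pos by (simp add: Pi field_simps)
  qed
  then show thesis using Pi that by blast
qed

text \<open>The energy norm. The stability of the Euler steps is measured in it;
  \<open>form_norm_lower\<close> and \<open>form_norm_upper\<close> relate it to the original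
  norm.\<close>

definition form_norm :: "'h \<Rightarrow> real" where
  "form_norm h = sqrt (inner (P h) h)"

lemma form_cauchy_schwarz: "inner (P x) y \<le> form_norm x * form_norm y"
proof (cases "y = 0")
  case False
  then have b: "inner (P y) y > 0"
    using coercive[of y] \<gamma>_pos by (smt (verit, best) mult_pos_pos zero_less_norm_iff zero_less_power)
  define t where "t = inner (P x) y / inner (P y) y"
  have "0 \<le> inner (P (x - t *\<^sub>R y)) (x - t *\<^sub>R y)" by (rule form_nonneg)
  also have "\<dots> = inner (P x) x - 2 * t * inner (P x) y + t\<^sup>2 * inner (P y) y"
    by (simp add: form_diff P.scaleR power2_eq_square)
  also have "\<dots> = inner (P x) x - (inner (P x) y)\<^sup>2 / inner (P y) y"
    using b by (simp add: t_def power2_eq_square field_simps)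
  finally have "(inner (P x) y)\<^sup>2 \<le> inner (P x) x * inner (P y) y"
    using b by (simp add: field_simps)
  then have "\<bar>inner (P x) y\<bar> \<le> sqrt (inner (P x) x * inner (P y) y)"
    by (metis real_sqrt_abs real_sqrt_le_mono)
  then show ?thesis by (simp add: form_norm_def real_sqrt_mult)
qed (simp add: form_norm_def)

lemma form_norm_sq: "(form_norm h)\<^sup>2 = inner (P h) h"
  by (simp add: form_norm_def form_nonneg)

lemma form_norm_nonneg: "0 \<le> form_norm h"
  by (simp add: form_norm_def form_nonneg)

lemma form_norm_triangle: "form_norm (x + y) \<le> form_norm x + form_norm y"
proof (rule power2_le_imp_le)
  show "(form_norm (x + y))\<^sup>2 \<le> (form_norm x + form_norm y)\<^sup>2"
    using form_cauchy_schwarz[of x y] by (simp add: power2_sum form_norm_sq form_add)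
qed (simp add: form_norm_nonneg)

lemma form_norm_lower: "sqrt \<gamma> * norm h \<le> form_norm h"
  using real_sqrt_le_mono[OF coercive[of h]] by (simp add: form_norm_def real_sqrt_mult)

lemma form_norm_upper: obtains K where "K > 0" "\<And>h. form_norm h \<le> K * norm h"
proof -
  obtain K where K: "K > 0" "\<And>x. norm (P x) \<le> norm x * K" using P.pos_bounded by blast
  have "form_norm h \<le> sqrt K * norm h" for h
  proof (rule power2_le_imp_le)
    have "inner (P h) h \<le> norm (P h) * norm h" by (rule norm_cauchy_schwarz)
    also have "\<dots> \<le> (norm h * K) * norm h" using K(2) by (intro mult_right_mono) auto
    finally show "(form_norm h)\<^sup>2 \<le> (sqrt K * norm h)\<^sup>2"
      using K(1) unfolding form_norm_sq power_mult_distrib by (simp add: power2_eq_square[of "norm h"] mult_ac)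
  qed (use K in simp)
  then show thesis using that[of "sqrt K"] K(1) by simp
qed

end

text \<open>Fitzpatrick's trick: on the convex hull of the points \<open>(a, h, inner a h)\<close> of the graph the
  third component still dominates \<open>inner a h\<close>.\<close>

lemma monotone_hull_inner_le:
  assumes A: "monotone_op A"
    and p: "(a, h, c) \<in> convex hull {(a, h, inner a h) |a h. a \<in> A h}"
  shows "inner a h \<le> c"
proof -
  let ?G = "{(a, h, inner a h) |a h. a \<in> A h}"
  \<comment> \<open>For fixed \<open>b\<close>, \<open>k\<close>, \<open>d\<close> the condition is
    affine in \<open>(a, h, c)\<close>, so these sets are half-spaces. With
    \<open>d = inner b k\<close> it is the monotonicity inequality against the pair
    \<open>(k, b)\<close>, with \<open>c\<close> in place of \<open>inner a h\<close>.\<close>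
  define C where "C b k d = {(a, h, c). 0 \<le> c - inner a k - inner b h + d}" for b k :: 'a and d :: real
  have conv: "convex (C b k d)" for b k d
  proof (rule convexI)
    fix x y and u v :: real assume *: "x \<in> C b k d" "y \<in> C b k d" "0 \<le> u" "0 \<le> v" "u + v = 1"
    obtain a1 h1 c1 a2 h2 c2 where xy: "x = (a1, h1, c1)" "y = (a2, h2, c2)" by (metis prod.exhaust)
    have "0 \<le> u * (c1 - inner a1 k - inner b h1 + d) + v * (c2 - inner a2 k - inner b h2 + d)"
      using * xy by (auto simp: C_def)
    also have "\<dots> = (u * c1 + v * c2) - inner (u *\<^sub>R a1 + v *\<^sub>R a2) k - inner b (u *\<^sub>R h1 + v *\<^sub>R h2) + (u + v) * d"
      by (simp add: algebra_simps inner_add)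
    finally show "u *\<^sub>R x + v *\<^sub>R y \<in> C b k d" using *(5) xy by (simp add: C_def)
  qed
  have 1: "(a, h, c) \<in> C b k (inner b k)" if "b \<in> A k" for b k
  proof -
    have "?G \<subseteq> C b k (inner b k)"
    proof
      fix x assume "x \<in> ?G"
      then obtain a1 h1 where x: "x = (a1, h1, inner a1 h1)" "a1 \<in> A h1" by auto
      have "0 \<le> inner (a1 - b) (h1 - k)" using A x(2) that by (auto simp: monotone_op_def)
      then show "x \<in> C b k (inner b k)" by (simp add: C_def x inner_diff algebra_simps)
    qed
    then have "convex hull ?G \<subseteq> C b k (inner b k)" using conv by (rule hull_minimal)
    then show ?thesis using p by blast
  qed
  \<comment> \<open>Second pass to the hull, now with the hull point itself as the comparison.
    Evaluated at that same point, the half-space condition says that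
    \<open>2 * (c - inner a h)\<close> is nonnegative.\<close>
  have "?G \<subseteq> C a h c"
  proof
    fix x assume "x \<in> ?G"
    then obtain a1 h1 where x: "x = (a1, h1, inner a1 h1)" "a1 \<in> A h1" by auto
    show "x \<in> C a h c" using 1[OF x(2)] by (simp add: C_def x inner_commute algebra_simps)
  qed
  then have "convex hull ?G \<subseteq> C a h c" using conv by (rule hull_minimal)
  then have "(a, h, c) \<in> C a h c" using p by blast
  then show ?thesis by (simp add: C_def)
qed

text \<open>With \<open>b h = inner (P h) h\<close>, \<open>\<xi>\<close> solves the inclusion iff the quadratic polynomials
  \<open>b \<xi> + inner \<xi> (h - g - P a) - c + inner a g = m p + b (\<xi> - \<xi>\<^sub>p)\<close> are nonpositive for all
  \<open>p = (a, h, c)\<close> in the graph. On its convex hull \<open>m \<le> 0\<close>, and \<open>\<xi>\<^sub>p\<close> converges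
  along any maximising sequence of \<open>m\<close>.\<close>

lemma (in coercive_operator) resolvent_exists:
  assumes A: "maximal_monotone A"
  shows "\<exists>\<xi>. \<xi> \<in> A (g - P \<xi>)"
proof -
  obtain Pi where Pi_lin: "bounded_linear Pi" and Pi: "\<And>y. P (Pi y) = y" using inverse by blast
  interpret Pi: bounded_linear Pi by (rule Pi_lin)
  define H where "H = convex hull {(a, h, inner a h) |a h. a \<in> A h}"
  have mon: "monotone_op A" using A by (simp add: maximal_monotone_def)
  have Hle: "inner (fst p) (fst (snd p)) \<le> snd (snd p)" if "p \<in> H" for p
    using monotone_hull_inner_le[OF mon, of "fst p" "fst (snd p)" "snd (snd p)"] that by (simp add: H_def)
  have Hconv: "convex H" by (simp add: H_def)
  define b where "b h = inner (P h) h" for h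
  \<comment> \<open>The vertex of the quadratic: completing the square requires
    \<open>P (x p)\<close> to be half the vector paired with \<open>- \<xi>\<close>, which is where
    the inverse of \<open>P\<close> enters.\<close>
  define x where "x p = (1/2) *\<^sub>R Pi (g + P (fst p) - fst (snd p))" for p :: "'h \<times> 'h \<times> real"
  define \<phi> where "\<phi> p \<xi> = b \<xi> + inner \<xi> (fst (snd p) - g - P (fst p)) - snd (snd p) + inner (fst p) g" for p and \<xi> :: 'h
  define m where "m p = - b (x p) - snd (snd p) + inner (fst p) g" for p :: "'h \<times> 'h \<times> real"
  have \<phi>m: "\<phi> p \<xi> = m p + b (\<xi> - x p)" for p \<xi>
  proof -
    have "P (x p) = (1/2) *\<^sub>R (g + P (fst p) - fst (snd p))" by (simp add: x_def P.scaleR Pi)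
    then have "- 2 * inner (P \<xi>) (x p) = inner \<xi> (fst (snd p) - g - P (fst p))"
      by (simp add: sym inner_diff inner_add)
    then show ?thesis unfolding \<phi>_def m_def b_def form_diff by simp
  qed
  have b0: "b \<xi> \<ge> 0" for \<xi> by (simp add: b_def form_nonneg)
  have m0: "m p \<le> 0" if "p \<in> H" for p
  proof -
    \<comment> \<open>At \<open>\<xi> = fst p\<close> the quadratic reduces to the quantity that
      Fitzpatrick's trick shows to be nonpositive; the minimum \<open>m p\<close> lies below
      it.\<close>
    have "\<phi> p (fst p) = inner (fst p) (fst (snd p)) - snd (snd p)"
      by (simp add: \<phi>_def b_def inner_diff_right sym)
    then show ?thesis using \<phi>m[of p "fst p"] b0[of "fst p - x p"] Hle[OF that] by simp
  qed
  show ?thesis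
  proof (cases "H = {}")
    case True
    then have "A h = {}" for h unfolding H_def by auto
    then have "0 \<in> A (g - P 0)" by (intro maximal_monotone_memI[OF A]) auto
    then show ?thesis by blast
  next
    case False
    define S where "S = Sup (m ` H)"
    have bdd: "bdd_above (m ` H)" by (rule bdd_aboveI[of _ 0]) (use m0 in auto)
    have mS: "m p \<le> S" if "p \<in> H" for p
      unfolding S_def using bdd that by (intro cSup_upper) auto
    have S0: "S \<le> 0" unfolding S_def using False m0 by (intro cSup_least) auto
    \<comment> \<open>Strong concavity of \<open>m\<close>: the vertex depends affinely on
      \<open>p\<close>, and minus the form is concave with an exact quadratic gain. A segment of the
      hull therefore cannot have far apart vertices when \<open>m\<close> is almost maximal at both
      ends.\<close>
    have conc: "(1 - s) * m p + s * m q + s * (1 - s) * b (x p - x q) \<le> S"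
      if "p \<in> H" "q \<in> H" "0 \<le> s" "s \<le> 1" for p q s
    proof -
      define r where "r = (1 - s) *\<^sub>R p + s *\<^sub>R q"
      have r: "r \<in> H" unfolding r_def using Hconv that by (intro convexD) auto
      have "g + P (fst r) - fst (snd r) = (1 - s) *\<^sub>R (g + P (fst p) - fst (snd p)) + s *\<^sub>R (g + P (fst q) - fst (snd q))"
        by (simp add: r_def P.add P.diff P.scaleR algebra_simps)
      then have "x r = (1 - s) *\<^sub>R x p + s *\<^sub>R x q"
        unfolding x_def by (simp only: Pi.add Pi.scaleR scaleR_add_right scaleR_left_commute)
      then have "x r = x p + s *\<^sub>R (x q - x p)" by (simp add: algebra_simps)
      define J D where "J = inner (P (x p)) (x q - x p)" and "D = b (x q - x p)"
      have br: "b (x r) = b (x p) + 2 * s * J + s\<^sup>2 * D"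
        unfolding b_def J_def D_def \<open>x r = x p + s *\<^sub>R (x q - x p)\<close> by (simp only: form_add form_scaleR) simp
      have bq: "b (x q) = b (x p) + 2 * J + D"
        unfolding b_def J_def D_def using form_add[of "x p" "x q - x p"] by simp
      have bd: "b (x p - x q) = D"
        unfolding b_def D_def by (simp add: form_diff form_commute[of "x p" "x q"])
      have "b (x r) = (1 - s) * b (x p) + s * b (x q) - s * (1 - s) * b (x p - x q)"
        unfolding br bq bd by (simp add: power2_eq_square algebra_simps)
      moreover have "snd (snd r) = (1 - s) * snd (snd p) + s * snd (snd q)"
        by (simp add: r_def)
      moreover have "inner (fst r) g = (1 - s) * inner (fst p) g + s * inner (fst q) g"
        by (simp add: r_def inner_add)
      ultimately have "m r = (1 - s) * m p + s * m q + s * (1 - s) * b (x p - x q)"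
        unfolding m_def by (simp add: algebra_simps)
      then show ?thesis using mS[OF r] by simp
    qed
    have "\<exists>p. p \<in> H \<and> S - 1 / Suc n < m p" for n
      using less_cSupD[of "m ` H" "S - 1 / Suc n"] False by (auto simp: S_def)
    then obtain p where p: "\<And>n. p n \<in> H" "\<And>n. S - 1 / Suc n < m (p n)" by metis
    have lim0: "(\<lambda>n. 1 / real (Suc n)) \<longlonglongrightarrow> 0"
      by (rule one_over_Suc_tendsto_0)
    have "Cauchy (\<lambda>n. x (p n))"
    proof (rule metric_CauchyI)
      fix e :: real assume e: "e > 0"
      have "\<gamma> * e\<^sup>2 / 4 > 0" using e \<gamma>_pos by simp
      with lim0 have "\<forall>\<^sub>F n in sequentially. 1 / real (Suc n) < \<gamma> * e\<^sup>2 / 4" by (rule order_tendstoD)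
      then obtain N where N: "1 / real (Suc N) < \<gamma> * e\<^sup>2 / 4"
        by (meson eventually_happens trivial_limit_sequentially)
      show "\<exists>M. \<forall>n\<ge>M. \<forall>k\<ge>M. dist (x (p n)) (x (p k)) < e"
      proof (intro exI[of _ N] allI impI)
        fix n k assume nk: "N \<le> n" "N \<le> k"
        have le: "1 / real (Suc n) \<le> 1 / real (Suc N)" "1 / real (Suc k) \<le> 1 / real (Suc N)"
          using nk by (simp_all add: frac_le)
        have "(1/2) * m (p n) + (1/2) * m (p k) + (1/4) * b (x (p n) - x (p k)) \<le> S"
          using conc[OF p(1)[of n] p(1)[of k], of "1/2"] by simp
        then have "b (x (p n) - x (p k)) < \<gamma> * e\<^sup>2"
          using p(2)[of n] p(2)[of k] le N by linarith
        then have "\<gamma> * (norm (x (p n) - x (p k)))\<^sup>2 < \<gamma> * e\<^sup>2"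
          using coercive[of "x (p n) - x (p k)"] by (simp add: b_def)
        then have "(norm (x (p n) - x (p k)))\<^sup>2 < e\<^sup>2" using \<gamma>_pos by simp
        then show "dist (x (p n)) (x (p k)) < e" using e by (simp add: dist_norm power_less_imp_less_base)
      qed
    qed
    then obtain \<xi> where \<xi>: "(\<lambda>n. x (p n)) \<longlonglongrightarrow> \<xi>" using convergent_eq_Cauchy by blast
    have \<phi>le: "\<phi> q \<xi> \<le> 0" if q: "q \<in> H" for q
    proof -
      have cont: "(\<lambda>n. b (x (p n) - x q)) \<longlonglongrightarrow> b (\<xi> - x q)"
        unfolding b_def by (intro tendsto_intros P.tendsto \<xi>)
      \<comment> \<open>First variation at the supremum: move from the almost maximisers
        \<open>p n\<close> towards \<open>q\<close>, let \<open>n\<close> grow, divide by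
        \<open>s\<close> and let \<open>s\<close> tend to zero.\<close>
      have 1: "s * m q + s * (1 - s) * b (\<xi> - x q) \<le> S - (1 - s) * S" if s: "0 \<le> s" "s \<le> 1" for s
      proof (rule LIMSEQ_le)
        show "(\<lambda>n. s * m q + s * (1 - s) * b (x (p n) - x q)) \<longlonglongrightarrow> s * m q + s * (1 - s) * b (\<xi> - x q)"
          by (intro tendsto_intros cont)
        have "(\<lambda>n. S - (1 - s) * (S - 1 / real (Suc n))) \<longlonglongrightarrow> S - (1 - s) * (S - 0)"
          by (intro tendsto_intros lim0)
        then show "(\<lambda>n. S - (1 - s) * (S - 1 / real (Suc n))) \<longlonglongrightarrow> S - (1 - s) * S" by simp
        show "\<exists>N. \<forall>n\<ge>N. s * m q + s * (1 - s) * b (x (p n) - x q) \<le> S - (1 - s) * (S - 1 / real (Suc n))"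
        proof (intro exI[of _ 0] allI impI)
          fix n
          have "(1 - s) * (S - 1 / real (Suc n)) \<le> (1 - s) * m (p n)"
            using p(2)[of n] s by (intro mult_left_mono) auto
          then show "s * m q + s * (1 - s) * b (x (p n) - x q) \<le> S - (1 - s) * (S - 1 / real (Suc n))"
            using conc[OF p(1)[of n] q s] by linarith
        qed
      qed
      have 2: "m q + (1 - s) * b (\<xi> - x q) \<le> S" if s: "0 < s" "s \<le> 1" for s
      proof -
        have "s * (m q + (1 - s) * b (\<xi> - x q)) \<le> s * S" using 1[of s] s by (simp add: algebra_simps)
        then show ?thesis using s by simp
      qed
      have "m q + (1 - 0) * b (\<xi> - x q) \<le> S"
      proof (rule LIMSEQ_le_const2)
        show "(\<lambda>n. m q + (1 - 1 / real (Suc n)) * b (\<xi> - x q)) \<longlonglongrightarrow> m q + (1 - 0) * b (\<xi> - x q)"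
          by (intro tendsto_intros lim0)
        show "\<exists>N. \<forall>n\<ge>N. m q + (1 - 1 / real (Suc n)) * b (\<xi> - x q) \<le> S"
          using 2 by (intro exI[of _ 0] allI impI) (simp del: of_nat_Suc)
      qed
      then show ?thesis using S0 by (simp add: \<phi>m)
    qed
    have "\<xi> \<in> A (g - P \<xi>)"
    proof (rule maximal_monotone_memI[OF A])
      fix y v assume v: "v \<in> A y"
      then have "(v, y, inner v y) \<in> H" unfolding H_def by (intro hull_inc) auto
      moreover have "inner \<xi> (P v) = inner v (P \<xi>)" by (metis sym inner_commute)
      ultimately show "0 \<le> inner (\<xi> - v) (g - P \<xi> - y)"
        using \<phi>le[of "(v, y, inner v y)"]
        by (simp add: \<phi>_def b_def inner_diff_left inner_diff_right inner_commute[of "P \<xi>" \<xi>])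
    qed
    then show ?thesis by blast
  qed
qed

section \<open>Implicit Euler scheme\<close>

lemma AE_lebesgue_neq: "AE t in lebesgue. t \<noteq> (c::real)"
  by (simp add: AE_lebesgue_negligible)

lemma set_integrable_norm_diff:
  assumes f: "strongly_measurable_on {a..b} f" "set_integrable lebesgue {a..b} (\<lambda>t. norm (f t))"
    and g: "strongly_measurable_on {a..b} g" "set_integrable lebesgue {a..b} (\<lambda>t. norm (g t))"
  shows "set_integrable lebesgue {a..b} (\<lambda>t. norm (f t - g t))"
  unfolding set_integrable_def
proof (rule Bochner_Integration.integrable_bound)
  show "integrable lebesgue (\<lambda>t. indicat_real {a..b} t *\<^sub>R norm (f t) + indicat_real {a..b} t *\<^sub>R norm (g t))"
    using f(2) g(2) unfolding set_integrable_def by (rule Bochner_Integration.integrable_add)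
  show "(\<lambda>t. indicat_real {a..b} t *\<^sub>R norm (f t - g t)) \<in> borel_measurable lebesgue"
    using strongly_measurable_on_norm[OF strongly_measurable_on_diff[OF f(1) g(1)], of 0] by simp
  show "AE t in lebesgue. norm (indicat_real {a..b} t *\<^sub>R norm (f t - g t))
      \<le> norm (indicat_real {a..b} t *\<^sub>R norm (f t) + indicat_real {a..b} t *\<^sub>R norm (g t))"
    by (auto simp: indicator_def norm_triangle_ineq4)
qed

text \<open>Connects the norms in the theorem, which are Lebesgue integrals of the pointwise
  \<open>tderiv\<close>, with Henstock-Kurzweil integrals of a representative. Completeness of
  Lebesgue measure lets \<open>g\<close> inherit measurability from \<open>f\<close>.\<close>

lemma set_integral_cong_AE_HK:
  fixes f g :: "real \<Rightarrow> real"
  assumes f: "set_integrable lebesgue {a..b} f" and eq: "AE t in lebesgue. t \<in> {a..b} \<longrightarrow> g t = f t"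
  shows "set_lebesgue_integral lebesgue {a..b} g = integral {a..b} f"
proof -
  have fm: "(\<lambda>t. indicat_real {a..b} t *\<^sub>R f t) \<in> borel_measurable lebesgue"
    using f unfolding set_integrable_def by (rule borel_measurable_integrable)
  have ae: "AE t in lebesgue. indicat_real {a..b} t *\<^sub>R f t = indicat_real {a..b} t *\<^sub>R g t"
    using eq by eventually_elim (auto simp: indicator_def)
  have "(\<lambda>t. indicat_real {a..b} t *\<^sub>R g t) \<in> borel_measurable lebesgue"
    using fm ae by (rule borel_measurable_AE)
  then have "set_lebesgue_integral lebesgue {a..b} g = set_lebesgue_integral lebesgue {a..b} f"
    unfolding set_lebesgue_integral_def using fm ae by (intro integral_cong_AE) auto
  then show ?thesis using set_lebesgue_integral_eq_integral(2)[OF f] by simp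
qed

text \<open>The density in \<open>H1\<close> is almost everywhere the classical derivative, so a
  single \<open>v\<close> serves for increments, pointwise inclusions and the norms of
  \<open>tderiv f\<close>.\<close>

lemma H1_obtain:
  fixes f :: "real \<Rightarrow> 'a::banach"
  assumes f: "H1 T f" and T: "T > 0"
  obtains v where "strongly_measurable_on {0..T} v"
    "set_integrable lebesgue {0..T} (\<lambda>t. norm (v t))"
    "set_integrable lebesgue {0..T} (\<lambda>t. (norm (v t))\<^sup>2)"
    "\<And>x y. 0 \<le> x \<Longrightarrow> x \<le> y \<Longrightarrow> y \<le> T \<Longrightarrow> (v has_integral (f y - f x)) {x..y}"
    "AE t in lebesgue. t \<in> {0..T} \<longrightarrow> (f has_vector_derivative v t) (at t)"
    "L1_norm_on T (tderiv f) = integral {0..T} (\<lambda>t. norm (v t))"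
    "L2_norm_on T (tderiv f) = sqrt (integral {0..T} (\<lambda>t. (norm (v t))\<^sup>2))"
proof -
  obtain v where v: "strongly_measurable_on {0..T} v"
     "set_integrable lebesgue {0..T} (\<lambda>t. (norm (v t))\<^sup>2)"
     "\<And>t. t \<in> {0..T} \<Longrightarrow> (v has_integral (f t - f 0)) {0..t}"
    using f unfolding H1_def by blast
  have v1: "set_integrable lebesgue {0..T} (\<lambda>t. norm (v t))"
    by (rule set_integrable_norm_of_square[OF v(1,2)])
  have der: "AE t in lebesgue. t \<in> {0..T} \<longrightarrow> (f has_vector_derivative v t) (at t)"
  proof -
    have "AE t in lebesgue. t \<in> {0<..<T} \<longrightarrow> (f has_vector_derivative v t) (at t)"
      using v(1) v1 v(3) by (rule AE_has_vector_derivative_primitive)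
    then show ?thesis
      using AE_lebesgue_neq[of 0] AE_lebesgue_neq[of T] by eventually_elim auto
  qed
  then have td: "AE t in lebesgue. t \<in> {0..T} \<longrightarrow> tderiv f t = v t"
    by eventually_elim (auto simp: tderiv_def intro: vector_derivative_at)
  show thesis
  proof (rule that[OF v(1) v1 v(2) _ der])
    show "(v has_integral (f y - f x)) {x..y}" if "0 \<le> x" "x \<le> y" "y \<le> T" for x y
      using v(3) that by (rule has_integral_increment)
    show "L1_norm_on T (tderiv f) = integral {0..T} (\<lambda>t. norm (v t))"
      unfolding L1_norm_on_def
      by (rule set_integral_cong_AE_HK[OF v1]) (use td in eventually_elim, auto)
    show "L2_norm_on T (tderiv f) = sqrt (integral {0..T} (\<lambda>t. (norm (v t))\<^sup>2))"
      unfolding L2_norm_on_def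
      by (subst set_integral_cong_AE_HK[OF v(2)]) (use td in eventually_elim, auto)
  qed
qed

lemma norm_increment_le_integral:
  fixes f :: "real \<Rightarrow> 'a::banach"
  assumes v: "(v has_integral (f y - f x)) {x..y}" and g: "(\<lambda>t. norm (v t)) integrable_on {x..y}"
  shows "norm (f y - f x) \<le> integral {x..y} (\<lambda>t. norm (v t))"
proof -
  have "norm (integral {x..y} v) \<le> integral {x..y} (\<lambda>t. norm (v t))"
    using v g by (intro integral_norm_bound_integral) auto
  then show ?thesis using v by (simp add: integral_unique)
qed

lemma H1_continuous_on:
  fixes f :: "real \<Rightarrow> 'a::banach"
  assumes f: "H1 T f" and T: "T > 0"
  shows "continuous_on {0..T} f"
proof -
  obtain v where v: "\<And>t. t \<in> {0..T} \<Longrightarrow> (v has_integral (f t - f 0)) {0..t}"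
    using f unfolding H1_def by blast
  have "v integrable_on {0..T}" using v[of T] T by auto
  then have "continuous_on {0..T} (\<lambda>x. f 0 + integral {0..x} v)"
    by (intro continuous_intros indefinite_integral_continuous_1)
  moreover have "f 0 + integral {0..x} v = f x" if "x \<in> {0..T}" for x
    using integral_unique[OF v[OF that]] by simp
  ultimately show ?thesis by (metis (no_types, lifting) continuous_on_cong)
qed

lemma sup_norm_on_upper:
  fixes f :: "real \<Rightarrow> 'a::real_normed_vector"
  assumes f: "continuous_on {0..T} f" and t: "t \<in> {0..T}"
  shows "norm (f t) \<le> sup_norm_on T f"
proof -
  have "compact ((\<lambda>t. norm (f t)) ` {0..T})"
    by (intro compact_continuous_image continuous_intros f) auto
  then have "bdd_above ((\<lambda>t. norm (f t)) ` {0..T})"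
    by (intro bounded_imp_bdd_above compact_imp_bounded)
  then show ?thesis unfolding sup_norm_on_def using t by (intro cSup_upper) auto
qed

text \<open>Stability of one implicit step, with \<open>p\<close> the new state and \<open>q\<close>
  the old one shifted by the data: the hypothesis bounds the energy of \<open>p\<close> by the form
  of \<open>q\<close> and \<open>p\<close>, and Cauchy-Schwarz for the form cancels one
  factor.\<close>

lemma (in coercive_operator) form_norm_le_if_inner_nonpos:
  assumes "inner (p - q) (P p) \<le> 0"
  shows "form_norm p \<le> form_norm q"
proof -
  have "inner (P p) p \<le> inner (P q) p"
    using assms by (simp add: sym[of q p] inner_diff_left inner_commute[of "P p" p])
  then have "form_norm p * form_norm p \<le> form_norm q * form_norm p"
    using form_cauchy_schwarz[of q p] form_norm_sq[of p] by (simp add: power2_eq_square)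
  then show ?thesis
    using form_norm_nonneg[of p] form_norm_nonneg[of q] by (cases "form_norm p = 0") auto
qed

lemma nonneg_if_ge_small_multiples:
  fixes x c :: real
  assumes "\<And>\<eta>. \<eta> > 0 \<Longrightarrow> - \<eta> * c \<le> x" "c \<ge> 0"
  shows "0 \<le> x"
proof (rule ccontr)
  assume "\<not> 0 \<le> x"
  then have x: "x < 0" by simp
  define \<eta> where "\<eta> = - x / (2 * (c + 1))"
  have "\<eta> > 0" using x assms(2) by (simp add: \<eta>_def divide_neg_pos)
  have "\<eta> * (2 * (c + 1)) = - x" using assms(2) by (simp add: \<eta>_def)
  moreover have "- \<eta> * c \<le> x" by (rule assms(1)[OF \<open>\<eta> > 0\<close>])
  moreover have "\<eta> * c \<ge> 0" using \<open>\<eta> > 0\<close> assms(2) by simp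
  ultimately show False using \<open>\<eta> > 0\<close> by (simp add: algebra_simps)
qed

lemma AE_imp_exists_in_interval:
  fixes a b T :: real
  assumes ae: "AE t in lebesgue. t \<in> {0<..<T} \<longrightarrow> P t" and ab: "0 \<le> a" "a < b" "b \<le> T"
  shows "\<exists>t. a < t \<and> t < b \<and> P t"
proof (rule ccontr)
  assume "\<not> ?thesis"
  then have "{a<..<b} \<subseteq> {t. \<not> (t \<in> {0<..<T} \<longrightarrow> P t)}" using ab by auto
  moreover have "negligible {t. \<not> (t \<in> {0<..<T} \<longrightarrow> P t)}" using ae by (simp add: AE_lebesgue_negligible)
  ultimately have "negligible {a<..<b}" by (rule negligible_subset[rotated])
  then show False using ab(2) open_not_negligible[of "{a<..<b}"] by auto
qed

section \<open>The scheme, its a priori bounds and its interpolation\<close>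

locale state_equation = coercive_operator Q \<gamma>
  for Q :: "'h::{real_inner,banach} \<Rightarrow> 'h" and \<gamma> :: real +
  fixes T :: real and A :: "'h \<Rightarrow> 'h set" and R :: "'x::banach \<Rightarrow> 'h"
  assumes T_pos: "T > 0" and A_maxmon: "maximal_monotone A" and R_lin: "bounded_linear R"
begin

sublocale R: bounded_linear R by (rule R_lin)

text \<open>\<open>\<xi> k\<close> is the slope on the cell that starts at grid point
  \<open>k\<close>; the inclusion holds at the right end of the cell, which makes the scheme
  implicit. The recursion is stated for all \<open>k\<close>, also past \<open>T\<close>.\<close>

definition euler :: "nat \<Rightarrow> (real \<Rightarrow> 'x) \<Rightarrow> (nat \<Rightarrow> 'h) \<Rightarrow> (nat \<Rightarrow> 'h) \<Rightarrow> bool" where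
  "euler N l z \<xi> \<longleftrightarrow> (\<forall>k. z (Suc k) = z k + (T / N) *\<^sub>R \<xi> k \<and>
      \<xi> k \<in> A (R (l (Suc k * (T / N))) - Q (z (Suc k))))"

text \<open>Substituting the new state turns a step into
  \<open>\<xi> \<in> A (g - \<tau> Q \<xi>)\<close> with step size \<open>\<tau> = T / N\<close>,
  solved by \<open>resolvent_exists\<close> for the scaled coercive operator.\<close>

lemma euler_exists:
  assumes N: "N > 0"
  obtains z \<xi> where "z 0 = z0" "euler N l z \<xi>"
proof -
  have \<tau>: "T / N > 0" using N T_pos by simp
  interpret S: coercive_operator "\<lambda>x. (T / N) *\<^sub>R Q x" "(T / N) * \<gamma>"
  proof (rule coercive_operator.intro)
    show "bounded_linear (\<lambda>x. (T / N) *\<^sub>R Q x)"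
      using bounded_linear_compose[OF bounded_linear_scaleR_right lin] .
    show "T / N * \<gamma> * (norm h)\<^sup>2 \<le> inner ((T / N) *\<^sub>R Q h) h" for h
      using mult_left_mono[OF coercive[of h], of "T / N"] \<tau> by (simp add: mult.assoc)
    show "T / N * \<gamma> > 0" using \<tau> \<gamma>_pos by (rule mult_pos_pos)
  qed (simp add: sym)
  obtain J where J: "\<And>g. J g \<in> A (g - (T / N) *\<^sub>R Q (J g))"
    using S.resolvent_exists[OF A_maxmon] by metis
  define z where "z = rec_nat z0 (\<lambda>k zk. zk + (T / N) *\<^sub>R J (R (l (Suc k * (T / N))) - Q zk))"
  show thesis
  proof (rule that)
    show "z 0 = z0" by (simp add: z_def)
    show "euler N l z (\<lambda>k. J (R (l (Suc k * (T / N))) - Q (z k)))"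
      unfolding euler_def
    proof (intro allI conjI)
      fix k
      define g where "g = R (l (Suc k * (T / N))) - Q (z k)"
      show s: "z (Suc k) = z k + (T / N) *\<^sub>R J (R (l (Suc k * (T / N))) - Q (z k))"
        by (simp add: z_def)
      have "R (l (Suc k * (T / N))) - Q (z (Suc k)) = g - (T / N) *\<^sub>R Q (J g)"
        unfolding s g_def[symmetric] P.add P.scaleR by (simp add: g_def)
      with J[of g] have "J g \<in> A (R (l (Suc k * (T / N))) - Q (z (Suc k)))" by (simp only:)
      then show "J (R (l (Suc k * (T / N))) - Q (z k)) \<in> A (R (l (Suc k * (T / N))) - Q (z (Suc k)))"
        by (simp only: g_def)
    qed
  qed
qed

text \<open>A predicate on \<open>C\<close>, so that the constant is chosen before the data and the
  step size. \<open>\<Gamma>\<close> is any function controlling the increments of \<open>l\<close>;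
  for the integral of \<open>norm l'\<close> its total increment is the L1 norm in the first
  estimate.\<close>

definition euler_bound_const :: "real \<Rightarrow> bool" where
  "euler_bound_const C \<longleftrightarrow> (\<forall>N l z \<xi> \<Gamma> L k. N > 0 \<longrightarrow> euler N l z \<xi> \<longrightarrow>
      (\<forall>x y. 0 \<le> x \<longrightarrow> x \<le> y \<longrightarrow> y \<le> T \<longrightarrow> norm (l y - l x) \<le> \<Gamma> y - \<Gamma> x) \<longrightarrow>
      (\<forall>t\<in>{0..T}. norm (l t) \<le> L) \<longrightarrow> k \<le> N \<longrightarrow>
      norm (z k) \<le> C * (1 + norm (z 0) + L + (\<Gamma> T - \<Gamma> 0)))"

text \<open>Working with \<open>p\<^sub>k = z\<^sub>k - Q\<inverse>(R l(t\<^sub>k) - h\<^sub>0)\<close> for a fixed \<open>h\<^sub>0\<close> in the domain makes every Euler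
  step a contraction up to the data.\<close>

lemma euler_bound:
  assumes dom: "dom_op A \<noteq> {}"
  obtains C where "C > 0" "euler_bound_const C"
proof -
  obtain h0 a0 where a0: "a0 \<in> A h0" using dom by (auto simp: dom_op_def)
  obtain Pi where Pi_lin: "bounded_linear Pi" and Pi: "\<And>y. Q (Pi y) = y" using inverse by blast
  interpret Pi: bounded_linear Pi by (rule Pi_lin)
  interpret PR: bounded_linear "\<lambda>x. Pi (R x)" by (rule bounded_linear_compose[OF Pi_lin R_lin])
  obtain K1 where K1: "K1 > 0" "\<And>h. form_norm h \<le> K1 * norm h" using form_norm_upper by blast
  obtain K2 where K2: "K2 > 0" "\<And>x. norm (Pi (R x)) \<le> norm x * K2" using PR.pos_bounded by blast
  define q where "q = Pi h0"
  define s where "s = sqrt \<gamma>"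
  have s: "s > 0" using \<gamma>_pos by (simp add: s_def)
  \<comment> \<open>The fraction bounds the shifted state, with \<open>s\<close> from the lower
    bound of the energy norm; \<open>K2 + norm q\<close> pays for undoing the shift.\<close>
  define C0 where "C0 = (K1 + K1 * K2 + K1 * norm q + T * form_norm a0) / s + K2 + norm q"
  have C0: "C0 > 0"
    unfolding C0_def using K1(1) K2(1) s T_pos form_norm_nonneg[of a0]
    by (intro add_pos_nonneg add_nonneg_pos divide_pos_pos add_nonneg_nonneg mult_nonneg_nonneg) auto
  show thesis
  proof (rule that[OF C0], unfold euler_bound_const_def, intro allI impI)
    fix N :: nat and l z \<xi> \<Gamma> L k
    assume N: "N > 0" and e: "euler N l z \<xi>"
      and \<Gamma>: "\<forall>x y. 0 \<le> x \<longrightarrow> x \<le> y \<longrightarrow> y \<le> T \<longrightarrow> norm (l y - l x) \<le> \<Gamma> y - \<Gamma> x"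
      and L: "\<forall>t\<in>{0..T}. norm (l t) \<le> L" and k: "k \<le> N"
    define \<tau> where "\<tau> = T / N"
    have \<tau>: "\<tau> > 0" "real N * \<tau> = T" using N T_pos by (simp_all add: \<tau>_def)
    have tk: "real k * \<tau> \<in> {0..T}" if "k \<le> N" for k
    proof -
      have "real k * \<tau> \<le> real N * \<tau>" using that \<tau>(1) by (intro mult_right_mono) auto
      then show ?thesis using \<tau> by simp
    qed
    define p where "p k = z k - Pi (R (l (real k * \<tau>)) - h0)" for k :: nat
    have "form_norm (p k) \<le> form_norm (p 0) + K1 * K2 * (\<Gamma> (real k * \<tau>) - \<Gamma> 0) + real k * \<tau> * form_norm a0"
      using k
    proof (induction k)
      case (Suc k)
      define dl where "dl = l (Suc k * \<tau>) - l (k * \<tau>)"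
      have z: "z (Suc k) = z k + \<tau> *\<^sub>R \<xi> k" and \<xi>: "\<xi> k \<in> A (R (l (Suc k * \<tau>)) - Q (z (Suc k)))"
        using e unfolding euler_def \<tau>_def by blast+
      \<comment> \<open>The shift is chosen for this identity: monotonicity against the pair
        \<open>(h0, a0)\<close> then tests \<open>\<xi> k - a0\<close> with
        \<open>- Q (p (Suc k))\<close>.\<close>
      have w: "R (l (Suc k * \<tau>)) - Q (z (Suc k)) - h0 = - Q (p (Suc k))"
        by (simp add: p_def P.diff Pi)
      have d: "p (Suc k) - (p k - Pi (R dl) + \<tau> *\<^sub>R a0) = \<tau> *\<^sub>R (\<xi> k - a0)"
        by (simp add: p_def dl_def z Pi.diff R.diff algebra_simps)
      have "0 \<le> inner (\<xi> k - a0) (- Q (p (Suc k)))"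
        using maximal_monotoneD[OF A_maxmon \<xi> a0] by (simp only: w)
      then have "inner (p (Suc k) - (p k - Pi (R dl) + \<tau> *\<^sub>R a0)) (Q (p (Suc k))) \<le> 0"
        unfolding d using \<tau>(1) by (simp add: mult_nonneg_nonpos)
      then have "form_norm (p (Suc k)) \<le> form_norm (p k - Pi (R dl) + \<tau> *\<^sub>R a0)"
        by (rule form_norm_le_if_inner_nonpos)
      also have "\<dots> \<le> form_norm (p k) + form_norm (- Pi (R dl)) + form_norm (\<tau> *\<^sub>R a0)"
        using form_norm_triangle[of "p k - Pi (R dl)" "\<tau> *\<^sub>R a0"] form_norm_triangle[of "p k" "- Pi (R dl)"] by simp
      also have "form_norm (\<tau> *\<^sub>R a0) = \<tau> * form_norm a0"
        using \<tau>(1) by (simp add: form_norm_def P.scaleR real_sqrt_mult mult.assoc[symmetric])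
      also have "form_norm (- Pi (R dl)) \<le> K1 * K2 * (\<Gamma> (Suc k * \<tau>) - \<Gamma> (k * \<tau>))"
      proof -
        have "k * \<tau> \<le> Suc k * \<tau>" using \<tau>(1) by (intro mult_right_mono) auto
        then have "norm dl \<le> \<Gamma> (Suc k * \<tau>) - \<Gamma> (k * \<tau>)"
          unfolding dl_def using \<Gamma> tk[of k] tk[of "Suc k"] Suc.prems by auto
        then have "K1 * K2 * norm dl \<le> K1 * K2 * (\<Gamma> (Suc k * \<tau>) - \<Gamma> (k * \<tau>))"
          using K1(1) K2(1) by (intro mult_left_mono) auto
        moreover have "form_norm (- Pi (R dl)) \<le> K1 * (norm dl * K2)"
          using order_trans[OF K1(2)[of "- Pi (R dl)"], of "K1 * (norm dl * K2)"]
            mult_left_mono[OF K2(2)[of dl], of K1] K1(1) by simp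
        ultimately show ?thesis by (simp add: mult_ac)
      qed
      finally show ?case using Suc.IH Suc.prems by (simp add: algebra_simps)
    qed (simp)
    moreover have "K1 * K2 * (\<Gamma> (real k * \<tau>) - \<Gamma> 0) \<le> K1 * K2 * (\<Gamma> T - \<Gamma> 0)"
    proof -
      have "0 \<le> \<Gamma> T - \<Gamma> (real k * \<tau>)"
        using \<Gamma> tk[OF k] by (meson atLeastAtMost_iff norm_ge_zero order_refl order_trans)
      then show ?thesis using K1(1) K2(1) by (intro mult_left_mono) auto
    qed
    moreover have "real k * \<tau> * form_norm a0 \<le> T * form_norm a0"
      using tk[OF k] form_norm_nonneg[of a0] by (intro mult_right_mono) auto
    moreover have Pil: "norm (Pi (R (l t) - h0)) \<le> K2 * L + norm q" if "t \<in> {0..T}" for t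
    proof -
      have "norm (Pi (R (l t) - h0)) \<le> norm (Pi (R (l t))) + norm q"
        by (simp add: Pi.diff q_def norm_triangle_ineq4)
      moreover have "norm (Pi (R (l t))) \<le> L * K2"
        using order_trans[OF K2(2)[of "l t"] mult_right_mono[of "norm (l t)" L K2]] L that K2(1) by simp
      ultimately show ?thesis by (simp add: mult.commute)
    qed
    have p0: "form_norm (p 0) \<le> K1 * (norm (z 0) + K2 * L + norm q)"
    proof -
      have "norm (p 0) \<le> norm (z 0) + norm (Pi (R (l 0) - h0))"
        by (simp add: p_def norm_triangle_ineq4)
      also have "\<dots> \<le> norm (z 0) + K2 * L + norm q" using Pil[of 0] T_pos by simp
      finally show ?thesis using K1 by (meson mult_left_mono less_imp_le order_trans)
    qed
    ultimately have pk: "form_norm (p k) \<le> K1 * (norm (z 0) + K2 * L + norm q) + K1 * K2 * (\<Gamma> T - \<Gamma> 0) + T * form_norm a0"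
      by linarith
    \<comment> \<open>\<open>D\<close> is at least 1 and at least each datum, so the contributions
      of \<open>h0\<close> and \<open>a0\<close> are absorbed as multiples of it.\<close>
    define D where "D = 1 + norm (z 0) + L + (\<Gamma> T - \<Gamma> 0)"
    have pos: "L \<ge> 0" "\<Gamma> T - \<Gamma> 0 \<ge> 0"
      using L \<Gamma> T_pos by (meson atLeastAtMost_iff less_imp_le norm_ge_zero order_refl order_trans)+
    have "K1 * (norm (z 0) + K2 * L + norm q) + K1 * K2 * (\<Gamma> T - \<Gamma> 0) + T * form_norm a0
        = K1 * norm (z 0) + K1 * K2 * (L + (\<Gamma> T - \<Gamma> 0)) + (K1 * norm q + T * form_norm a0) * 1"
      by (simp add: algebra_simps)
    also have "\<dots> \<le> K1 * D + K1 * K2 * D + (K1 * norm q + T * form_norm a0) * D"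
      using K1(1) K2(1) T_pos form_norm_nonneg[of a0] pos
      by (intro add_mono mult_left_mono) (auto simp: D_def)
    also have "\<dots> = (K1 + K1 * K2 + K1 * norm q + T * form_norm a0) * D" by (simp add: algebra_simps)
    finally have pk': "s * norm (p k) \<le> (K1 + K1 * K2 + K1 * norm q + T * form_norm a0) * D"
      using pk form_norm_lower[of "p k"] by (simp add: s_def)
    have "norm (p k) = s * norm (p k) / s" using s by simp
    also have "\<dots> \<le> (K1 + K1 * K2 + K1 * norm q + T * form_norm a0) * D / s"
      using pk' s by (intro divide_right_mono) auto
    finally have 1: "norm (p k) \<le> (K1 + K1 * K2 + K1 * norm q + T * form_norm a0) / s * D" by simp
    have "z k = p k + Pi (R (l (real k * \<tau>)) - h0)" by (simp add: p_def)
    then have "norm (z k) \<le> norm (p k) + norm (Pi (R (l (real k * \<tau>)) - h0))"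
      by (metis norm_triangle_ineq)
    also have "\<dots> \<le> (K1 + K1 * K2 + K1 * norm q + T * form_norm a0) / s * D + (K2 * L + norm q * 1)"
      using 1 Pil[OF tk[OF k]] by simp
    also have "\<dots> \<le> (K1 + K1 * K2 + K1 * norm q + T * form_norm a0) / s * D + (K2 * D + norm q * D)"
      using K2(1) pos by (intro add_left_mono add_mono mult_left_mono) (auto simp: D_def)
    also have "\<dots> = C0 * D" by (simp add: C0_def algebra_simps)
    finally show "norm (z k) \<le> C0 * (1 + norm (z 0) + L + (\<Gamma> T - \<Gamma> 0))" by (simp add: D_def)
  qed
qed

text \<open>Monotonicity between consecutive grid points: \<open>\<xi> k\<close> belongs to the new
  argument and \<open>a\<close> to the old one. The arguments differ by the increment of the load
  and by \<open>- \<tau> Q \<xi>\<close> with \<open>\<tau> = T / N\<close>, so coercivity controls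
  \<open>\<xi> k - a\<close>.\<close>

lemma euler_slope_bound:
  obtains K where "K \<ge> 1" "\<And>N l z \<xi> k a. N > 0 \<Longrightarrow> euler N l z \<xi> \<Longrightarrow>
      a \<in> A (R (l (k * (T / N))) - Q (z k)) \<Longrightarrow>
      (T / N) * norm (\<xi> k) \<le> K * (norm (l (Suc k * (T / N)) - l (k * (T / N))) + (T / N) * norm a)"
proof -
  obtain KR where KR: "KR > 0" "\<And>x. norm (R x) \<le> norm x * KR" using R.pos_bounded by blast
  obtain KQ where KQ: "KQ > 0" "\<And>x. norm (Q x) \<le> norm x * KQ" using P.pos_bounded by blast
  \<comment> \<open>The summand 1 comes from returning from \<open>\<xi> k - a\<close> to
    \<open>\<xi> k\<close>. It also gives \<open>K \<ge> 1\<close>, which later lets the slope bound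
    dominate \<open>norm l'\<close>.\<close>
  define K where "K = KR / \<gamma> + KQ / \<gamma> + 1"
  show thesis
  proof (rule that)
    show "K \<ge> 1" unfolding K_def using KR(1) KQ(1) \<gamma>_pos by simp
    fix N :: nat and l z \<xi> a and k :: nat
    assume N: "N > 0" and e: "euler N l z \<xi>" and a: "a \<in> A (R (l (k * (T / N))) - Q (z k))"
    define \<tau> where "\<tau> = T / N"
    have \<tau>: "\<tau> > 0" using N T_pos by (simp add: \<tau>_def)
    define dl where "dl = l (Suc k * \<tau>) - l (k * \<tau>)"
    have z: "z (Suc k) = z k + \<tau> *\<^sub>R \<xi> k" and \<xi>: "\<xi> k \<in> A (R (l (Suc k * \<tau>)) - Q (z (Suc k)))"
      using e unfolding euler_def \<tau>_def by blast+
    have w: "R (l (Suc k * \<tau>)) - Q (z (Suc k)) - (R (l (k * \<tau>)) - Q (z k)) = (R dl - \<tau> *\<^sub>R Q a) - \<tau> *\<^sub>R Q (\<xi> k - a)"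
      by (simp add: z dl_def R.diff P.add P.diff P.scaleR algebra_simps)
    define x where "x = \<xi> k - a"
    have "0 \<le> inner x ((R dl - \<tau> *\<^sub>R Q a) - \<tau> *\<^sub>R Q x)"
      using maximal_monotoneD[OF A_maxmon \<xi> a[folded \<tau>_def]] by (simp only: w x_def)
    then have "\<tau> * inner (Q x) x \<le> inner x (R dl - \<tau> *\<^sub>R Q a)"
      by (simp add: inner_diff_right inner_commute)
    also have "\<dots> \<le> norm x * norm (R dl - \<tau> *\<^sub>R Q a)" by (rule norm_cauchy_schwarz)
    also have "\<dots> \<le> norm x * (norm dl * KR + \<tau> * (norm a * KQ))"
    proof (intro mult_left_mono)
      have "norm (R dl - \<tau> *\<^sub>R Q a) \<le> norm (R dl) + \<tau> * norm (Q a)"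
        using norm_triangle_ineq4[of "R dl" "\<tau> *\<^sub>R Q a"] \<tau> by simp
      also have "\<dots> \<le> norm dl * KR + \<tau> * (norm a * KQ)"
        using KR(2)[of dl] KQ(2)[of a] \<tau> by (intro add_mono mult_left_mono) auto
      finally show "norm (R dl - \<tau> *\<^sub>R Q a) \<le> norm dl * KR + \<tau> * (norm a * KQ)" .
    qed simp
    finally have "\<tau> * (\<gamma> * (norm x)\<^sup>2) \<le> norm x * (norm dl * KR + \<tau> * (norm a * KQ))"
      using order_trans[OF mult_left_mono[OF coercive[of x], of \<tau>]] \<tau> by simp
    then have "norm x * (\<gamma> * (\<tau> * norm x)) \<le> norm x * (norm dl * KR + \<tau> * (norm a * KQ))"
      by (simp add: power2_eq_square mult_ac)
    then have "\<gamma> * (\<tau> * norm x) \<le> norm dl * KR + \<tau> * (norm a * KQ)"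
      using \<tau> KR(1) KQ(1) by (cases "norm x = 0") auto
    then have "\<tau> * norm x \<le> (norm dl * KR + \<tau> * (norm a * KQ)) / \<gamma>"
      using \<gamma>_pos by (simp add: field_simps)
    moreover have "\<tau> * norm (\<xi> k) \<le> \<tau> * norm x + \<tau> * norm a"
    proof -
      have "norm (\<xi> k) \<le> norm x + norm a" unfolding x_def by (metis diff_add_cancel norm_triangle_ineq)
      then have "\<tau> * norm (\<xi> k) \<le> \<tau> * (norm x + norm a)" using \<tau> by (intro mult_left_mono) auto
      then show ?thesis by (simp add: algebra_simps)
    qed
    ultimately have "\<tau> * norm (\<xi> k) \<le> KR / \<gamma> * norm dl + (KQ / \<gamma> + 1) * (\<tau> * norm a)"
      by (simp add: add_divide_distrib algebra_simps)
    also have "\<dots> \<le> K * norm dl + K * (\<tau> * norm a)"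
      using KR(1) KQ(1) \<gamma>_pos \<tau> by (intro add_mono mult_right_mono) (auto simp: K_def)
    finally show "(T / N) * norm (\<xi> k) \<le> K * (norm (l (Suc k * (T / N)) - l (k * (T / N))) + (T / N) * norm a)"
      by (simp add: \<tau>_def dl_def algebra_simps)
  qed
qed

text \<open>\<open>\<omega>\<close> bounds the integral of \<open>g\<close> over anything no longer
  than one step, hence also the change of the state within a cell. Full cells transfer the L1 and L2
  bounds by \<open>g\<close> without loss; only the cells at the ends of an interval cost
  \<open>\<omega>\<close>.\<close>

lemma euler_interpolation:
  assumes N: "N > 0" and e: "euler N l z \<xi>"
    and slope: "\<And>k. k < N \<Longrightarrow> (T / N) * norm (\<xi> k) \<le> integral {k * (T / N)..Suc k * (T / N)} g"
    and g: "g integrable_on {0..T}" "\<And>t. 0 \<le> g t" and g2: "(\<lambda>t. (g t)\<^sup>2) integrable_on {0..T}"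
    and \<omega>: "\<And>x y. 0 \<le> x \<Longrightarrow> x \<le> y \<Longrightarrow> y \<le> T \<Longrightarrow> y - x \<le> T / N \<Longrightarrow> integral {x..y} g \<le> \<omega>"
  obtains \<zeta> where "simple_map \<zeta>"
    "\<And>t. 0 < t \<Longrightarrow> t \<le> T \<Longrightarrow> \<exists>k<N. \<zeta> t = \<xi> k \<and> t \<le> Suc k * (T / N) \<and> Suc k * (T / N) \<le> T \<and> Suc k * (T / N) - t \<le> T / N \<and>
        norm (z 0 + integral {0..t} \<zeta> - z (Suc k)) \<le> \<omega>"
    "\<And>x y. 0 \<le> x \<Longrightarrow> x \<le> y \<Longrightarrow> y \<le> T \<Longrightarrow> integral {x..y} (\<lambda>t. norm (\<zeta> t)) \<le> integral {x..y} g + 2 * \<omega>"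
    "sq_int T \<zeta> \<le> integral {0..T} (\<lambda>t. (g t)\<^sup>2)"
proof -
  define \<tau> where "\<tau> = T / N"
  have \<tau>: "\<tau> > 0" "real N * \<tau> = T" using N T_pos by (simp_all add: \<tau>_def)
  have tk: "0 \<le> real k * \<tau>" "real k * \<tau> \<le> T" if "k \<le> N" for k
  proof -
    have "real k * \<tau> \<le> real N * \<tau>" using that \<tau>(1) by (intro mult_right_mono) auto
    then show "real k * \<tau> \<le> T" "0 \<le> real k * \<tau>" using \<tau> by auto
  qed
  \<comment> \<open>Cells are open on the left and closed on the right, matching the inclusion at
    right ends. The index is shifted by one, so that 0 marks the times outside the half-open
    interval from 0 to \<open>T\<close>.\<close>
  define s where "s t = (if 0 < t \<and> t \<le> T then nat \<lceil>t / \<tau>\<rceil> else 0)" for t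
  define \<zeta> where "\<zeta> t = (if s t = 0 then 0 else \<xi> (s t - 1))" for t
  have s_cell: "s t = Suc k" if "real k * \<tau> < t" "t \<le> real (Suc k) * \<tau>" "k < N" for t k
  proof -
    have "\<lceil>t / \<tau>\<rceil> = int (Suc k)"
      using that \<tau>(1) by (intro ceiling_unique) (auto simp: field_simps)
    moreover have "0 < t" "t \<le> T" using that tk[of k] tk[of "Suc k"] by auto
    ultimately show ?thesis by (simp add: s_def)
  qed
  have cell: "\<exists>k<N. real k * \<tau> < t \<and> t \<le> real (Suc k) * \<tau>" if "0 < t" "t \<le> T" for t
  proof -
    define k where "k = nat (\<lceil>t / \<tau>\<rceil> - 1)"
    have pos: "0 < t / \<tau>" using that \<tau> by simp
    then have c: "\<lceil>t / \<tau>\<rceil> \<ge> 1" by linarith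
    then have k: "int k = \<lceil>t / \<tau>\<rceil> - 1" unfolding k_def by (intro nat_0_le) simp
    have "real k < t / \<tau>" "t / \<tau> \<le> real k + 1"
      using k by linarith+
    then have 1: "real k * \<tau> < t" "t \<le> real (Suc k) * \<tau>"
      using \<tau>(1) by (auto simp: field_simps)
    have "real k * \<tau> < real N * \<tau>" using 1(1) that(2) \<tau>(2) by linarith
    then have "k < N" using \<tau>(1) by simp
    then show ?thesis using 1 by blast
  qed
  have "simple_map s"
    unfolding simple_map_def
  proof (intro conjI allI)
    have "s t \<le> N" for t
    proof (cases "0 < t \<and> t \<le> T")
      case True
      then obtain k where "k < N" "real k * \<tau> < t" "t \<le> real (Suc k) * \<tau>" using cell by blast
      then show ?thesis using s_cell by (metis Suc_leI)
    qed (auto simp: s_def)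
    then have "range s \<subseteq> {..N}" by auto
    then show "finite (range s)" by (rule finite_subset) simp
    show "s -` {n} \<in> sets lebesgue" for n
    proof -
      have "(\<lambda>t. if 0 < t \<and> t \<le> T then nat \<lceil>t / \<tau>\<rceil> else 0) \<in> borel \<rightarrow>\<^sub>M count_space UNIV"
        by measurable
      then have "s \<in> borel \<rightarrow>\<^sub>M count_space UNIV" by (simp add: s_def[abs_def])
      then have "s -` {n} \<inter> space borel \<in> sets borel" by (rule measurable_sets) simp
      then show ?thesis using sets_completionI_sets[of "s -` {n}" lborel] by simp
    qed
  qed
  then have sm: "simple_map \<zeta>"
    unfolding \<zeta>_def[abs_def] by (rule simple_map_comp)
  have \<zeta>_cell: "\<zeta> t = \<xi> k" if "real k * \<tau> < t" "t \<le> real (Suc k) * \<tau>" "k < N" for t k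
    using s_cell[OF that] by (simp add: \<zeta>_def)
  \<comment> \<open>Only the left end point of a cell carries a foreign value.\<close>
  have hi: "((\<lambda>t. F (\<zeta> t)) has_integral (y - x) *\<^sub>R F (\<xi> k)) {x..y}"
    if "real k * \<tau> \<le> x" "x \<le> y" "y \<le> real (Suc k) * \<tau>" "k < N" for x y k and F :: "'h \<Rightarrow> 'b::banach"
  proof (rule has_integral_spike_finite)
    show "finite {real k * \<tau>}" by simp
    show "((\<lambda>t. F (\<xi> k)) has_integral (y - x) *\<^sub>R F (\<xi> k)) {x..y}"
      using has_integral_const_real[of "F (\<xi> k)" x y] that by simp
    fix t assume "t \<in> {x..y} - {real k * \<tau>}"
    then have "real k * \<tau> < t" "t \<le> real (Suc k) * \<tau>" using that by auto
    then show "F (\<zeta> t) = F (\<xi> k)" using \<zeta>_cell that(4) by simp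
  qed
  have cell_le: "real k * \<tau> \<le> real (Suc k) * \<tau>" "real (Suc k) * \<tau> - real k * \<tau> = \<tau>" for k
    using \<tau>(1) by (auto simp: algebra_simps)
  have sum_le: "integral {real j * \<tau>..real k * \<tau>} f \<le> integral {real j * \<tau>..real k * \<tau>} h"
    if "j \<le> k" "k \<le> N" and f: "f integrable_on {0..T}" and h: "h integrable_on {0..T}"
      and le: "\<And>k. k < N \<Longrightarrow> integral {real k * \<tau>..real (Suc k) * \<tau>} f \<le> integral {real k * \<tau>..real (Suc k) * \<tau>} h"
    for j k and f h :: "real \<Rightarrow> real"
    using that(1,2)
  proof (induction k rule: dec_induct)
    case (step k)
    have sub: "f' integrable_on {real j * \<tau>..real (Suc k) * \<tau>}" if "f' integrable_on {0..T}" for f' :: "real \<Rightarrow> real"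
      by (rule integrable_on_subinterval[OF that]) (use tk[of j] tk[of "Suc k"] step in auto)
    have ord: "real j * \<tau> \<le> real k * \<tau>" using step(1) \<tau>(1) by (intro mult_right_mono) auto
    show ?case
      using integral_combine_HK[OF ord cell_le(1) sub[OF f]]
        integral_combine_HK[OF ord cell_le(1) sub[OF h]]
        step.IH le[of k] step by linarith
  qed simp
  have nint: "(\<lambda>t. norm (\<zeta> t)) integrable_on {x..y}" for x y
    by (rule simple_map_integrable_on[OF simple_map_comp[OF sm]])
  have zint: "\<zeta> integrable_on {x..y}" for x y by (rule simple_map_integrable_on[OF sm])
  have gint: "g integrable_on {x..y}" if "0 \<le> x" "y \<le> T" for x y
    by (rule integrable_on_subinterval[OF g(1)]) (use that in auto)
  have cell_norm: "integral {real k * \<tau>..real (Suc k) * \<tau>} (\<lambda>t. norm (\<zeta> t)) = \<tau> * norm (\<xi> k)" if "k < N" for k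
    using integral_unique[OF hi[OF order_refl cell_le(1) order_refl that, of norm]] unfolding cell_le(2) by simp
  have slope': "\<tau> * norm (\<xi> k) \<le> integral {real k * \<tau>..real (Suc k) * \<tau>} g" if "k < N" for k
    using slope[OF that] by (simp only: \<tau>_def)
  have zk: "z 0 + integral {0..real k * \<tau>} \<zeta> = z k" if "k \<le> N" for k
    using that
  proof (induction k)
    case (Suc k)
    have "integral {0..real (Suc k) * \<tau>} \<zeta> = integral {0..real k * \<tau>} \<zeta> + integral {real k * \<tau>..real (Suc k) * \<tau>} \<zeta>"
      using tk[of k] Suc.prems cell_le(1)[of k] zint
      by (intro integral_combine_HK[symmetric]) auto
    also have "integral {real k * \<tau>..real (Suc k) * \<tau>} \<zeta> = \<tau> *\<^sub>R \<xi> k"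
      using integral_unique[OF hi[OF order_refl cell_le(1) order_refl, of k "\<lambda>x. x"]] Suc.prems
      unfolding cell_le(2) by simp
    finally have "z 0 + integral {0..real (Suc k) * \<tau>} \<zeta> = z k + \<tau> *\<^sub>R \<xi> k"
      using Suc by (simp add: add.assoc[symmetric])
    then show ?case using e by (simp add: euler_def \<tau>_def)
  qed simp
  have \<omega>0: "\<omega> \<ge> 0" using \<omega>[of 0 0] T_pos N by simp
  show thesis
  proof (rule that[OF sm])
    fix t :: real assume t: "0 < t" "t \<le> T"
    obtain k where k: "k < N" "real k * \<tau> < t" "t \<le> real (Suc k) * \<tau>" using cell[OF t] by blast
    have kT: "real (Suc k) * \<tau> \<le> T" "Suc k \<le> N" using tk[of "Suc k"] k(1) by auto
    have small: "real (Suc k) * \<tau> - t \<le> \<tau>" using cell_le(2)[of k] k by linarith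
    have "integral {0..real (Suc k) * \<tau>} \<zeta> = integral {0..t} \<zeta> + integral {t..real (Suc k) * \<tau>} \<zeta>"
      using t k zint by (intro integral_combine_HK[symmetric]) auto
    moreover have "integral {t..real (Suc k) * \<tau>} \<zeta> = (real (Suc k) * \<tau> - t) *\<^sub>R \<xi> k"
      using integral_unique[OF hi[of k t "real (Suc k) * \<tau>" "\<lambda>x. x"]] k by simp
    ultimately have zS: "z (Suc k) = z 0 + (integral {0..t} \<zeta> + (real (Suc k) * \<tau> - t) *\<^sub>R \<xi> k)"
      using zk[OF kT(2)] by (simp only:)
    have "z 0 + integral {0..t} \<zeta> - z (Suc k) = - ((real (Suc k) * \<tau> - t) *\<^sub>R \<xi> k)"
      unfolding zS by simp
    then have "norm (z 0 + integral {0..t} \<zeta> - z (Suc k)) = (real (Suc k) * \<tau> - t) * norm (\<xi> k)"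
      using k(3) by (simp only: norm_minus_cancel norm_scaleR)
    also have "\<dots> \<le> \<tau> * norm (\<xi> k)" using small by (intro mult_right_mono) auto
    also have "\<dots> \<le> \<omega>"
      using slope'[OF k(1)] \<omega>[of "real k * \<tau>" "real (Suc k) * \<tau>"] tk[of k] k(1) kT(1) cell_le[of k]
      by (simp add: \<tau>_def)
    finally have "norm (z 0 + integral {0..t} \<zeta> - z (Suc k)) \<le> \<omega>" .
    then show "\<exists>k<N. \<zeta> t = \<xi> k \<and> t \<le> Suc k * (T / N) \<and> Suc k * (T / N) \<le> T \<and> Suc k * (T / N) - t \<le> T / N \<and>
        norm (z 0 + integral {0..t} \<zeta> - z (Suc k)) \<le> \<omega>"
      using k \<zeta>_cell[OF k(2,3,1)] kT(1) small unfolding \<tau>_def by blast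
  next
    fix x y :: real assume xy: "0 \<le> x" "x \<le> y" "y \<le> T"
    show "integral {x..y} (\<lambda>t. norm (\<zeta> t)) \<le> integral {x..y} g + 2 * \<omega>"
    proof (cases "y = 0")
      case True
      then show ?thesis using xy \<omega>0 by simp
    next
      case False
      then obtain k where k: "k < N" "real k * \<tau> < y" "y \<le> real (Suc k) * \<tau>" using cell[of y] xy by auto
      \<comment> \<open>Rounding the interval outwards to grid points adds at most one step on
        either side, which is the origin of \<open>2 * \<omega>\<close>.\<close>
      have "\<exists>j. j \<le> Suc k \<and> real j * \<tau> \<le> x \<and> x - real j * \<tau> \<le> \<tau>"
      proof (cases "x = 0")
        case True
        then show ?thesis using \<tau>(1) by (intro exI[of _ 0]) auto
      next
        case False
        then obtain j where j: "j < N" "real j * \<tau> < x" "x \<le> real (Suc j) * \<tau>" using cell[of x] xy by auto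
        then have "real j * \<tau> < real (Suc k) * \<tau>" using xy(2) k(3) by linarith
        then have "j \<le> Suc k" using \<tau>(1) by simp
        then show ?thesis using j cell_le(2)[of j] by (intro exI[of _ j]) auto
      qed
      then obtain j where j: "j \<le> Suc k" "real j * \<tau> \<le> x" "x - real j * \<tau> \<le> \<tau>" by blast
      define u w where "u = real j * \<tau>" and "w = real (Suc k) * \<tau>"
      have uw: "0 \<le> u" "u \<le> x" "y \<le> w" "w \<le> T" "x - u \<le> T / N" "w - y \<le> T / N"
        using j k tk[of "Suc k"] \<tau>(1) cell_le(2)[of k] by (auto simp: u_def w_def \<tau>_def)
      have "integral {x..y} (\<lambda>t. norm (\<zeta> t)) \<le> integral {u..w} (\<lambda>t. norm (\<zeta> t))"
        using nint uw by (intro integral_subset_le) auto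
      also have "\<dots> \<le> integral {u..w} g"
        unfolding u_def w_def
        by (rule sum_le[OF j(1) _ nint g(1)]) (use k(1) cell_norm slope' in auto)
      also have "\<dots> = integral {u..x} g + integral {x..y} g + integral {y..w} g"
        using integral_combine_HK[of u x w g]
          integral_combine_HK[of x y w g] uw xy gint by simp
      also have "\<dots> \<le> integral {x..y} g + 2 * \<omega>"
        using \<omega>[of u x] \<omega>[of y w] uw xy by simp
      finally show ?thesis .
    qed
  next
    have "integral {real 0 * \<tau>..real N * \<tau>} (\<lambda>t. (norm (\<zeta> t))\<^sup>2) \<le> integral {real 0 * \<tau>..real N * \<tau>} (\<lambda>t. (g t)\<^sup>2)"
    proof (rule sum_le[OF _ _ simple_map_sq_integrable[OF sm] g2])
      fix k assume k: "k < N"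
      let ?I = "{real k * \<tau>..real (Suc k) * \<tau>}"
      define c where "c = norm (\<xi> k)"
      have sub: "f' integrable_on ?I" if "f' integrable_on {0..T}" for f' :: "real \<Rightarrow> real"
        by (rule integrable_on_subinterval[OF that]) (use tk[of k] tk[of "Suc k"] k in auto)
      \<comment> \<open>Jensen on one cell: the integral of \<open>(g t - c)\<^sup>2\<close> is
        nonnegative, and the mean of \<open>g\<close> over the cell is at least
        \<open>c\<close>.\<close>
      have "((\<lambda>t. (g t)\<^sup>2 - 2 * c * g t + c\<^sup>2) has_integral
          (integral ?I (\<lambda>t. (g t)\<^sup>2) - 2 * c * integral ?I g + (real (Suc k) * \<tau> - real k * \<tau>) *\<^sub>R c\<^sup>2)) ?I"
        using sub[OF g(1)] sub[OF g2] has_integral_const_real[of "c\<^sup>2" "real k * \<tau>" "real (Suc k) * \<tau>"] cell_le(1)[of k]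
        by (intro has_integral_add has_integral_diff has_integral_mult_right integrable_integral) auto
      then have "0 \<le> integral ?I (\<lambda>t. (g t)\<^sup>2) - 2 * c * integral ?I g + (real (Suc k) * \<tau> - real k * \<tau>) *\<^sub>R c\<^sup>2"
      proof (rule has_integral_nonneg)
        fix t
        have "(g t)\<^sup>2 - 2 * c * g t + c\<^sup>2 = (g t - c)\<^sup>2" by (simp add: power2_diff)
        then show "0 \<le> (g t)\<^sup>2 - 2 * c * g t + c\<^sup>2" by simp
      qed
      then have 1: "0 \<le> integral ?I (\<lambda>t. (g t)\<^sup>2) - 2 * c * integral ?I g + \<tau> * c\<^sup>2"
        unfolding cell_le(2) by simp
      have "c * (\<tau> * c) \<le> c * integral ?I g"
        using slope'[OF k] by (intro mult_left_mono) (auto simp: c_def)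
      moreover have "integral ?I (\<lambda>t. (norm (\<zeta> t))\<^sup>2) = \<tau> * c\<^sup>2"
        using integral_unique[OF hi[OF order_refl cell_le(1) order_refl k, of "\<lambda>x. (norm x)\<^sup>2"]]
        unfolding cell_le(2) c_def by simp
      ultimately show "integral ?I (\<lambda>t. (norm (\<zeta> t))\<^sup>2) \<le> integral ?I (\<lambda>t. (g t)\<^sup>2)"
        using 1 by (simp add: power2_eq_square algebra_simps)
    qed auto
    then show "sq_int T \<zeta> \<le> integral {0..T} (\<lambda>t. (g t)\<^sup>2)"
      using \<tau>(2) by (simp add: sq_int_def)
  qed
qed

text \<open>The inclusion is relaxed by displacing the argument of \<open>A\<close>, not the slope,
  because the Euler inclusion is exact at the end of the cell. The bounds \<open>g\<close>,
  \<open>B\<close> and \<open>M\<close> do not depend on \<epsilon>: \<open>g\<close> serves the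
  Cauchy property, \<open>B\<close> membership in \<open>H1\<close>, and \<open>M\<close> the first
  estimate.\<close>

definition approx_solution where
  "approx_solution l z0 g B M \<epsilon> \<zeta> \<longleftrightarrow> simple_map \<zeta> \<and>
     (\<forall>t. 0 < t \<longrightarrow> t \<le> T \<longrightarrow> (\<exists>w. \<zeta> t \<in> A w \<and> norm (w - (R (l t) - Q (z0 + integral {0..t} \<zeta>))) \<le> \<epsilon>)) \<and>
     (\<forall>x y. 0 \<le> x \<longrightarrow> x \<le> y \<longrightarrow> y \<le> T \<longrightarrow> integral {x..y} (\<lambda>t. norm (\<zeta> t)) \<le> integral {x..y} g + \<epsilon>) \<and>
     sq_int T \<zeta> \<le> B \<and> (\<forall>t\<in>{0..T}. norm (z0 + integral {0..t} \<zeta>) \<le> M + \<epsilon>)"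

section \<open>Existence and uniqueness\<close>

text \<open>Here the boundedness of the minimal section enters: it bounds the Euler slopes uniformly in the
  step size by the square integrable function \<open>K (norm l' + S)\<close>.\<close>

lemma approx_solution_exists:
  assumes A0: "\<And>B. bounded B \<Longrightarrow> B \<subseteq> dom_op A \<Longrightarrow> bounded (min_section A ` B)"
    and l: "H1 T l" and init: "R (l 0) - Q z0 \<in> dom_op A"
    and C: "C > 0" "euler_bound_const C"
  obtains g B where "g integrable_on {0..T}" "\<And>t. 0 \<le> g t"
    "\<And>\<epsilon>. \<epsilon> > 0 \<Longrightarrow> \<exists>\<zeta>. approx_solution l z0 g B
        (C * (1 + norm z0 + sup_norm_on T l + L1_norm_on T (tderiv l))) \<epsilon> \<zeta>"
proof -
  obtain v where v: "strongly_measurable_on {0..T} v"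
    "set_integrable lebesgue {0..T} (\<lambda>t. norm (v t))"
    "set_integrable lebesgue {0..T} (\<lambda>t. (norm (v t))\<^sup>2)"
    "\<And>x y. 0 \<le> x \<Longrightarrow> x \<le> y \<Longrightarrow> y \<le> T \<Longrightarrow> (v has_integral (l y - l x)) {x..y}"
    "L1_norm_on T (tderiv l) = integral {0..T} (\<lambda>t. norm (v t))"
    by (rule H1_obtain[OF l T_pos], rule that)
  note vn = set_lebesgue_integral_eq_integral(1)[OF v(2)] and v2 = set_lebesgue_integral_eq_integral(1)[OF v(3)]
  have vint: "(\<lambda>t. norm (v t)) integrable_on {x..y}" if "0 \<le> x" "y \<le> T" for x y
    by (rule integrable_on_subinterval[OF vn]) (use that in auto)
  define \<Gamma>l where "\<Gamma>l t = integral {0..t} (\<lambda>t. norm (v t))" for t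
  have \<Gamma>l: "integral {x..y} (\<lambda>t. norm (v t)) = \<Gamma>l y - \<Gamma>l x" if "0 \<le> x" "x \<le> y" "y \<le> T" for x y
    unfolding \<Gamma>l_def using integral_combine_HK[OF that(1,2) vint[OF _ that(3)]] by simp
  have lv: "norm (l y - l x) \<le> integral {x..y} (\<lambda>t. norm (v t))" if "0 \<le> x" "x \<le> y" "y \<le> T" for x y
    using norm_increment_le_integral[OF v(4)[OF that] vint] that by simp
  define L where "L = sup_norm_on T l"
  have L: "norm (l t) \<le> L" if "t \<in> {0..T}" for t
    unfolding L_def using H1_continuous_on[OF l T_pos] that by (rule sup_norm_on_upper)
  define M where "M = C * (1 + norm z0 + L + L1_norm_on T (tderiv l))"
  have zM: "norm (z k) \<le> M" if "N > 0" "euler N l z \<xi>" "z 0 = z0" "k \<le> N" for N z \<xi> k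
  proof -
    have "norm (z k) \<le> C * (1 + norm (z 0) + L + (\<Gamma>l T - \<Gamma>l 0))"
      using that lv \<Gamma>l L by (intro C(2)[unfolded euler_bound_const_def, rule_format, of N l z \<xi> \<Gamma>l]) auto
    then show ?thesis using that(3) \<Gamma>l[of 0 T] T_pos by (simp add: M_def v(5))
  qed
  obtain KR where KR: "KR > 0" "\<And>x. norm (R x) \<le> norm x * KR" using R.pos_bounded by blast
  obtain KQ where KQ: "KQ > 0" "\<And>x. norm (Q x) \<le> norm x * KQ" using P.pos_bounded by blast
  \<comment> \<open>The radius bounds \<open>R l - Q z\<close> for all loads bounded by
    \<open>L\<close> and all states bounded by \<open>M\<close>, whatever the step size.\<close>
  have "bounded (min_section A ` (dom_op A \<inter> cball 0 (L * KR + M * KQ)))"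
    by (rule A0) (auto intro: bounded_subset[OF bounded_cball])
  then obtain S where S: "S > 0" "\<And>h. h \<in> dom_op A \<Longrightarrow> norm h \<le> L * KR + M * KQ \<Longrightarrow> norm (min_section A h) \<le> S"
    unfolding bounded_pos by (auto simp: dist_norm)
  obtain K where K: "K \<ge> 1" "\<And>N l z \<xi> k a. N > 0 \<Longrightarrow> euler N l z \<xi> \<Longrightarrow>
      a \<in> A (R (l (k * (T / N))) - Q (z k)) \<Longrightarrow>
      (T / N) * norm (\<xi> k) \<le> K * (norm (l (Suc k * (T / N)) - l (k * (T / N))) + (T / N) * norm a)"
    using euler_slope_bound by blast
  define g where "g t = K * (norm (v t) + S)" for t
  have g0: "0 \<le> g t" for t using K(1) S(1) by (simp add: g_def)
  have gint: "g integrable_on {x..y}" if "0 \<le> x" "y \<le> T" for x y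
    unfolding g_def using vint[OF that]
    by (intro integrable_on_mult_right integrable_add integrable_const_ivl)
  have g2: "(\<lambda>t. (g t)\<^sup>2) integrable_on {0..T}"
  proof -
    have "(\<lambda>t. K\<^sup>2 * ((norm (v t))\<^sup>2 + 2 * S * norm (v t) + S\<^sup>2)) integrable_on {0..T}"
      using v2 vn by (intro integrable_on_mult_right integrable_add integrable_const_ivl)
    moreover have "K\<^sup>2 * ((norm (v t))\<^sup>2 + 2 * S * norm (v t) + S\<^sup>2) = (g t)\<^sup>2" for t
      by (simp add: g_def power2_eq_square algebra_simps)
    ultimately show ?thesis by simp
  qed
  have gv: "integral {x..y} (\<lambda>t. norm (v t)) \<le> integral {x..y} g" if "0 \<le> x" "y \<le> T" for x y
  proof (intro integral_le vint gint that)
    fix t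
    have "norm (v t) \<le> norm (v t) + S" using S by simp
    also have "\<dots> \<le> K * (norm (v t) + S)" using K(1) S(1) mult_right_mono[OF K(1), of "norm (v t) + S"] by simp
    finally show "norm (v t) \<le> g t" by (simp add: g_def)
  qed
  have gI: "integral {x..y} g = K * (integral {x..y} (\<lambda>t. norm (v t)) + S * (y - x))" if "0 \<le> x" "x \<le> y" "y \<le> T" for x y
  proof -
    have "integral {x..y} (\<lambda>t. norm (v t) + S) = integral {x..y} (\<lambda>t. norm (v t)) + integral {x..y} (\<lambda>t. S)"
      using vint[of x y] that by (intro integral_add_HK integrable_const_ivl) auto
    then show ?thesis unfolding g_def using that by simp
  qed
  have slope: "(T / N) * norm (\<xi> k) \<le> integral {k * (T / N)..Suc k * (T / N)} g"
    if N: "N > 0" and e: "euler N l z \<xi>" and z0: "z 0 = z0" and k: "k < N" for N z \<xi> k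
  proof -
    define \<tau> where "\<tau> = T / N"
    have \<tau>: "\<tau> > 0" "real N * \<tau> = T" using N T_pos by (simp_all add: \<tau>_def)
    have "real k * \<tau> \<le> real N * \<tau>" "real (Suc k) * \<tau> \<le> real N * \<tau>"
      using k \<tau>(1) by (intro mult_right_mono; simp)+
    then have tk: "0 \<le> real k * \<tau>" "real k * \<tau> \<le> real (Suc k) * \<tau>" "real (Suc k) * \<tau> \<le> T"
      using \<tau> by (auto simp: algebra_simps)
    define h where "h = R (l (real k * \<tau>)) - Q (z k)"
    \<comment> \<open>Initially by admissibility, later because the preceding step ended with an
      inclusion at this very argument.\<close>
    have dom: "h \<in> dom_op A"
    proof (cases k)
      case 0
      then show ?thesis using init z0 by (simp add: h_def)
    next
      case (Suc j)
      have "\<xi> j \<in> A (R (l (real (Suc j) * (T / N))) - Q (z (Suc j)))"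
        using e unfolding euler_def by blast
      then have "\<xi> j \<in> A h" by (simp only: h_def Suc \<tau>_def)
      then show ?thesis by (auto simp: dom_op_def)
    qed
    have "norm h \<le> norm (R (l (real k * \<tau>))) + norm (Q (z k))" by (simp add: h_def norm_triangle_ineq4)
    also have "\<dots> \<le> norm (l (real k * \<tau>)) * KR + norm (z k) * KQ" by (intro add_mono KR(2) KQ(2))
    also have "\<dots> \<le> L * KR + M * KQ"
      using L[of "real k * \<tau>"] tk zM[OF N e z0, of k] k KR(1) KQ(1)
      by (intro add_mono mult_right_mono) auto
    finally have a: "norm (min_section A h) \<le> S" using S(2)[OF dom] by blast
    have "\<tau> * norm (\<xi> k) \<le> K * (norm (l (Suc k * \<tau>) - l (k * \<tau>)) + \<tau> * norm (min_section A h))"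
      using K(2)[OF N e, of "min_section A h" k] min_section_in[OF A_maxmon dom]
      by (simp only: h_def \<tau>_def)
    also have "\<dots> \<le> K * (integral {k * \<tau>..Suc k * \<tau>} (\<lambda>t. norm (v t)) + \<tau> * S)"
      using K(1) \<tau>(1) a lv[OF tk] by (intro mult_left_mono add_mono) auto
    also have "\<dots> = integral {k * \<tau>..Suc k * \<tau>} g"
    proof -
      have "real (Suc k) * \<tau> - real k * \<tau> = \<tau>" by (simp add: algebra_simps)
      then show ?thesis unfolding gI[OF tk] by (simp only: mult.commute[of S])
    qed
    finally show ?thesis by (simp only: \<tau>_def)
  qed
  define \<Gamma> where "\<Gamma> t = integral {0..t} g" for t
  have \<Gamma>: "integral {x..y} g = \<Gamma> y - \<Gamma> x" if "0 \<le> x" "x \<le> y" "y \<le> T" for x y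
    unfolding \<Gamma>_def using integral_combine_HK[OF that(1,2) gint[OF _ that(3)]] by simp
  have "continuous_on {0..T} \<Gamma>"
    unfolding \<Gamma>_def using gint[of 0 T] T_pos by (intro indefinite_integral_continuous_1) auto
  then have uc: "uniformly_continuous_on {0..T} \<Gamma>" by (rule compact_uniformly_continuous) simp
  show thesis
  proof (rule that[OF gint[of 0 T] g0])
    fix \<epsilon> :: real assume \<epsilon>: "\<epsilon> > 0"
    \<comment> \<open>Small enough for three purposes: \<open>2 * \<omega>\<close> for the
      variation, \<open>\<omega> * KR + \<omega> * KQ\<close> for the displacement of the argument,
      and \<open>\<omega>\<close> for the states.\<close>
    define \<omega> where "\<omega> = \<epsilon> / (2 + KR + KQ)"
    have \<omega>: "\<omega> > 0" "2 * \<omega> \<le> \<epsilon>" "\<omega> * KR + \<omega> * KQ \<le> \<epsilon>" "\<omega> \<le> \<epsilon>"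
    proof -
      have den: "2 + KR + KQ > 0" using KR(1) KQ(1) by simp
      show "\<omega> > 0" using \<epsilon> den by (simp add: \<omega>_def)
      have "2 * \<omega> + \<omega> * KR + \<omega> * KQ = \<omega> * (2 + KR + KQ)" by (simp add: algebra_simps)
      also have "\<dots> = \<epsilon>" using den by (simp add: \<omega>_def)
      finally have eq: "2 * \<omega> + \<omega> * KR + \<omega> * KQ = \<epsilon>" .
      have "\<omega> * KR > 0" "\<omega> * KQ > 0" using \<open>\<omega> > 0\<close> KR(1) KQ(1) by auto
      then show "2 * \<omega> \<le> \<epsilon>" "\<omega> * KR + \<omega> * KQ \<le> \<epsilon>" "\<omega> \<le> \<epsilon>" using eq \<open>\<omega> > 0\<close> by linarith+
    qed
    obtain \<delta> where \<delta>: "\<delta> > 0" "\<And>x y. x \<in> {0..T} \<Longrightarrow> y \<in> {0..T} \<Longrightarrow> dist y x < \<delta> \<Longrightarrow> dist (\<Gamma> y) (\<Gamma> x) < \<omega>"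
      using uc \<omega>(1) unfolding uniformly_continuous_on_def by metis
    obtain N where N: "N > 0" "T / real N < \<delta>"
    proof -
      obtain n :: nat where n: "T / \<delta> < real n" using reals_Archimedean2 by blast
      then have "n > 0" using T_pos \<delta>(1) by (metis divide_pos_pos less_trans of_nat_0_less_iff)
      moreover have "T / real n < \<delta>" using n \<delta>(1) \<open>n > 0\<close> by (simp add: field_simps)
      ultimately show thesis using that by blast
    qed
    have g\<omega>: "integral {x..y} g \<le> \<omega>" if "0 \<le> x" "x \<le> y" "y \<le> T" "y - x \<le> T / N" for x y
      using \<delta>(2)[of x y] that N(2) by (auto simp: \<Gamma> dist_real_def)
    obtain z \<xi> where z: "z 0 = z0" "euler N l z \<xi>" using euler_exists[OF N(1)] by blast
    obtain \<zeta> where \<zeta>: "simple_map \<zeta>"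
      "\<And>t. 0 < t \<Longrightarrow> t \<le> T \<Longrightarrow> \<exists>k<N. \<zeta> t = \<xi> k \<and> t \<le> Suc k * (T / N) \<and> Suc k * (T / N) \<le> T \<and> Suc k * (T / N) - t \<le> T / N \<and>
          norm (z 0 + integral {0..t} \<zeta> - z (Suc k)) \<le> \<omega>"
      "\<And>x y. 0 \<le> x \<Longrightarrow> x \<le> y \<Longrightarrow> y \<le> T \<Longrightarrow> integral {x..y} (\<lambda>t. norm (\<zeta> t)) \<le> integral {x..y} g + 2 * \<omega>"
      "sq_int T \<zeta> \<le> integral {0..T} (\<lambda>t. (g t)\<^sup>2)"
      using euler_interpolation[OF N(1) z(2) slope[OF N(1) z(2,1)] gint[of 0 T] g0 g2 g\<omega>] by auto
    have "approx_solution l z0 g (integral {0..T} (\<lambda>t. (g t)\<^sup>2)) M \<epsilon> \<zeta>"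
      unfolding approx_solution_def
    proof (intro conjI allI impI ballI)
      show "simple_map \<zeta>" by (rule \<zeta>(1))
      show "sq_int T \<zeta> \<le> integral {0..T} (\<lambda>t. (g t)\<^sup>2)" by (rule \<zeta>(4))
      show "integral {x..y} (\<lambda>t. norm (\<zeta> t)) \<le> integral {x..y} g + \<epsilon>" if "0 \<le> x" "x \<le> y" "y \<le> T" for x y
        using \<zeta>(3)[OF that] \<omega>(2) by linarith
      show "norm (z0 + integral {0..t} \<zeta>) \<le> M + \<epsilon>" if t: "t \<in> {0..T}" for t
      proof (cases "t = 0")
        case True
        then show ?thesis using zM[OF N(1) z(2,1), of 0] z(1) \<epsilon> by simp
      next
        case False
        then obtain k where k: "k < N" "norm (z 0 + integral {0..t} \<zeta> - z (Suc k)) \<le> \<omega>"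
          using \<zeta>(2)[of t] t by auto
        have "norm (z0 + integral {0..t} \<zeta>) \<le> norm (z 0 + integral {0..t} \<zeta> - z (Suc k)) + norm (z (Suc k))"
          unfolding z(1) by (metis diff_add_cancel norm_triangle_ineq)
        then show ?thesis using k zM[OF N(1) z(2,1), of "Suc k"] \<omega>(4) by simp
      qed
      fix t assume t: "0 < t" "t \<le> T"
      obtain k where k: "k < N" "\<zeta> t = \<xi> k" "t \<le> Suc k * (T / N)" "Suc k * (T / N) \<le> T" "Suc k * (T / N) - t \<le> T / N"
          "norm (z 0 + integral {0..t} \<zeta> - z (Suc k)) \<le> \<omega>"
        using \<zeta>(2)[OF t] by blast
      define s where "s = Suc k * (T / N)"
      define w where "w = R (l s) - Q (z (Suc k))"
      have wA: "\<zeta> t \<in> A w" using z(2) unfolding euler_def w_def s_def k(2) by blast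
      have s: "t \<le> s" "s \<le> T" "s - t \<le> T / N" using k by (simp_all add: s_def)
      have "w - (R (l t) - Q (z0 + integral {0..t} \<zeta>)) = R (l s - l t) + Q (z 0 + integral {0..t} \<zeta> - z (Suc k))"
        by (simp add: w_def R.diff P.diff z(1))
      then have "norm (w - (R (l t) - Q (z0 + integral {0..t} \<zeta>))) \<le>
          norm (R (l s - l t)) + norm (Q (z 0 + integral {0..t} \<zeta> - z (Suc k)))"
        by (simp only: norm_triangle_ineq)
      also have "\<dots> \<le> norm (l s - l t) * KR + norm (z 0 + integral {0..t} \<zeta> - z (Suc k)) * KQ"
        by (intro add_mono KR(2) KQ(2))
      also have "\<dots> \<le> \<omega> * KR + \<omega> * KQ"
      proof -
        have "norm (l s - l t) \<le> \<omega>"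
          using lv[of t s] gv[of t s] g\<omega>[of t s] t s by linarith
        then show ?thesis using k(6) KR(1) KQ(1) by (intro add_mono mult_right_mono) auto
      qed
      also have "\<dots> \<le> \<epsilon>" by (rule \<omega>(3))
      finally show "\<exists>w. \<zeta> t \<in> A w \<and> norm (w - (R (l t) - Q (z0 + integral {0..t} \<zeta>))) \<le> \<epsilon>"
        using wA by blast
    qed
    then show "\<exists>\<zeta>. approx_solution l z0 g (integral {0..T} (\<lambda>t. (g t)\<^sup>2))
        (C * (1 + norm z0 + sup_norm_on T l + L1_norm_on T (tderiv l))) \<epsilon> \<zeta>"
      unfolding M_def L_def by blast
  qed (use T_pos in auto)
qed

text \<open>Monotonicity at almost every time is the hypothesis of
  \<open>quadratic_form_bound\<close> with \<open>\<kappa> = 0\<close>, so the energy of the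
  difference stays zero.\<close>

lemma solution_unique:
  assumes z: "is_solution T A R Q z0 l z" and z': "is_solution T A R Q z0 l z'" and t: "t \<in> {0..T}"
  shows "z' t = z t"
proof -
  have H: "H1 T z" "H1 T z'" and init: "z 0 = z0" "z' 0 = z0" using z z' by (auto simp: is_solution_def)
  obtain v where v: "strongly_measurable_on {0..T} v"
    "set_integrable lebesgue {0..T} (\<lambda>t. norm (v t))"
    "\<And>x y. 0 \<le> x \<Longrightarrow> x \<le> y \<Longrightarrow> y \<le> T \<Longrightarrow> (v has_integral (z y - z x)) {x..y}"
    "AE t in lebesgue. t \<in> {0..T} \<longrightarrow> (z has_vector_derivative v t) (at t)"
    by (rule H1_obtain[OF H(1) T_pos], rule that)
  obtain v' where v': "strongly_measurable_on {0..T} v'"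
    "set_integrable lebesgue {0..T} (\<lambda>t. norm (v' t))"
    "\<And>x y. 0 \<le> x \<Longrightarrow> x \<le> y \<Longrightarrow> y \<le> T \<Longrightarrow> (v' has_integral (z' y - z' x)) {x..y}"
    "AE t in lebesgue. t \<in> {0..T} \<longrightarrow> (z' has_vector_derivative v' t) (at t)"
    by (rule H1_obtain[OF H(2) T_pos], rule that)
  have "AE t in lebesgue. t \<in> {0<..<T} \<longrightarrow> tderiv z t \<in> A (R (l t) - Q (z t))"
    "AE t in lebesgue. t \<in> {0<..<T} \<longrightarrow> tderiv z' t \<in> A (R (l t) - Q (z' t))"
    using z z' by (auto simp: is_solution_def)
  then have ae: "AE t in lebesgue. t \<in> {0..T} \<longrightarrow> inner (Q (z t - z' t)) (v t - v' t) \<le> 0 * norm (v t - v' t)"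
    using v(4) v'(4) AE_lebesgue_neq[of 0] AE_lebesgue_neq[of T]
  proof eventually_elim
    case (elim t)
    show ?case
    proof
      assume t: "t \<in> {0..T}"
      have "v t \<in> A (R (l t) - Q (z t))" "v' t \<in> A (R (l t) - Q (z' t))"
        using elim t by (auto simp: tderiv_def dest: vector_derivative_at)
      then have "0 \<le> inner (v t - v' t) ((R (l t) - Q (z t)) - (R (l t) - Q (z' t)))"
        by (rule maximal_monotoneD[OF A_maxmon])
      also have "(R (l t) - Q (z t)) - (R (l t) - Q (z' t)) = - Q (z t - z' t)"
        by (simp add: P.diff)
      finally show "inner (Q (z t - z' t)) (v t - v' t) \<le> 0 * norm (v t - v' t)"
        by (simp add: inner_commute)
    qed
  qed
  have "inner (Q (z t - z' t)) (z t - z' t) \<le> 2 * 0 * integral {0..t} (\<lambda>t. norm (v t - v' t))"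
  proof (rule quadratic_form_bound[OF lin sym form_nonneg _ _ ae t])
    show "((\<lambda>t. v t - v' t) has_integral (z t - z' t)) {0..t}" if "t \<in> {0..T}" for t
      using has_integral_diff[OF v(3)[of 0 t] v'(3)[of 0 t]] that by (simp add: init)
    show "(\<lambda>t. norm (v t - v' t)) integrable_on {0..T}"
      using set_integrable_norm_diff[OF v(1,2) v'(1,2)] by (rule set_lebesgue_integral_eq_integral(1))
  qed
  then have "\<gamma> * (norm (z t - z' t))\<^sup>2 \<le> 0" using coercive[of "z t - z' t"] by simp
  then show ?thesis using \<gamma>_pos by (simp add: mult_le_0_iff)
qed

text \<open>Displaced arguments spoil monotonicity by at most
  \<open>\<epsilon>1 + \<epsilon>2\<close> times the norm of the difference of slopes. The integral
  of that norm is bounded through \<open>g\<close>, so the squared distance is of first order in the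
  displacements.\<close>

lemma approx_solution_distance:
  assumes a1: "approx_solution l z0 g B M \<epsilon>1 \<zeta>1" and a2: "approx_solution l z0 g B M \<epsilon>2 \<zeta>2"
    and g: "g integrable_on {0..T}" "\<And>t. 0 \<le> g t" and t: "t \<in> {0..T}"
    and \<epsilon>: "\<epsilon>1 \<ge> 0" "\<epsilon>2 \<ge> 0"
  shows "\<gamma> * (norm (integral {0..t} \<zeta>1 - integral {0..t} \<zeta>2))\<^sup>2
      \<le> 2 * (\<epsilon>1 + \<epsilon>2) * (2 * integral {0..T} g + (\<epsilon>1 + \<epsilon>2))"
proof -
  have s: "simple_map \<zeta>1" "simple_map \<zeta>2" using a1 a2 by (auto simp: approx_solution_def)
  note i = simple_map_integrable_on[OF s(1)] simple_map_integrable_on[OF s(2)]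
  note ni = simple_map_integrable_on[OF simple_map_comp[OF s(1)], of norm] simple_map_integrable_on[OF simple_map_comp[OF s(2)], of norm]
  have nd: "(\<lambda>t. norm (\<zeta>1 t - \<zeta>2 t)) integrable_on {x..y}" for x y
    by (rule simple_map_integrable_on[OF simple_map_comp2[OF s]])
  define e where "e t = integral {0..t} \<zeta>1 - integral {0..t} \<zeta>2" for t
  have "inner (Q (e t)) (e t) \<le> 2 * (\<epsilon>1 + \<epsilon>2) * integral {0..t} (\<lambda>t. norm (\<zeta>1 t - \<zeta>2 t))"
  proof (rule quadratic_form_bound[OF lin sym form_nonneg _ nd _ t])
    show "((\<lambda>t. \<zeta>1 t - \<zeta>2 t) has_integral e t) {0..t}" for t
      unfolding e_def by (intro has_integral_diff integrable_integral i)
    show "AE t in lebesgue. t \<in> {0..T} \<longrightarrow> inner (Q (e t)) (\<zeta>1 t - \<zeta>2 t) \<le> (\<epsilon>1 + \<epsilon>2) * norm (\<zeta>1 t - \<zeta>2 t)"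
      using AE_lebesgue_neq[of 0]
    proof eventually_elim
      case (elim t)
      show ?case
      proof
        assume "t \<in> {0..T}"
        then have t: "0 < t" "t \<le> T" using elim by auto
        define u where "u = (\<lambda>\<zeta>. R (l t) - Q (z0 + integral {0..t} \<zeta>))"
        obtain w1 where w1: "\<zeta>1 t \<in> A w1" "norm (w1 - u \<zeta>1) \<le> \<epsilon>1"
          using a1 t unfolding approx_solution_def u_def by blast
        obtain w2 where w2: "\<zeta>2 t \<in> A w2" "norm (w2 - u \<zeta>2) \<le> \<epsilon>2"
          using a2 t unfolding approx_solution_def u_def by blast
        have "u \<zeta>1 - u \<zeta>2 = - Q (e t)" by (simp add: u_def e_def P.diff P.add)
        then have w: "w1 - w2 = (w1 - u \<zeta>1) - (w2 - u \<zeta>2) - Q (e t)" by (simp add: algebra_simps)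
        have "0 \<le> inner (\<zeta>1 t - \<zeta>2 t) (w1 - w2)" by (rule maximal_monotoneD[OF A_maxmon w1(1) w2(1)])
        then have "inner (Q (e t)) (\<zeta>1 t - \<zeta>2 t) \<le> inner (\<zeta>1 t - \<zeta>2 t) ((w1 - u \<zeta>1) - (w2 - u \<zeta>2))"
          unfolding w by (simp add: inner_diff_right inner_commute)
        also have "\<dots> \<le> norm (\<zeta>1 t - \<zeta>2 t) * norm ((w1 - u \<zeta>1) - (w2 - u \<zeta>2))" by (rule norm_cauchy_schwarz)
        also have "\<dots> \<le> norm (\<zeta>1 t - \<zeta>2 t) * (\<epsilon>1 + \<epsilon>2)"
          using norm_triangle_ineq4[of "w1 - u \<zeta>1" "w2 - u \<zeta>2"] w1(2) w2(2) by (intro mult_left_mono) auto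
        finally show "inner (Q (e t)) (\<zeta>1 t - \<zeta>2 t) \<le> (\<epsilon>1 + \<epsilon>2) * norm (\<zeta>1 t - \<zeta>2 t)"
          by (simp add: mult.commute)
      qed
    qed
  qed
  also have "\<dots> \<le> 2 * (\<epsilon>1 + \<epsilon>2) * (2 * integral {0..T} g + (\<epsilon>1 + \<epsilon>2))"
  proof (intro mult_left_mono)
    have "integral {0..t} (\<lambda>t. norm (\<zeta>1 t - \<zeta>2 t)) \<le> integral {0..t} (\<lambda>t. norm (\<zeta>1 t) + norm (\<zeta>2 t))"
      by (intro integral_le nd integrable_add ni norm_triangle_ineq4)
    also have "\<dots> = integral {0..t} (\<lambda>t. norm (\<zeta>1 t)) + integral {0..t} (\<lambda>t. norm (\<zeta>2 t))"
      by (intro integral_add_HK ni)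
    also have "\<dots> \<le> (integral {0..t} g + \<epsilon>1) + (integral {0..t} g + \<epsilon>2)"
      using a1 a2 t by (intro add_mono) (auto simp: approx_solution_def)
    also have "integral {0..t} g \<le> integral {0..T} g"
    proof (rule integral_subset_le)
      show "g integrable_on {0..t}" by (rule integrable_on_subinterval[OF g(1)]) (use t in auto)
    qed (use t g in auto)
    finally show "integral {0..t} (\<lambda>t. norm (\<zeta>1 t - \<zeta>2 t)) \<le> 2 * integral {0..T} g + (\<epsilon>1 + \<epsilon>2)" by simp
  qed (use \<epsilon> in auto)
  finally show ?thesis using coercive[of "e t"] by (simp add: e_def)
qed

text \<open>Minty's argument on increments: the monotonicity inequality against a fixed pair
  \<open>(h, a)\<close> is integrated over \<open>{t..y}\<close>, where convergence of the
  trajectories suffices to let \<open>n\<close> grow. Dividing by \<open>y - t\<close> near a point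
  of differentiability gives the inequality for the derivative.\<close>

lemma limit_of_approx_solutions:
  assumes l: "H1 T l"
    and g: "g integrable_on {0..T}" "\<And>t. 0 \<le> g t"
    and approx: "\<And>\<epsilon>. \<epsilon> > 0 \<Longrightarrow> \<exists>\<zeta>. approx_solution l z0 g B M \<epsilon> \<zeta>"
  shows "\<exists>z. is_solution T A R Q z0 l z \<and> (\<forall>t\<in>{0..T}. norm (z t) \<le> M)"
proof -
  define \<epsilon> where "\<epsilon> n = 1 / real (Suc n)" for n
  have \<epsilon>: "\<epsilon> n > 0" "\<epsilon> n \<le> 1" for n by (simp_all add: \<epsilon>_def)
  have \<epsilon>_mono: "\<epsilon> k \<le> \<epsilon> n" if "n \<le> k" for n k using that by (simp add: \<epsilon>_def frac_le)
  have \<epsilon>0: "\<epsilon> \<longlonglongrightarrow> 0"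
    unfolding \<epsilon>_def by (rule one_over_Suc_tendsto_0)
  obtain \<zeta> where \<zeta>: "\<And>n. approx_solution l z0 g B M (\<epsilon> n) (\<zeta> n)"
    using choice[of "\<lambda>n. approx_solution l z0 g B M (\<epsilon> n)"] approx[OF \<epsilon>(1)] by blast
  have s: "simple_map (\<zeta> n)" for n using \<zeta>[of n] by (simp add: approx_solution_def)
  define zh where "zh n t = z0 + integral {0..t} (\<zeta> n)" for n t
  define I where "I = integral {0..T} g"
  have I0: "I \<ge> 0" unfolding I_def using g by (intro integral_nonneg) auto
  \<comment> \<open>From \<open>approx_solution_distance\<close> with both displacements at most
    \<open>\<epsilon> n\<close>, which is itself at most 1.\<close>
  define \<delta> where "\<delta> n = sqrt (8 * (I + 1) * \<epsilon> n / \<gamma>)" for n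
  have dist: "norm (zh n t - zh k t) \<le> \<delta> n" if nk: "n \<le> k" and t: "t \<in> {0..T}" for n k t
  proof -
    have "\<gamma> * (norm (zh n t - zh k t))\<^sup>2 \<le> 2 * (\<epsilon> n + \<epsilon> k) * (2 * I + (\<epsilon> n + \<epsilon> k))"
      using approx_solution_distance[OF \<zeta>[of n] \<zeta>[of k] g t] \<epsilon>(1)[of n] \<epsilon>(1)[of k] by (simp add: zh_def I_def)
    also have "\<dots> \<le> 2 * (\<epsilon> n + \<epsilon> n) * (2 * I + (1 + 1))"
      using \<epsilon>(1)[of n] \<epsilon>(1)[of k] \<epsilon>(2)[of n] \<epsilon>(2)[of k] \<epsilon>_mono[OF nk] I0 by (intro mult_mono add_mono) auto
    also have "\<dots> = 8 * (I + 1) * \<epsilon> n" by (simp add: algebra_simps)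
    finally have "(norm (zh n t - zh k t))\<^sup>2 \<le> 8 * (I + 1) * \<epsilon> n / \<gamma>"
      using \<gamma>_pos by (simp add: field_simps)
    then show ?thesis unfolding \<delta>_def by (rule real_le_rsqrt)
  qed
  have "(\<lambda>n. sqrt (8 * (I + 1) * \<epsilon> n / \<gamma>)) \<longlonglongrightarrow> sqrt (8 * (I + 1) * 0 / \<gamma>)"
    using \<gamma>_pos by (intro tendsto_intros \<epsilon>0) auto
  then have \<delta>0: "\<delta> \<longlonglongrightarrow> 0" by (simp add: \<delta>_def[abs_def])
  have conv: "convergent (\<lambda>n. zh n t)" if t: "t \<in> {0..T}" for t
  proof -
    have "Cauchy (\<lambda>n. zh n t)"
    proof (rule metric_CauchyI)
      fix e :: real assume "e > 0"
      then have "\<forall>\<^sub>F n in sequentially. \<delta> n < e / 2" using \<delta>0 by (intro order_tendstoD) auto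
      then obtain N where N: "\<delta> N < e / 2" by (meson eventually_happens trivial_limit_sequentially)
      show "\<exists>M. \<forall>m\<ge>M. \<forall>n\<ge>M. dist (zh m t) (zh n t) < e"
      proof (intro exI[of _ N] allI impI)
        fix m n assume "N \<le> m" "N \<le> n"
        then have "dist (zh N t) (zh m t) \<le> \<delta> N" "dist (zh N t) (zh n t) \<le> \<delta> N"
          using dist t by (auto simp: dist_norm)
        then show "dist (zh m t) (zh n t) < e"
          using N dist_triangle3[of "zh m t" "zh n t" "zh N t"] by linarith
      qed
    qed
    then show ?thesis by (simp add: Cauchy_convergent_iff)
  qed
  define z where "z t = lim (\<lambda>n. zh n t)" for t
  have lim: "(\<lambda>n. zh n t) \<longlonglongrightarrow> z t" if "t \<in> {0..T}" for t
    using conv[OF that] by (simp add: z_def convergent_LIMSEQ_iff)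
  have zd: "norm (zh n t - z t) \<le> \<delta> n" if t: "t \<in> {0..T}" for n t
  proof (rule LIMSEQ_le_const2)
    show "(\<lambda>k. norm (zh n t - zh k t)) \<longlonglongrightarrow> norm (zh n t - z t)"
      by (intro tendsto_intros lim t)
    show "\<exists>N. \<forall>k\<ge>N. norm (zh n t - zh k t) \<le> \<delta> n" using dist t by blast
  qed
  have z00: "z 0 = z0" using lim[of 0] T_pos by (simp add: zh_def LIMSEQ_const_iff)
  have zM: "norm (z t) \<le> M" if t: "t \<in> {0..T}" for t
  proof (rule LIMSEQ_le)
    show "(\<lambda>n. norm (zh n t)) \<longlonglongrightarrow> norm (z t)" by (intro tendsto_intros lim t)
    have "(\<lambda>n. M + \<epsilon> n) \<longlonglongrightarrow> M + 0" by (intro tendsto_intros \<epsilon>0)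
    then show "(\<lambda>n. M + \<epsilon> n) \<longlonglongrightarrow> M" by simp
    show "\<exists>N. \<forall>n\<ge>N. norm (zh n t) \<le> M + \<epsilon> n"
      using \<zeta> t unfolding approx_solution_def zh_def by blast
  qed
  have H1z: "H1 T z"
  proof (rule H1_if_simple_approximations)
    fix e :: real assume "e > 0"
    then have "\<forall>\<^sub>F n in sequentially. \<delta> n < e" using \<delta>0 by (intro order_tendstoD) auto
    then obtain n where n: "\<delta> n < e" by (meson eventually_happens trivial_limit_sequentially)
    have "norm (integral {0..t} (\<zeta> n) - (z t - z 0)) \<le> e" if "t \<in> {0..T}" for t
    proof -
      have "integral {0..t} (\<zeta> n) - (z t - z 0) = zh n t - z t" by (simp add: zh_def z00)
      then show ?thesis using order_trans[OF zd[OF that, of n] less_imp_le[OF n]] by (simp only:)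
    qed
    then show "\<exists>\<zeta>. simple_map \<zeta> \<and> sq_int T \<zeta> \<le> B \<and> (\<forall>t\<in>{0..T}. norm (integral {0..t} \<zeta> - (z t - z 0)) \<le> e)"
      using \<zeta>[of n] unfolding approx_solution_def by blast
  qed (use T_pos in simp)
  obtain v where v: "AE t in lebesgue. t \<in> {0..T} \<longrightarrow> (z has_vector_derivative v t) (at t)"
    by (rule H1_obtain[OF H1z T_pos], rule that)
  define W where "W t = R (l t) - Q (z t)" for t
  have contW: "continuous_on {0..T} W"
    unfolding W_def
    by (intro continuous_intros R.continuous_on P.continuous_on H1_continuous_on[OF l T_pos] H1_continuous_on[OF H1z T_pos])
  obtain KQ where KQ: "KQ > 0" "\<And>x. norm (Q x) \<le> norm x * KQ" using P.pos_bounded by blast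
  \<comment> \<open>The oscillation error below is multiplied by the integral of the slopes over
    \<open>{t..y}\<close>. Bounding averages of \<open>g\<close> near \<open>t\<close> keeps that
    integral of order \<open>y - t\<close>.\<close>
  define gi where "gi t = indicat_real {0..T} t * g t" for t
  have "set_integrable lebesgue {0..T} g"
    using g by (intro nonnegative_absolutely_integrable_1) auto
  then have "integrable lebesgue gi" by (simp add: set_integrable_def gi_def[abs_def])
  moreover have "gi t \<ge> 0" for t using g(2) by (simp add: gi_def)
  ultimately have avg: "AE t in lebesgue. \<forall>\<eta>>0. \<exists>d>0. \<forall>a b. a \<le> t \<longrightarrow> t \<le> b \<longrightarrow> b - a < d \<longrightarrow>
           integral {a..b} gi \<le> (gi t + \<eta>) * (b - a)"
    by (rule AE_averages_upper_bound)
  have "AE t in lebesgue. t \<in> {0<..<T} \<longrightarrow> tderiv z t \<in> A (W t)"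
    using v avg
  proof eventually_elim
    case (elim t)
    show ?case
    proof
      assume t: "t \<in> {0<..<T}"
      then have der: "(z has_vector_derivative v t) (at t)" using elim(1) by auto
      have gi_pos: "gi t \<ge> 0" using g(2) by (simp add: gi_def)
      define G where "G = gi t + 1"
      obtain d1 where d1: "d1 > 0" "\<And>b. t \<le> b \<Longrightarrow> b - t < d1 \<Longrightarrow> integral {t..b} gi \<le> G * (b - t)"
        using elim(2) unfolding G_def by (meson order_refl zero_less_one)
      have "v t \<in> A (W t)"
      proof (rule maximal_monotone_memI[OF A_maxmon])
        fix h a assume a: "a \<in> A h"
        define q where "q = W t - h"
        \<comment> \<open>Errors per unit of time, each with a factor \<eta>: \<open>G\<close>
          bounds the average slopes, \<open>norm a\<close> belongs to the comparison element, and
          \<open>norm q\<close> to the remainder of the derivative.\<close>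
        show "0 \<le> inner (v t - a) (W t - h)"
        proof (rule nonneg_if_ge_small_multiples[of "G + norm a + norm q"])
          show "0 \<le> G + norm a + norm q" using gi_pos by (simp add: G_def)
          fix \<eta> :: real assume \<eta>: "\<eta> > 0"
          obtain d2 where d2: "d2 > 0" "\<And>r. r \<in> {0..T} \<Longrightarrow> dist r t < d2 \<Longrightarrow> dist (W r) (W t) < \<eta>"
            using contW t \<eta> unfolding continuous_on_iff by (metis greaterThanLessThan_iff atLeastAtMost_iff less_imp_le)
          obtain d3 where d3: "d3 > 0" "\<And>y. norm (y - t) < d3 \<Longrightarrow> norm (z y - z t - (y - t) *\<^sub>R v t) \<le> \<eta> * norm (y - t)"
            using der \<eta> unfolding has_vector_derivative_def has_derivative_at_alt by blast
          have "t < t + min (min d1 d2) (min d3 (T - t))" using d1(1) d2(1) d3(1) t by simp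
          then obtain y where "t < y" "y < t + min (min d1 d2) (min d3 (T - t))" using dense by blast
          then have y: "t < y" "y - t < d1" "y - t < d2" "y - t < d3" "y < T" by auto
          have yT: "y \<in> {0..T}" "t \<in> {0..T}" using y t by auto
          have step: "- (\<eta> + \<epsilon> n + KQ * \<delta> n) * (integral {t..y} g + \<epsilon> n + (y - t) * norm a)
              \<le> inner (zh n y - zh n t - (y - t) *\<^sub>R a) q" for n
          proof -
            \<comment> \<open>Oscillation of the limit argument, displacement in the approximate
              inclusion, and distance of the trajectories under \<open>Q\<close>.\<close>
            define \<eta>' where "\<eta>' = \<eta> + \<epsilon> n + KQ * \<delta> n"
            have \<eta>'0: "\<eta>' \<ge> 0" using \<eta> \<epsilon>(1)[of n] KQ(1) I0 \<gamma>_pos by (simp add: \<eta>'_def \<delta>_def less_imp_le)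
            have pt: "- \<eta>' * (norm (\<zeta> n r) + norm a) \<le> inner (\<zeta> n r - a) q" if r: "r \<in> {t..y}" for r
            proof -
              have r': "0 < r" "r \<le> T" "r \<in> {0..T}" using r t y by auto
              obtain w where w: "\<zeta> n r \<in> A w" "norm (w - (R (l r) - Q (zh n r))) \<le> \<epsilon> n"
                using \<zeta>[of n] r' unfolding approx_solution_def zh_def by blast
              have "0 \<le> inner (\<zeta> n r - a) (w - h)" by (rule maximal_monotoneD[OF A_maxmon w(1) a])
              also have "w - h = q + (w - W t)" by (simp add: q_def)
              finally have 1: "- inner (\<zeta> n r - a) (w - W t) \<le> inner (\<zeta> n r - a) q" by (simp add: inner_add_right)
              have eq: "w - W t = (w - (R (l r) - Q (zh n r))) - Q (zh n r - z r) + (W r - W t)"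
                by (simp add: W_def P.diff)
              have "norm (w - W t) \<le> norm (w - (R (l r) - Q (zh n r))) + norm (Q (zh n r - z r)) + norm (W r - W t)"
                unfolding eq by (intro norm_triangle_mono order_refl norm_triangle_ineq4)
              moreover have "norm (Q (zh n r - z r)) \<le> KQ * \<delta> n"
                using order_trans[OF KQ(2)[of "zh n r - z r"] mult_right_mono[OF zd[OF r'(3), of n]]] KQ(1)
                by (simp add: mult.commute)
              moreover have "norm (W r - W t) \<le> \<eta>" using d2(2)[OF r'(3)] r y by (simp add: dist_norm less_imp_le)
              ultimately have "norm (w - W t) \<le> \<eta>'" using w(2) by (simp add: \<eta>'_def)
              then have "norm (\<zeta> n r - a) * norm (w - W t) \<le> (norm (\<zeta> n r) + norm a) * \<eta>'"
                by (intro mult_mono norm_triangle_ineq4) auto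
              then have "inner (\<zeta> n r - a) (w - W t) \<le> (norm (\<zeta> n r) + norm a) * \<eta>'"
                using norm_cauchy_schwarz[of "\<zeta> n r - a" "w - W t"] by linarith
              then show ?thesis using 1 by (simp add: mult.commute)
            qed
            have zi: "\<zeta> n integrable_on {c..d}" for c d by (rule simple_map_integrable_on[OF s])
            have ni: "(\<lambda>r. norm (\<zeta> n r)) integrable_on {c..d}" for c d
              by (rule simple_map_integrable_on[OF simple_map_comp[OF s]])
            have "integral {t..y} (\<zeta> n) = zh n y - zh n t"
              using integral_combine_HK[of 0 t y "\<zeta> n"] zi t y by (simp add: zh_def algebra_simps)
            then have "(\<zeta> n has_integral (zh n y - zh n t)) {t..y}" using zi by (metis integrable_integral)
            then have "((\<lambda>r. \<zeta> n r - a) has_integral (zh n y - zh n t - (y - t) *\<^sub>R a)) {t..y}"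
              using has_integral_diff[OF _ has_integral_const_real[of a t y]] y by simp
            then have hi: "((\<lambda>r. inner (\<zeta> n r - a) q) has_integral inner (zh n y - zh n t - (y - t) *\<^sub>R a) q) {t..y}"
              by (rule has_integral_linear[OF _ bounded_linear_inner_left[of q], unfolded o_def])
            have hn: "((\<lambda>r. - \<eta>' * (norm (\<zeta> n r) + norm a)) has_integral
                - \<eta>' * (integral {t..y} (\<lambda>r. norm (\<zeta> n r)) + (y - t) *\<^sub>R norm a)) {t..y}"
              using has_integral_const_real[of "norm a" t y] y
              by (intro has_integral_mult_right has_integral_add integrable_integral ni) auto
            have "- \<eta>' * (integral {t..y} g + \<epsilon> n + (y - t) * norm a) \<le>
                - \<eta>' * (integral {t..y} (\<lambda>r. norm (\<zeta> n r)) + (y - t) *\<^sub>R norm a)"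
            proof -
              have "integral {t..y} (\<lambda>r. norm (\<zeta> n r)) \<le> integral {t..y} g + \<epsilon> n"
                using \<zeta>[of n] t y unfolding approx_solution_def by auto
              then show ?thesis using \<eta>'0 by (intro mult_left_mono_neg) auto
            qed
            also have "\<dots> \<le> inner (zh n y - zh n t - (y - t) *\<^sub>R a) q"
              using has_integral_le[OF hn hi] pt by blast
            finally show ?thesis by (simp add: \<eta>'_def)
          qed
          have "- (\<eta> + 0 + KQ * 0) * (integral {t..y} g + 0 + (y - t) * norm a)
              \<le> inner (z y - z t - (y - t) *\<^sub>R a) q"
          proof (rule LIMSEQ_le)
            show "(\<lambda>n. - (\<eta> + \<epsilon> n + KQ * \<delta> n) * (integral {t..y} g + \<epsilon> n + (y - t) * norm a))
                \<longlonglongrightarrow> - (\<eta> + 0 + KQ * 0) * (integral {t..y} g + 0 + (y - t) * norm a)"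
              by (intro tendsto_intros \<epsilon>0 \<delta>0)
            show "(\<lambda>n. inner (zh n y - zh n t - (y - t) *\<^sub>R a) q) \<longlonglongrightarrow> inner (z y - z t - (y - t) *\<^sub>R a) q"
              by (intro tendsto_intros lim yT)
            show "\<exists>N. \<forall>n\<ge>N. - (\<eta> + \<epsilon> n + KQ * \<delta> n) * (integral {t..y} g + \<epsilon> n + (y - t) * norm a)
                \<le> inner (zh n y - zh n t - (y - t) *\<^sub>R a) q" using step by blast
          qed
          then have 1: "- \<eta> * (integral {t..y} g + (y - t) * norm a) \<le> inner (z y - z t - (y - t) *\<^sub>R a) q" by simp
          have "integral {t..y} g = integral {t..y} gi"
            by (rule integral_cong) (use t y in \<open>auto simp: gi_def\<close>)
          then have "integral {t..y} g \<le> G * (y - t)" using d1(2)[of y] y by simp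
          then have "\<eta> * (integral {t..y} g + (y - t) * norm a) \<le> \<eta> * (G * (y - t) + (y - t) * norm a)"
            using \<eta> by (intro mult_left_mono add_right_mono) auto
          with 1 have 2: "- (\<eta> * (G * (y - t) + (y - t) * norm a)) \<le> inner (z y - z t - (y - t) *\<^sub>R a) q" by simp
          define p where "p = z y - z t - (y - t) *\<^sub>R v t"
          have "inner p q \<le> norm p * norm q" by (rule norm_cauchy_schwarz)
          also have "\<dots> \<le> (\<eta> * (y - t)) * norm q"
            using d3(2)[of y] y by (intro mult_right_mono) (auto simp: p_def)
          finally have 3: "inner p q \<le> \<eta> * (y - t) * norm q" .
          have "z y - z t - (y - t) *\<^sub>R a = p + (y - t) *\<^sub>R (v t - a)" by (simp add: p_def algebra_simps)
          then have "inner (z y - z t - (y - t) *\<^sub>R a) q = inner p q + (y - t) * inner (v t - a) q"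
            by (simp add: inner_add_left)
          then have "(y - t) * (- \<eta> * (G + norm a + norm q)) \<le> (y - t) * inner (v t - a) q"
            using 2 3 by (simp add: algebra_simps)
          then have "- \<eta> * (G + norm a + norm q) \<le> inner (v t - a) q"
            by (rule mult_left_le_imp_le) (use y(1) in simp)
          then show "- \<eta> * (G + norm a + norm q) \<le> inner (v t - a) (W t - h)" by (simp add: q_def)
        qed
      qed
      then show "tderiv z t \<in> A (W t)" using der by (simp add: tderiv_def vector_derivative_at)
    qed
  qed
  then have "is_solution T A R Q z0 l z"
    using H1z z00 by (simp add: is_solution_def W_def)
  then show ?thesis using zM by blast
qed

text \<open>Compare \<open>w(t) = R l(t) - Q z(t)\<close> with \<open>w(s)\<close> at a point \<open>t\<close> of differentiability and let
  \<open>s \<rightarrow> t\<close> from the left.\<close>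

lemma velocity_bound:
  obtains K where "K > 0" "\<And>l z S t l' z'. (l has_vector_derivative l') (at t) \<Longrightarrow> (z has_vector_derivative z') (at t) \<Longrightarrow>
    0 < t \<Longrightarrow> z' \<in> A (R (l t) - Q (z t)) \<Longrightarrow>
    (\<And>s. 0 \<le> s \<Longrightarrow> s < t \<Longrightarrow> \<exists>a\<in>A (R (l s) - Q (z s)). norm a \<le> S) \<Longrightarrow>
    norm z' \<le> K * (norm l' + S)"
proof -
  obtain KR where KR: "KR > 0" "\<And>x. norm (R x) \<le> norm x * KR" using R.pos_bounded by blast
  obtain KQ where KQ: "KQ > 0" "\<And>x. norm (Q x) \<le> norm x * KQ" using P.pos_bounded by blast
  \<comment> \<open>Chosen so that \<open>\<gamma> * K = KR + KQ + \<gamma>\<close>, as the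
    contradiction at the end requires.\<close>
  define K where "K = KR / \<gamma> + KQ / \<gamma> + 1"
  have K: "K > 0" unfolding K_def using KR(1) KQ(1) \<gamma>_pos by (simp add: add_pos_pos)
  show thesis
  proof (rule that[OF K])
    fix l :: "real \<Rightarrow> 'x" and z S t l' z'
    assume l': "(l has_vector_derivative l') (at t)" and z': "(z has_vector_derivative z') (at t)"
      and t: "0 < t" and zA: "z' \<in> A (R (l t) - Q (z t))"
      and S: "\<And>s. 0 \<le> s \<Longrightarrow> s < t \<Longrightarrow> \<exists>a\<in>A (R (l s) - Q (z s)). norm a \<le> S"
    show "norm z' \<le> K * (norm l' + S)"
    proof -
      define w where "w s = R (l s) - Q (z s)" for s
      define w' where "w' = R l' - Q z'"
      have w': "(w has_vector_derivative w') (at t)"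
        unfolding w_def w'_def
        by (intro has_vector_derivative_diff R.has_vector_derivative P.has_vector_derivative l' z')
      have S0: "S \<ge> 0" using S[of 0] t norm_ge_zero order_trans by blast
      \<comment> \<open>The elements \<open>a\<close> at earlier times need not converge; the bound
        \<open>S\<close> on their norms is enough to divide by the time step and pass to the
        limit.\<close>
      have "0 \<le> inner z' w' + S * norm w'"
      proof (rule nonneg_if_ge_small_multiples[of "norm z' + S"])
        show "0 \<le> norm z' + S" using S0 by simp
        fix \<eta> :: real assume "\<eta> > 0"
        then obtain d where d: "d > 0" "\<And>y. norm (y - t) < d \<Longrightarrow> norm (w y - w t - (y - t) *\<^sub>R w') \<le> \<eta> * norm (y - t)"
          using w' unfolding has_vector_derivative_def has_derivative_at_alt by blast
        define h where "h = min (d / 2) t"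
        define s where "s = t - h"
        have h: "h > 0" "h < d" "0 \<le> s" "s < t" using d(1) t by (auto simp: h_def s_def)
        obtain a where a: "a \<in> A (w s)" "norm a \<le> S" using S[of s] h by (auto simp: w_def)
        define p where "p = w t - w s - h *\<^sub>R w'"
        have "norm (w s - w t - (s - t) *\<^sub>R w') \<le> \<eta> * h" using d(2)[of s] h by (simp add: s_def)
        moreover have "w s - w t - (s - t) *\<^sub>R w' = - p" by (simp add: p_def s_def)
        ultimately have p: "norm p \<le> \<eta> * h" by simp
        have D: "w t - w s = h *\<^sub>R w' + p" by (simp add: p_def)
        have "0 \<le> inner (z' - a) (w t - w s)"
          using maximal_monotoneD[OF A_maxmon zA a(1)] by (simp add: w_def)
        then have "0 \<le> inner z' (w t - w s) - inner a (w t - w s)" by (simp add: inner_diff_left)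
        moreover have "- inner a (w t - w s) \<le> S * norm (w t - w s)"
        proof -
          have "- inner a (w t - w s) \<le> norm a * norm (w t - w s)"
            using norm_cauchy_schwarz[of "- a" "w t - w s"] by simp
          also have "\<dots> \<le> S * norm (w t - w s)" using a(2) by (intro mult_right_mono) auto
          finally show ?thesis .
        qed
        moreover have "S * norm (w t - w s) \<le> S * (h * norm w' + \<eta> * h)"
        proof (rule mult_left_mono[OF _ S0])
          show "norm (w t - w s) \<le> h * norm w' + \<eta> * h"
            unfolding D using norm_triangle_ineq[of "h *\<^sub>R w'" p] p h(1) by simp
        qed
        moreover have "inner z' (w t - w s) \<le> h * inner z' w' + norm z' * (\<eta> * h)"
        proof -
          have "inner z' p \<le> norm z' * norm p" by (rule norm_cauchy_schwarz)
          also have "\<dots> \<le> norm z' * (\<eta> * h)" using p by (intro mult_left_mono) auto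
          finally show ?thesis unfolding D by (simp add: inner_add_right)
        qed
        ultimately have "0 \<le> h * inner z' w' + norm z' * (\<eta> * h) + S * (h * norm w' + \<eta> * h)" by linarith
        also have "\<dots> = h * (inner z' w' + S * norm w' + \<eta> * (norm z' + S))" by (simp add: algebra_simps)
        finally have "0 \<le> inner z' w' + S * norm w' + \<eta> * (norm z' + S)" using h(1) by (simp add: zero_le_mult_iff)
        then show "- \<eta> * (norm z' + S) \<le> inner z' w' + S * norm w'" by simp
      qed
      then have 1: "inner z' (Q z') \<le> inner z' (R l') + S * norm w'"
        by (simp add: w'_def inner_diff_right)
      define n L X where "n = norm z'" and "L = norm l'" and "X = L + S"
      have nn: "n \<ge> 0" "L \<ge> 0" "X \<ge> 0" "L \<le> X" "S \<le> X" using S0 by (auto simp: n_def L_def X_def)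
      have "inner z' (R l') \<le> n * (KR * L)"
        using order_trans[OF norm_cauchy_schwarz[of z' "R l'"] mult_left_mono[OF KR(2)[of l'] norm_ge_zero]]
        by (simp add: n_def L_def mult.commute)
      moreover have "S * norm w' \<le> S * (KR * L + KQ * n)"
      proof (rule mult_left_mono[OF _ S0])
        show "norm w' \<le> KR * L + KQ * n"
          unfolding w'_def using norm_triangle_ineq4[of "R l'" "Q z'"] KR(2)[of l'] KQ(2)[of z']
          by (simp add: n_def L_def mult.commute)
      qed
      moreover have "\<gamma> * n\<^sup>2 \<le> inner z' (Q z')" using coercive[of z'] by (simp add: n_def inner_commute)
      ultimately have 2: "\<gamma> * n\<^sup>2 \<le> n * (KR * L) + S * (KR * L + KQ * n)" using 1 by linarith
      \<comment> \<open>If \<open>n\<close> were larger, then \<open>\<gamma> * n\<close> would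
        exceed \<open>(KR + KQ + \<gamma>) * X\<close>. Replacing \<open>L\<close> and
        \<open>S\<close> by \<open>X\<close>, and one \<open>KR * X\<close> by
        \<open>\<gamma> * n\<close>, would make the right-hand side of the quadratic inequality
        smaller than its left-hand side.\<close>
      have "n \<le> K * X"
      proof (rule ccontr)
        assume "\<not> n \<le> K * X"
        then have n: "n > K * X" by simp
        then have n0: "n > 0" using K nn(3) by (meson less_imp_le mult_nonneg_nonneg order_le_less_trans)
        have "\<gamma> * K = KR + KQ + \<gamma>" using \<gamma>_pos by (simp add: K_def algebra_simps)
        moreover have "\<gamma> * (K * X) < \<gamma> * n" using n \<gamma>_pos by simp
        ultimately have 3: "(KR + KQ + \<gamma>) * X < \<gamma> * n" by (simp add: mult.assoc[symmetric])
        then have 4: "n * ((KR + KQ + \<gamma>) * X) < n * (\<gamma> * n)" using n0 by simp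
        have "(KR + 0 + 0) * X \<le> (KR + KQ + \<gamma>) * X"
          using KQ(1) \<gamma>_pos nn(3) by (intro mult_right_mono) auto
        then have "KR * X \<le> \<gamma> * n" using 3 by simp
        then have 5: "(KR * X) * X \<le> (\<gamma> * n) * X" using nn(3) by (rule mult_right_mono)
        have 6: "S * (KR * L) \<le> X * (KR * X)" using nn S0 KR(1) by (intro mult_mono) auto
        have 7: "n * (KR * L) \<le> n * (KR * X)" using nn KR(1) by (intro mult_left_mono) auto
        have 8: "S * (KQ * n) \<le> X * (KQ * n)" using nn KQ(1) by (intro mult_right_mono) auto
        show False using 2 4 5 6 7 8 by (simp add: power2_eq_square algebra_simps)
      qed
      then show ?thesis by (simp add: n_def X_def L_def)
    qed
  qed
qed

section \<open>Estimates\<close>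

text \<open>The inclusion places the argument in the domain for a dense set of times; continuity and
  closedness of the domain extend this to all times, end points included.\<close>

lemma solution_in_domain:
  assumes dom_closed: "closed (dom_op A)" and l: "H1 T l"
    and z: "is_solution T A R Q z0 l z" and t: "t \<in> {0..T}"
  shows "R (l t) - Q (z t) \<in> dom_op A"
proof -
  define W where "W t = R (l t) - Q (z t)" for t
  have H1z: "H1 T z" and ae: "AE t in lebesgue. t \<in> {0<..<T} \<longrightarrow> tderiv z t \<in> A (W t)"
    using z by (auto simp: is_solution_def W_def)
  have contW: "continuous_on {0..T} W"
    unfolding W_def
    by (intro continuous_intros R.continuous_on P.continuous_on H1_continuous_on[OF l T_pos] H1_continuous_on[OF H1z T_pos])
  have "W t \<in> closure (dom_op A)"
    unfolding closure_approachable
  proof (intro allI impI)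
    fix e :: real assume "e > 0"
    then obtain d where d: "d > 0" "\<And>r. r \<in> {0..T} \<Longrightarrow> dist r t < d \<Longrightarrow> dist (W r) (W t) < e"
      using contW t unfolding continuous_on_iff by metis
    define a b where "a = max 0 (t - d)" and "b = min T (t + d)"
    have "0 \<le> a" "a < b" "b \<le> T" using t d(1) T_pos by (auto simp: a_def b_def)
    then obtain r where r: "a < r" "r < b" "tderiv z r \<in> A (W r)"
      using AE_imp_exists_in_interval[OF ae] by blast
    have "W r \<in> dom_op A" using r(3) by (auto simp: dom_op_def)
    moreover have "dist (W r) (W t) < e" using r by (intro d(2)) (auto simp: a_def b_def dist_real_def)
    ultimately show "\<exists>y\<in>dom_op A. dist y (W t) < e" by blast
  qed
  then show ?thesis using dom_closed by (simp add: W_def)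
qed

text \<open>The pointwise \<open>velocity_bound\<close> is squared and integrated with
  \<open>S\<close> the supremum. That supremum is finite because the continuous argument has compact
  range inside the domain.\<close>

lemma derivative_estimate:
  assumes dom_closed: "closed (dom_op A)"
    and A0: "\<And>B. bounded B \<Longrightarrow> B \<subseteq> dom_op A \<Longrightarrow> bounded (min_section A ` B)"
  obtains C where "C > 0" "\<And>l z0 z. H1 T l \<Longrightarrow> is_solution T A R Q z0 l z \<Longrightarrow>
    L2_norm_on T (tderiv z) \<le>
      C * (L2_norm_on T (tderiv l) + Sup ((\<lambda>\<tau>. norm (min_section A (R (l \<tau>) - Q (z \<tau>)))) ` {0..T}))"
proof -
  obtain K where K: "K > 0" "\<And>l z S t l' z'. (l has_vector_derivative l') (at t) \<Longrightarrow> (z has_vector_derivative z') (at t) \<Longrightarrow>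
    0 < t \<Longrightarrow> z' \<in> A (R (l t) - Q (z t)) \<Longrightarrow>
    (\<And>s. 0 \<le> s \<Longrightarrow> s < t \<Longrightarrow> \<exists>a\<in>A (R (l s) - Q (z s)). norm a \<le> S) \<Longrightarrow>
    norm z' \<le> K * (norm l' + S)"
    using velocity_bound by blast
  \<comment> \<open>\<open>sqrt 2\<close> comes from squaring a sum, and \<open>sqrt T\<close> from
    the L2 norm of the constant \<open>S\<close>.\<close>
  define C where "C = sqrt 2 * K * (1 + sqrt T)"
  show thesis
  proof (rule that)
    show C: "C > 0" using K(1) T_pos by (simp add: C_def add_pos_pos)
    fix l z0 z assume l: "H1 T l" and z: "is_solution T A R Q z0 l z"
    define W where "W t = R (l t) - Q (z t)" for t
    have H1z: "H1 T z" and ae: "AE t in lebesgue. t \<in> {0<..<T} \<longrightarrow> tderiv z t \<in> A (W t)"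
      using z by (auto simp: is_solution_def W_def)
    have contW: "continuous_on {0..T} W"
      unfolding W_def
      by (intro continuous_intros R.continuous_on P.continuous_on H1_continuous_on[OF l T_pos] H1_continuous_on[OF H1z T_pos])
    have dom: "W t \<in> dom_op A" if "t \<in> {0..T}" for t
      using solution_in_domain[OF dom_closed l z that] by (simp add: W_def)
    have "compact (W ` {0..T})" using contW by (intro compact_continuous_image) auto
    then have "bounded (min_section A ` (W ` {0..T}))"
      using dom by (intro A0 compact_imp_bounded) auto
    then have "bdd_above (norm ` min_section A ` W ` {0..T})"
      by (intro bounded_imp_bdd_above) (simp add: bounded_norm_comp)
    then have bdd: "bdd_above ((\<lambda>\<tau>. norm (min_section A (W \<tau>))) ` {0..T})"
      by (simp add: image_image)
    define S where "S = Sup ((\<lambda>\<tau>. norm (min_section A (W \<tau>))) ` {0..T})"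
    have S: "norm (min_section A (W s)) \<le> S" if "s \<in> {0..T}" for s
      unfolding S_def using bdd that by (intro cSup_upper) auto
    have S0: "S \<ge> 0" using order_trans[OF norm_ge_zero S[of 0]] T_pos by simp
    obtain v where v: "set_integrable lebesgue {0..T} (\<lambda>t. (norm (v t))\<^sup>2)"
      "AE t in lebesgue. t \<in> {0..T} \<longrightarrow> (l has_vector_derivative v t) (at t)"
      "L2_norm_on T (tderiv l) = sqrt (integral {0..T} (\<lambda>t. (norm (v t))\<^sup>2))"
      by (rule H1_obtain[OF l T_pos], rule that)
    obtain u where u: "set_integrable lebesgue {0..T} (\<lambda>t. (norm (u t))\<^sup>2)"
      "AE t in lebesgue. t \<in> {0..T} \<longrightarrow> (z has_vector_derivative u t) (at t)"
      "L2_norm_on T (tderiv z) = sqrt (integral {0..T} (\<lambda>t. (norm (u t))\<^sup>2))"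
      by (rule H1_obtain[OF H1z T_pos], rule that)
    note vi = set_lebesgue_integral_eq_integral(1)[OF v(1)] and ui = set_lebesgue_integral_eq_integral(1)[OF u(1)]
    have "AE t in lebesgue. t \<in> {0..T} \<longrightarrow> norm (u t) \<le> K * (norm (v t) + S)"
      using ae v(2) u(2) AE_lebesgue_neq[of 0] AE_lebesgue_neq[of T]
    proof eventually_elim
      case (elim t)
      show ?case
      proof
        assume t: "t \<in> {0..T}"
        show "norm (u t) \<le> K * (norm (v t) + S)"
        proof (rule K(2))
          show "(l has_vector_derivative v t) (at t)" "(z has_vector_derivative u t) (at t)" "0 < t"
            using elim t by auto
          then show "u t \<in> A (R (l t) - Q (z t))"
            using elim t by (auto simp: tderiv_def W_def vector_derivative_at)
          show "\<exists>a\<in>A (R (l s) - Q (z s)). norm a \<le> S" if "0 \<le> s" "s < t" for s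
            using min_section_in[OF A_maxmon dom[of s]] S[of s] that t by (auto simp: W_def)
        qed
      qed
    qed
    then have le: "AE t in lebesgue. t \<in> {0..T} \<longrightarrow> (norm (u t))\<^sup>2 \<le> 2 * K\<^sup>2 * ((norm (v t))\<^sup>2 + S\<^sup>2)"
    proof eventually_elim
      case (elim t)
      show ?case
      proof
        assume "t \<in> {0..T}"
        then have "(norm (u t))\<^sup>2 \<le> (K * (norm (v t) + S))\<^sup>2" using elim by (intro power_mono) auto
        also have "\<dots> = K\<^sup>2 * (norm (v t) + S)\<^sup>2" by (rule power_mult_distrib)
        also have "\<dots> \<le> K\<^sup>2 * (2 * ((norm (v t))\<^sup>2 + S\<^sup>2))"
          using sum_squares_bound[of "norm (v t)" S] by (intro mult_left_mono) (auto simp: power2_sum)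
        finally show "(norm (u t))\<^sup>2 \<le> 2 * K\<^sup>2 * ((norm (v t))\<^sup>2 + S\<^sup>2)" by (simp add: algebra_simps)
      qed
    qed
    define J where "J = integral {0..T} (\<lambda>t. (norm (v t))\<^sup>2)"
    have J0: "J \<ge> 0" unfolding J_def using vi by (intro integral_nonneg) auto
    have hi: "((\<lambda>t. 2 * K\<^sup>2 * ((norm (v t))\<^sup>2 + S\<^sup>2)) has_integral 2 * K\<^sup>2 * (J + T * S\<^sup>2)) {0..T}"
      unfolding J_def using has_integral_const_real[of "S\<^sup>2" 0 T] T_pos vi
      by (intro has_integral_mult_right has_integral_add integrable_integral) auto
    have "integral {0..T} (\<lambda>t. (norm (u t))\<^sup>2) \<le> 2 * K\<^sup>2 * (J + T * S\<^sup>2)"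
      using integral_le_AE[OF ui has_integral_integrable[OF hi] le] unfolding integral_unique[OF hi] .
    then have "L2_norm_on T (tderiv z) \<le> sqrt (2 * K\<^sup>2 * (J + T * S\<^sup>2))"
      unfolding u(3) by (rule real_sqrt_le_mono)
    also have "\<dots> = sqrt 2 * K * sqrt (J + T * S\<^sup>2)" using K(1) by (simp add: real_sqrt_mult)
    also have "\<dots> \<le> sqrt 2 * K * (sqrt J + sqrt T * S)"
    proof (rule mult_left_mono)
      have "sqrt (J + T * S\<^sup>2) \<le> sqrt J + sqrt (T * S\<^sup>2)"
        using J0 T_pos by (intro sqrt_add_le_add_sqrt) auto
      then show "sqrt (J + T * S\<^sup>2) \<le> sqrt J + sqrt T * S" using S0 by (simp add: real_sqrt_mult)
    qed (use K(1) in simp)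
    also have "\<dots> \<le> sqrt 2 * K * ((1 + sqrt T) * (sqrt J + S))"
      using K(1) J0 S0 T_pos by (intro mult_left_mono) (auto simp: algebra_simps)
    also have "\<dots> = C * (L2_norm_on T (tderiv l) + S)" by (simp add: C_def v(3) J_def)
    finally show "L2_norm_on T (tderiv z) \<le>
      C * (L2_norm_on T (tderiv l) + Sup ((\<lambda>\<tau>. norm (min_section A (R (l \<tau>) - Q (z \<tau>)))) ` {0..T}))"
      by (simp only: S_def W_def)
  qed
qed

end

theorem mainTheorem1:
  fixes T :: real
    and A :: "'h::{real_inner,banach} \<Rightarrow> 'h set"
    and R :: "'x::banach \<Rightarrow> 'h"
    and Q :: "'h \<Rightarrow> 'h"
  assumes T_pos: "T > 0"
    and H_separable: "\<exists>D::'h set. countable D \<and> closure D = UNIV"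
    and A_maxmon: "maximal_monotone A"
    and A_dom_closed: "closed (dom_op A)"
    and A0_bdd: "\<forall>B. bounded B \<and> B \<subseteq> dom_op A \<longrightarrow> bounded (min_section A ` B)"
    and R_lin: "bounded_linear R"
    and Q_lin: "bounded_linear Q"
    and Q_selfadj: "\<forall>h k. inner (Q h) k = inner h (Q k)"
    and Q_coercive: "\<exists>\<gamma>>0. \<forall>h. inner (Q h) h \<ge> \<gamma> * (norm h)\<^sup>2"
  shows "\<exists>C>0. \<forall>z0 l. l \<in> admissible T R Q z0 (dom_op A) \<longrightarrow>
           (\<exists>z. is_solution T A R Q z0 l z \<and>
                (\<forall>z'. is_solution T A R Q z0 l z' \<longrightarrow> (\<forall>t\<in>{0..T}. z' t = z t))) \<and>
           (\<forall>z. is_solution T A R Q z0 l z \<longrightarrow>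
              sup_norm_on T z \<le> C * (1 + norm z0 + sup_norm_on T l + L1_norm_on T (tderiv l)) \<and>
              L2_norm_on T (tderiv z) \<le>
                C * (L2_norm_on T (tderiv l) +
                     Sup ((\<lambda>\<tau>. norm (min_section A (R (l \<tau>) - Q (z \<tau>)))) ` {0..T})))"
proof -
  obtain \<gamma> where \<gamma>: "\<gamma> > 0" "\<And>h. \<gamma> * (norm h)\<^sup>2 \<le> inner (Q h) h" using Q_coercive by blast
  have "state_equation Q \<gamma> T A R"
    using Q_lin Q_selfadj \<gamma> T_pos A_maxmon R_lin
    by (intro state_equation.intro coercive_operator.intro state_equation_axioms.intro) auto
  then interpret state_equation Q \<gamma> T A R .
  have A0: "bounded (min_section A ` B)" if "bounded B" "B \<subseteq> dom_op A" for B
    using A0_bdd that by blast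
  show ?thesis
  \<comment> \<open>Without domain no load is admissible and any constant works; otherwise
    \<open>euler_bound\<close> has a pair to compare with.\<close>
  proof (cases "dom_op A = {}")
    case True
    then show ?thesis by (intro exI[of _ 1]) (simp add: admissible_def)
  next
    case False
    obtain C1 where C1: "C1 > 0" "euler_bound_const C1"
      using euler_bound[OF False] by blast
    obtain C2 where C2: "C2 > 0" "\<And>l z0 z. H1 T l \<Longrightarrow> is_solution T A R Q z0 l z \<Longrightarrow>
      L2_norm_on T (tderiv z) \<le>
        C2 * (L2_norm_on T (tderiv l) + Sup ((\<lambda>\<tau>. norm (min_section A (R (l \<tau>) - Q (z \<tau>)))) ` {0..T}))"
      by (rule derivative_estimate[OF A_dom_closed A0], assumption+, rule that)
    have main: "(\<exists>z. is_solution T A R Q z0 l z \<and>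
                (\<forall>z'. is_solution T A R Q z0 l z' \<longrightarrow> (\<forall>t\<in>{0..T}. z' t = z t))) \<and>
           (\<forall>z. is_solution T A R Q z0 l z \<longrightarrow>
              sup_norm_on T z \<le> max C1 C2 * (1 + norm z0 + sup_norm_on T l + L1_norm_on T (tderiv l)) \<and>
              L2_norm_on T (tderiv z) \<le>
                max C1 C2 * (L2_norm_on T (tderiv l) +
                     Sup ((\<lambda>\<tau>. norm (min_section A (R (l \<tau>) - Q (z \<tau>)))) ` {0..T})))"
      if adm: "l \<in> admissible T R Q z0 (dom_op A)" for z0 l
    proof -
      have l: "H1 T l" and init: "R (l 0) - Q z0 \<in> dom_op A" using adm by (auto simp: admissible_def)
      define D where "D = 1 + norm z0 + sup_norm_on T l + L1_norm_on T (tderiv l)"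
      obtain g B where gB: "g integrable_on {0..T}" "\<And>t. 0 \<le> g t"
        "\<And>\<epsilon>. \<epsilon> > 0 \<Longrightarrow> \<exists>\<zeta>. approx_solution l z0 g B
          (C1 * (1 + norm z0 + sup_norm_on T l + L1_norm_on T (tderiv l))) \<epsilon> \<zeta>"
        by (rule approx_solution_exists[OF _ l init C1], erule (1) A0, rule that)
      have "\<exists>z. is_solution T A R Q z0 l z \<and> (\<forall>t\<in>{0..T}. norm (z t) \<le> C1 * D)"
        unfolding D_def by (rule limit_of_approx_solutions[OF l gB(1)], rule gB(2), erule gB(3))
      then obtain z where z: "is_solution T A R Q z0 l z" "\<And>t. t \<in> {0..T} \<Longrightarrow> norm (z t) \<le> C1 * D"
        by blast
      have uniq: "z' t = z t" if "is_solution T A R Q z0 l z'" "t \<in> {0..T}" for z' t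
        using solution_unique[OF z(1) that] .
      have D0: "0 \<le> C1 * D" using order_trans[OF norm_ge_zero z(2)[of 0]] T_pos by simp
      have Dpos: "D \<ge> 0" using D0 C1(1) by (simp add: zero_le_mult_iff)
      \<comment> \<open>By uniqueness the bound for the constructed solution carries over to every
        solution, since the supremum sees only \<open>{0..T}\<close>.\<close>
      have est1: "sup_norm_on T z' \<le> max C1 C2 * D" if s: "is_solution T A R Q z0 l z'" for z'
      proof -
        have "sup_norm_on T z' \<le> C1 * D"
          unfolding sup_norm_on_def
          using T_pos uniq[OF s] z(2) by (intro cSup_least) auto
        also have "\<dots> \<le> max C1 C2 * D" using Dpos by (intro mult_right_mono) auto
        finally show ?thesis .
      qed
      have est2: "L2_norm_on T (tderiv z') \<le> max C1 C2 * (L2_norm_on T (tderiv l) +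
                     Sup ((\<lambda>\<tau>. norm (min_section A (R (l \<tau>) - Q (z' \<tau>)))) ` {0..T}))"
        (is "_ \<le> _ * ?E") if s: "is_solution T A R Q z0 l z'" for z'
      proof -
        have 1: "L2_norm_on T (tderiv z') \<le> C2 * ?E" by (rule C2(2)[OF l s])
        have "0 \<le> L2_norm_on T (tderiv z')"
          unfolding L2_norm_on_def set_lebesgue_integral_def by (intro real_sqrt_ge_zero integral_nonneg_AE) auto
        \<comment> \<open>Enlarging the constant to the maximum requires a nonnegative bracket,
          which is read off from the estimate itself.\<close>
        then have "0 \<le> C2 * ?E" using 1 by linarith
        then have "0 \<le> ?E" using C2(1) by (simp add: zero_le_mult_iff)
        then have "C2 * ?E \<le> max C1 C2 * ?E" by (intro mult_right_mono) auto
        then show ?thesis using 1 by linarith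
      qed
      show ?thesis
      proof (intro conjI exI[of _ z] allI impI ballI)
        show "sup_norm_on T z' \<le> max C1 C2 * (1 + norm z0 + sup_norm_on T l + L1_norm_on T (tderiv l))"
          if "is_solution T A R Q z0 l z'" for z'
          using est1[OF that] by (simp only: D_def)
      qed (fact z(1), erule (1) uniq, erule est2)
    qed
    have "max C1 C2 > 0" using C1(1) by simp
    then show ?thesis
      by (intro exI[of _ "max C1 C2"] conjI[of "max C1 C2 > 0"] allI impI main)
  qed
qed

end
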